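(* Let $s\ge0$ and $u_0\in H^s(\mathbb{T})$. The local-in-time solution of the BBM equation $$u_t+u_x+uu_x-u_{xxt}=0,\quad x\in\mathbb{T},\qquad u(0,x)=u_0(x),$$ is global in time; that is, for every $T>0$ there is a unique solution $u\in X^s_T=C^0([-T,T],H^s(\mathbb{T}))$ with initial data $u_0$.
   Context: $\mathbb{T}=\mathbb{R}/2\pi\mathbb{Z}$; functions are real-valued. $H^s(\mathbb{T})$ has norm $\|u\|_{H^s}=\|\langle k\rangle^s\widehat{u}(k)\|_{\ell^2_k}$, with $\langle k\rangle=(1+k^2)^{1/2}$. $X^s_T=C^0([-T,T],H^s(\mathbb{T}))$ with the sup norm in time. Let $\varphi(k)=\frac{k}{1+k^2}$ and let $\varphi(D)$ be the Fourier multiplier $\widehat{\varphi(D)u}(k)=\varphi(k)\widehat{u}(k)$. A function $u\in X^s_T$ is a solution of the BBM equation with initial data $u_0$ if $$u(t)=e^{-it\varphi(D)}u_0-\frac{i}{2}\int_0^t e^{-i(t-\tau)\varphi(D)}\varphi(D)\left(u(\tau)^2\right)d\tau\quad\text{for all } t\in[-T,T].$$ For every $u_0\in H^s(\mathbb{T})$ with $s\ge0$ there is some $T>0$ (depending on $u_0$) for which a unique such local solution in $X^s_T$ exists. *)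

theory Defs
  imports "HOL-Analysis.Analysis"
begin

section \<open>The Hilbert space of square-integrable functions on the circle\<close>

text \<open>
  Functions on the circle \<open>\<real> / 2\<pi>\<int>\<close> are \<open>2\<pi>\<close>-periodic functions on the real line; integrals
  are taken over one period.
\<close>

definition torus :: "real measure" where
  "torus = restrict_space lborel {-pi..pi}"

definition L2_fun :: "(real \<Rightarrow> complex) set" where
  "L2_fun = {f \<in> borel_measurable borel.
     (\<forall>x. f (x + 2 * pi) = f x) \<and> integrable torus (\<lambda>x. (cmod (f x))\<^sup>2)}"

definition L2_rel :: "(real \<Rightarrow> complex) \<Rightarrow> (real \<Rightarrow> complex) \<Rightarrow> bool" where
  "L2_rel f g \<longleftrightarrow> f \<in> L2_fun \<and> g \<in> L2_fun \<and> (AE x in torus. f x = g x)"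

lemma L2_fun_measurable: "f \<in> L2_fun \<Longrightarrow> f \<in> borel_measurable torus"
  unfolding L2_fun_def torus_def by (auto intro!: measurable_restrict_space1)

lemma L2_fun_integrable: "f \<in> L2_fun \<Longrightarrow> integrable torus (\<lambda>x. (cmod (f x))\<^sup>2)"
  by (simp add: L2_fun_def)

lemma L2_fun_zero: "(\<lambda>x. 0) \<in> L2_fun"
  by (simp add: L2_fun_def)

lemma L2_fun_integrable_mult:
  assumes "f \<in> L2_fun" "g \<in> L2_fun"
  shows "integrable torus (\<lambda>x. f x * cnj (g x))"
proof (rule Bochner_Integration.integrable_bound)
  show "integrable torus (\<lambda>x. (cmod (f x))\<^sup>2 + (cmod (g x))\<^sup>2)"
    using assms by (simp add: L2_fun_integrable)
  have m [measurable]: "f \<in> borel_measurable torus" "g \<in> borel_measurable torus"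
    using assms by (simp_all add: L2_fun_measurable)
  have "(\<lambda>x. cnj (g x)) \<in> borel_measurable torus"
    by (rule borel_measurable_continuous_on[OF _ m(2)]) (intro continuous_intros)
  then show "(\<lambda>x. f x * cnj (g x)) \<in> borel_measurable torus"
    by measurable
  have "a * b \<le> a\<^sup>2 + b\<^sup>2" for a b :: real
    using sum_squares_bound[of a b] sum_squares_bound[of a "- b"] by (simp add: power2_eq_square)
  then show "AE x in torus. norm (f x * cnj (g x)) \<le> norm ((cmod (f x))\<^sup>2 + (cmod (g x))\<^sup>2)"
    by (simp add: norm_mult)
qed

lemma L2_fun_add:
  assumes "f \<in> L2_fun" "g \<in> L2_fun"
  shows "(\<lambda>x. f x + g x) \<in> L2_fun"
proof -
  have m [measurable]: "f \<in> borel_measurable borel" "g \<in> borel_measurable borel"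
    using assms by (simp_all add: L2_fun_def)
  have "integrable torus (\<lambda>x. (cmod (f x + g x))\<^sup>2)"
  proof (rule Bochner_Integration.integrable_bound)
    show "integrable torus (\<lambda>x. 2 * (cmod (f x))\<^sup>2 + 2 * (cmod (g x))\<^sup>2)"
      using assms by (simp add: L2_fun_integrable)
    have [measurable]: "f \<in> borel_measurable torus" "g \<in> borel_measurable torus"
      using assms by (simp_all add: L2_fun_measurable)
    show "(\<lambda>x. (cmod (f x + g x))\<^sup>2) \<in> borel_measurable torus"
      by measurable
    have "(cmod (f x + g x))\<^sup>2 \<le> 2 * (cmod (f x))\<^sup>2 + 2 * (cmod (g x))\<^sup>2" for x
    proof -
      have "(cmod (f x + g x))\<^sup>2 \<le> (cmod (f x) + cmod (g x))\<^sup>2"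
        by (intro power_mono norm_triangle_ineq) simp
      also have "\<dots> \<le> 2 * (cmod (f x))\<^sup>2 + 2 * (cmod (g x))\<^sup>2"
        using sum_squares_bound[of "cmod (f x)" "cmod (g x)"] by (simp add: power2_sum)
      finally show ?thesis .
    qed
    then show "AE x in torus. norm ((cmod (f x + g x))\<^sup>2)
        \<le> norm (2 * (cmod (f x))\<^sup>2 + 2 * (cmod (g x))\<^sup>2)"
      by simp
  qed
  then show ?thesis
    using assms by (simp add: L2_fun_def)
qed

lemma L2_fun_cmult: "f \<in> L2_fun \<Longrightarrow> (\<lambda>x. c * f x) \<in> L2_fun"
  by (auto simp: L2_fun_def norm_mult power_mult_distrib
      intro!: borel_measurable_times borel_measurable_const)

lemma part_equivp_L2_rel: "part_equivp L2_rel"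
proof (rule part_equivpI)
  show "\<exists>f. L2_rel f f"
    using L2_fun_zero by (auto simp: L2_rel_def)
  show "symp L2_rel"
    by (rule sympI) (auto simp: L2_rel_def eq_commute)
  show "transp L2_rel"
    by (rule transpI) (auto simp: L2_rel_def elim: AE_mp)
qed

quotient_type L2_torus = "real \<Rightarrow> complex" / partial: L2_rel
  by (rule part_equivp_L2_rel)

text \<open>
  The inner product is normalised by \<open>1 / 2\<pi>\<close>, so that the exponentials \<open>e\<^sup>i\<^sup>k\<^sup>x\<close> are orthonormal.
  The class \<open>real_inner\<close> asks for the real part of the usual Hermitian product; the
  resulting norm is the same.
\<close>

instantiation L2_torus :: real_inner
begin

lift_definition zero_L2_torus :: L2_torus is "\<lambda>x. 0"
  by (simp add: L2_rel_def L2_fun_zero)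

lift_definition plus_L2_torus :: "L2_torus \<Rightarrow> L2_torus \<Rightarrow> L2_torus" is "\<lambda>f g x. f x + g x"
  by (auto simp: L2_rel_def L2_fun_add elim: AE_mp)

lift_definition uminus_L2_torus :: "L2_torus \<Rightarrow> L2_torus" is "\<lambda>f x. - 1 * f x"
  unfolding L2_rel_def by (intro conjI L2_fun_cmult) (auto elim: AE_mp)

definition minus_L2_torus :: "L2_torus \<Rightarrow> L2_torus \<Rightarrow> L2_torus" where
  "minus_L2_torus f g = f + - g"

lift_definition scaleR_L2_torus :: "real \<Rightarrow> L2_torus \<Rightarrow> L2_torus" is
  "\<lambda>r f x. complex_of_real r * f x"
  unfolding L2_rel_def by (intro conjI L2_fun_cmult) (auto elim: AE_mp)

lift_definition inner_L2_torus :: "L2_torus \<Rightarrow> L2_torus \<Rightarrow> real" is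
  "\<lambda>f g. Re (LINT x|torus. f x * cnj (g x)) / (2 * pi)"
proof -
  fix f f' g g' :: "real \<Rightarrow> complex"
  assume *: "L2_rel f f'" "L2_rel g g'"
  have "(LINT x|torus. f x * cnj (g x)) = (LINT x|torus. f' x * cnj (g' x))"
  proof (rule integral_cong_AE)
    show "(\<lambda>x. f x * cnj (g x)) \<in> borel_measurable torus"
      "(\<lambda>x. f' x * cnj (g' x)) \<in> borel_measurable torus"
      using * by (auto simp: L2_rel_def intro: borel_measurable_integrable L2_fun_integrable_mult)
    show "AE x in torus. f x * cnj (g x) = f' x * cnj (g' x)"
      using * by (auto simp: L2_rel_def elim: AE_mp)
  qed
  then show "Re (LINT x|torus. f x * cnj (g x)) / (2 * pi)
      = Re (LINT x|torus. f' x * cnj (g' x)) / (2 * pi)"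
    by simp
qed

definition norm_L2_torus :: "L2_torus \<Rightarrow> real" where
  "norm_L2_torus f = sqrt (inner f f)"

definition sgn_L2_torus :: "L2_torus \<Rightarrow> L2_torus" where
  "sgn_L2_torus f = inverse (norm f) *\<^sub>R f"

definition dist_L2_torus :: "L2_torus \<Rightarrow> L2_torus \<Rightarrow> real" where
  "dist_L2_torus f g = norm (f - g)"

definition uniformity_L2_torus :: "(L2_torus \<times> L2_torus) filter" where
  "uniformity_L2_torus = (INF e\<in>{0<..}. principal {(f, g). dist f g < e})"

definition open_L2_torus :: "L2_torus set \<Rightarrow> bool" where
  "open_L2_torus U \<longleftrightarrow> (\<forall>f\<in>U. \<forall>\<^sub>F (f', g) in uniformity. f' = f \<longrightarrow> g \<in> U)"

instance
proof
  fix f g h :: L2_torus and r q :: real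
  show "f + g + h = f + (g + h)"
    by transfer (auto simp: L2_rel_def add.assoc intro!: L2_fun_add)
  show "f + g = g + f"
    by transfer (auto simp: L2_rel_def add.commute intro!: L2_fun_add)
  show "0 + f = f"
    by transfer (auto simp: L2_rel_def)
  show "- f + f = 0"
    by transfer (auto simp: L2_rel_def L2_fun_zero)
  show "f - g = f + - g"
    by (rule minus_L2_torus_def)
  show "r *\<^sub>R (f + g) = r *\<^sub>R f + r *\<^sub>R g"
    by transfer (auto simp: L2_rel_def distrib_left intro!: L2_fun_add L2_fun_cmult)
  show "(r + q) *\<^sub>R f = r *\<^sub>R f + q *\<^sub>R f"
    by transfer (auto simp: L2_rel_def distrib_right intro!: L2_fun_add L2_fun_cmult)
  show "r *\<^sub>R q *\<^sub>R f = (r * q) *\<^sub>R f"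
    by transfer (auto simp: L2_rel_def mult.assoc intro!: L2_fun_cmult)
  show "1 *\<^sub>R f = f"
    by transfer (auto simp: L2_rel_def)
  show "dist f g = norm (f - g)"
    by (rule dist_L2_torus_def)
  show "sgn f = inverse (norm f) *\<^sub>R f"
    by (rule sgn_L2_torus_def)
  show "uniformity = (INF e\<in>{0<..}. principal {(f, g::L2_torus). dist f g < e})"
    by (rule uniformity_L2_torus_def)
  show "open U \<longleftrightarrow> (\<forall>f\<in>U. \<forall>\<^sub>F (f', g) in uniformity. f' = f \<longrightarrow> g \<in> U)" for U :: "L2_torus set"
    by (rule open_L2_torus_def)
  show "norm f = sqrt (inner f f)"
    by (rule norm_L2_torus_def)
  show "inner f g = inner g f"
  proof transfer
    fix f g :: "real \<Rightarrow> complex"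
    assume "L2_rel f f" "L2_rel g g"
    have "(LINT x|torus. f x * cnj (g x)) = (LINT x|torus. cnj (g x * cnj (f x)))"
      by (simp add: mult.commute)
    also have "\<dots> = cnj (LINT x|torus. g x * cnj (f x))"
      by (rule Bochner_Integration.integral_cnj)
    finally show "Re (LINT x|torus. f x * cnj (g x)) / (2 * pi)
        = Re (LINT x|torus. g x * cnj (f x)) / (2 * pi)"
      by simp
  qed
  show "inner (f + g) h = inner f h + inner g h"
    by transfer (simp add: L2_rel_def distrib_right L2_fun_integrable_mult add_divide_distrib)
  show "inner (r *\<^sub>R f) g = r * inner f g"
    by transfer (simp add: L2_rel_def mult.assoc)
  have eq: "Re (LINT x|torus. f x * cnj (f x)) = (LINT x|torus. (cmod (f x))\<^sup>2)" for f
    by (simp add: complex_norm_square[symmetric] del: of_real_power)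
  show "0 \<le> inner f f"
    by transfer (simp add: eq)
  show "inner f f = 0 \<longleftrightarrow> f = 0"
  proof transfer
    fix f :: "real \<Rightarrow> complex"
    assume "L2_rel f f"
    then have f: "f \<in> L2_fun"
      by (simp add: L2_rel_def)
    show "(Re (LINT x|torus. f x * cnj (f x)) / (2 * pi) = 0) = L2_rel f (\<lambda>x. 0)"
      using integral_nonneg_eq_0_iff_AE[OF L2_fun_integrable[OF f]] f
      by (simp add: eq L2_rel_def L2_fun_zero)
  qed
qed

end

lift_definition scaleC :: "complex \<Rightarrow> L2_torus \<Rightarrow> L2_torus" is "\<lambda>c f x. c * f x"
  unfolding L2_rel_def by (intro conjI L2_fun_cmult) (auto elim: AE_mp)

section \<open>Fourier multipliers and Sobolev spaces\<close>

definition fourier_coeff :: "(real \<Rightarrow> complex) \<Rightarrow> int \<Rightarrow> complex" where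
  "fourier_coeff f k = (LINT x|torus. f x * exp (- \<i> * of_real (of_int k * x))) / of_real (2 * pi)"

abbreviation L2_coeff :: "L2_torus \<Rightarrow> int \<Rightarrow> complex" where
  "L2_coeff u \<equiv> fourier_coeff (rep_L2_torus u)"

text \<open>
  The multiplier with symbol \<open>m\<close> acts on functions that need only be integrable, because the square
  of an \<open>L\<^sup>2\<close> function is in general only in \<open>L\<^sup>1\<close>. All multipliers used below map into \<open>L\<^sup>2\<close>.
  Fourier coefficients determine an element of \<open>L\<^sup>2\<close> uniquely.
\<close>

definition multiplier :: "(int \<Rightarrow> complex) \<Rightarrow> (real \<Rightarrow> complex) \<Rightarrow> L2_torus" where
  "multiplier m f = (THE g. \<forall>k. L2_coeff g k = m k * fourier_coeff f k)"

definition bracket :: "int \<Rightarrow> real" where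
  "bracket k = sqrt (1 + (of_int k)\<^sup>2)"

definition real_valued :: "L2_torus \<Rightarrow> bool" where
  "real_valued u \<longleftrightarrow> (AE x in torus. rep_L2_torus u x \<in> \<real>)"

definition Hs :: "real \<Rightarrow> L2_torus set" where
  "Hs s = {u. real_valued u \<and>
     (\<lambda>k. (bracket k powr s * cmod (L2_coeff u k))\<^sup>2) summable_on UNIV}"

definition Hs_norm :: "real \<Rightarrow> L2_torus \<Rightarrow> real" where
  "Hs_norm s u = sqrt (\<Sum>\<^sub>\<infinity>k. (bracket k powr s * cmod (L2_coeff u k))\<^sup>2)"

text \<open>
  Functions on the time interval are total functions that are \<open>undefined\<close> outside the interval,
  so that equality means equality on the interval.
\<close>

definition Xs :: "real \<Rightarrow> real \<Rightarrow> (real \<Rightarrow> L2_torus) set" where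
  "Xs s T = {u \<in> {-T..T} \<rightarrow>\<^sub>E Hs s.
     \<forall>t\<in>{-T..T}. ((\<lambda>\<tau>. Hs_norm s (u \<tau> - u t)) \<longlongrightarrow> 0) (at t within {-T..T})}"

section \<open>The BBM equation\<close>

definition phi :: "int \<Rightarrow> real" where
  "phi k = of_int k / (1 + (of_int k)\<^sup>2)"

definition phi_D :: "(real \<Rightarrow> complex) \<Rightarrow> L2_torus" where
  "phi_D f = multiplier (\<lambda>k. of_real (phi k)) f"

definition propagator :: "real \<Rightarrow> L2_torus \<Rightarrow> L2_torus" where
  "propagator t u = multiplier (\<lambda>k. exp (- \<i> * of_real (t * phi k))) (rep_L2_torus u)"

definition oriented_integral :: "real \<Rightarrow> real \<Rightarrow> (real \<Rightarrow> 'a::real_normed_vector) \<Rightarrow> 'a" where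
  "oriented_integral a b F = (if a \<le> b then integral {a..b} F else - integral {b..a} F)"

text \<open>
  The equation in integrated (Duhamel) form. The time integral is taken in \<open>L\<^sup>2\<close>; for \<open>u\<close> in
  \<open>Xs s T\<close> with \<open>s \<ge> 0\<close> the integrand, multiplied by \<open>\<i>\<close>, is continuous into \<open>H\<^sup>s\<close>, and its
  integral in \<open>H\<^sup>s\<close> is the same element. The function \<open>\<phi>\<close> is odd, so \<open>\<phi>(D)\<close> maps real functions to imaginary ones, and the
  right-hand side is real.
\<close>

definition bbm_solution :: "real \<Rightarrow> L2_torus \<Rightarrow> (real \<Rightarrow> L2_torus) \<Rightarrow> bool" where
  "bbm_solution T u0 u \<longleftrightarrow> (\<forall>t\<in>{-T..T}.
     u t = propagator t u0 - scaleC (\<i> / 2)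
       (oriented_integral 0 t
         (\<lambda>\<tau>. propagator (t - \<tau>) (phi_D (\<lambda>x. (rep_L2_torus (u \<tau>) x)\<^sup>2)))))"

end

(*
  In L^2 the equation is an ordinary differential equation u' = F(u) with
  F(u) = -i phi(D)(u + u^2/2). Since the Fourier coefficients of u^2 are bounded by |u|^2 and phi is
  square summable, F is locally Lipschitz; with its argument truncated radially it is globally
  Lipschitz and has a global flow, so that only an a priori L^2 bound is missing.

  The bound is proved for the Galerkin systems, uniformly in the frequency cutoff, by the splitting
  of Bona and Tzvetkov. The high frequencies of the data launch a solution v that stays small on
  [-T,T]. The difference w = u - v starts from finitely many modes and satisfies
  w_t + w_x - w_xxt + w w_x + (v w)_x = 0, so the derivative of its squared H^1 norm is a multiple of
  the integral of v w w_x, which is at most C |v|_{L^2} |w|_{H^1}^2; Gronwall's inequality applies.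
  The bound passes to the limit of the cutoff.

  For data in H^s the L^2 solution is bootstrapped to H^s: F gains a quarter derivative because
  |k|^r |(u^2)^(k)| <= C |u|_{H^r} |u|_{L^2}.
*)
theory Submission
  imports Defs
begin

section \<open>Completeness of the space of square-integrable functions\<close>

text \<open>The quantity that the equation conserves is the H^1 norm, which is infinite for general
  L^2 data, while the L^2 norm is not conserved. Hence the final L^2 bound depends on the frequency
  at which the tail of the data becomes small, and not on the norm of the data alone. Galerkin
  systems keep every energy computation a finite sum, so that differentiating and rearranging need
  no convergence argument. The truncation is radial because it then multiplies its argument by a
  real scalar: the truncated equation has the same cancellations as the original one, and the energy
  bound holds before anything is known about the size of the solution. The radius is read off from
  the bound itself, after which the truncation never acts. This takes the place of a blow-up
  alternative and is used three times: for each Galerkin solution (radius from its H^1 energy), for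
  the small solution (radius 1), and for the limit (radius the uniform L^2 bound).\<close>

lemma space_torus [simp]: "space torus = {-pi..pi}"
  by (simp add: torus_def space_restrict_space)

lemma finite_measure_torus: "finite_measure torus"
proof (rule finite_measureI)
  show "emeasure torus (space torus) \<noteq> \<infinity>"
    unfolding torus_def by (simp add: space_restrict_space emeasure_restrict_space)
qed

interpretation torus: finite_measure torus
  by (rule finite_measure_torus)

lemma measure_torus [simp]: "measure torus {-pi..pi} = 2 * pi"
  unfolding torus_def by (simp add: measure_restrict_space)

lemma borel_measurable_torus:
  "f \<in> borel_measurable borel \<Longrightarrow> f \<in> borel_measurable torus"
  unfolding torus_def by (auto intro!: measurable_restrict_space1)

section \<open>Representatives of classes, up to null sets\<close>

lemma rep_in: "rep_L2_torus u \<in> L2_fun"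
  using Quotient_rep_reflp[OF Quotient_L2_torus, of u] by (simp add: L2_rel_def)

lemma abs_rep [simp]: "abs_L2_torus (rep_L2_torus u) = u"
  by (rule Quotient_abs_rep[OF Quotient_L2_torus])

lemma rep_abs_AE: "f \<in> L2_fun \<Longrightarrow> AE x in torus. rep_L2_torus (abs_L2_torus f) x = f x"
  using Quotient_rep_abs[OF Quotient_L2_torus, of f] by (simp add: L2_rel_def)

lemma abs_eqI:
  "f \<in> L2_fun \<Longrightarrow> g \<in> L2_fun \<Longrightarrow> AE x in torus. f x = g x \<Longrightarrow> abs_L2_torus f = abs_L2_torus g"
  using Quotient_rel_abs[OF Quotient_L2_torus, of f g] by (simp add: L2_rel_def)

lemma L2_eqI: "AE x in torus. rep_L2_torus u x = rep_L2_torus v x \<Longrightarrow> u = v"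
  using abs_eqI[OF rep_in rep_in, of u v] by simp

lemma rep_measurable [measurable]: "rep_L2_torus u \<in> borel_measurable torus"
  by (rule L2_fun_measurable[OF rep_in])

lemma rep_zero: "AE x in torus. rep_L2_torus 0 x = 0"
  using rep_abs_AE[OF L2_fun_zero] by (simp add: zero_L2_torus_def)

lemma rep_add: "AE x in torus. rep_L2_torus (u + v) x = rep_L2_torus u x + rep_L2_torus v x"
  using rep_abs_AE[OF L2_fun_add[OF rep_in[of u] rep_in[of v]]]
  by (simp add: plus_L2_torus_def)

lemma rep_scaleR: "AE x in torus. rep_L2_torus (r *\<^sub>R u) x = of_real r * rep_L2_torus u x"
  using rep_abs_AE[OF L2_fun_cmult[OF rep_in[of u]]]
  by (simp add: scaleR_L2_torus_def)

lemma rep_scaleC: "AE x in torus. rep_L2_torus (scaleC c u) x = c * rep_L2_torus u x"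
  using rep_abs_AE[OF L2_fun_cmult[OF rep_in[of u]]]
  by (simp add: scaleC_def)

lemma rep_diff: "AE x in torus. rep_L2_torus (u - v) x = rep_L2_torus u x - rep_L2_torus v x"
proof -
  have "u - v = u + (-1) *\<^sub>R v" by simp
  then show ?thesis
    using rep_add[of u "(-1) *\<^sub>R v"] rep_scaleR[of "-1" v] by auto
qed

lemma inner_abs:
  "f \<in> L2_fun \<Longrightarrow> g \<in> L2_fun \<Longrightarrow>
    inner (abs_L2_torus f) (abs_L2_torus g) = Re (LINT x|torus. f x * cnj (g x)) / (2 * pi)"
  by (rule inner_L2_torus.abs_eq) (simp_all add: L2_rel_def eq_onp_def)

lemma norm_abs: "f \<in> L2_fun \<Longrightarrow> (norm (abs_L2_torus f))\<^sup>2 = (LINT x|torus. (cmod (f x))\<^sup>2) / (2 * pi)"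
  by (simp add: power2_norm_eq_inner inner_abs complex_norm_square[symmetric] del: of_real_power)

lemma norm_rep: "(norm u)\<^sup>2 = (LINT x|torus. (cmod (rep_L2_torus u x))\<^sup>2) / (2 * pi)"
  using norm_abs[OF rep_in[of u]] by simp

lemma L2_fun_cmod: "f \<in> L2_fun \<Longrightarrow> (\<lambda>x. complex_of_real (cmod (f x))) \<in> L2_fun"
  unfolding L2_fun_def by auto

text \<open>Cauchy-Schwarz for the real inner product, applied to the moduli of \<open>f\<close> and
  \<open>g\<close>: they are nonnegative functions with the same norms, so taking the real part
  loses nothing.\<close>

lemma LINT_cmod_mult_le:
  assumes "f \<in> L2_fun" "g \<in> L2_fun"
  shows "(LINT x|torus. cmod (f x) * cmod (g x)) \<le> 2 * pi * (norm (abs_L2_torus f) * norm (abs_L2_torus g))"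
proof -
  let ?f = "abs_L2_torus (\<lambda>x. complex_of_real (cmod (f x)))"
  let ?g = "abs_L2_torus (\<lambda>x. complex_of_real (cmod (g x)))"
  have "norm (abs_L2_torus (\<lambda>x. complex_of_real (cmod (h x)))) = norm (abs_L2_torus h)"
    if "h \<in> L2_fun" for h
    by (rule power2_eq_imp_eq) (use that norm_abs[OF L2_fun_cmod[OF that]] in \<open>simp_all add: norm_abs\<close>)
  then have n: "norm ?f = norm (abs_L2_torus f)" "norm ?g = norm (abs_L2_torus g)"
    using assms by blast+
  have "Re (LINT x|torus. complex_of_real (cmod (f x)) * cnj (complex_of_real (cmod (g x))))
      = (LINT x|torus. cmod (f x) * cmod (g x))"
    by (simp flip: of_real_mult)
  then have "(LINT x|torus. cmod (f x) * cmod (g x)) = 2 * pi * inner ?f ?g"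
    by (simp add: inner_abs L2_fun_cmod assms)
  also have "\<dots> \<le> 2 * pi * (norm ?f * norm ?g)"
    by (intro mult_left_mono norm_cauchy_schwarz) simp
  finally show ?thesis by (simp add: n)
qed

lemma L2_fun_bounded:
  assumes "f \<in> borel_measurable borel" "\<And>x. f (x + 2 * pi) = f x" "\<And>x. cmod (f x) \<le> B"
  shows "f \<in> L2_fun"
proof -
  have "integrable torus (\<lambda>x. (cmod (f x))\<^sup>2)"
  proof (rule torus.integrable_const_bound[where B = "B\<^sup>2"])
    show "AE x in torus. norm ((cmod (f x))\<^sup>2) \<le> B\<^sup>2"
      using assms(3) by (auto intro!: power_mono)
    show "(\<lambda>x. (cmod (f x))\<^sup>2) \<in> borel_measurable torus"
      using borel_measurable_torus[OF assms(1)] by measurable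
  qed
  then show ?thesis using assms by (simp add: L2_fun_def)
qed

lemma L2_fun_const: "(\<lambda>x. c) \<in> L2_fun"
  by (rule L2_fun_bounded[where B = "cmod c"]) auto

lemma L2_fun_diff: "f \<in> L2_fun \<Longrightarrow> g \<in> L2_fun \<Longrightarrow> (\<lambda>x. f x - g x) \<in> L2_fun"
  using L2_fun_add[of f "\<lambda>x. -1 * g x"] L2_fun_cmult[of g "-1"] by simp

lemma norm_diff_rep:
  "(norm (u - v))\<^sup>2 = (LINT x|torus. (cmod (rep_L2_torus u x - rep_L2_torus v x))\<^sup>2) / (2 * pi)"
  unfolding norm_rep[of "u - v"]
  by (rule arg_cong[where f = "\<lambda>y. y / (2 * pi)"], rule integral_cong_AE)
    (use rep_diff[of u v] in auto)

text \<open>Riesz--Fischer: a subsequence converges almost everywhere, and Fatou's lemma identifies the limit.\<close>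

lemma L2_torus_Cauchy_convergent:
  fixes X :: "nat \<Rightarrow> L2_torus"
  assumes X: "Cauchy X"
  shows "convergent X"
proof -
  define f where "f n = rep_L2_torus (X n)" for n
  have f: "f n \<in> L2_fun" for n by (simp add: f_def rep_in)
  have [measurable]: "f n \<in> borel_measurable torus" for n by (simp add: f_def)
  \<comment> \<open>The almost everywhere convergent subsequence is extracted from a Cauchy sequence
    in L^1; testing against the constant 1 turns the L^2 bound into an L^1 bound.\<close>
  have l1: "(LINT x|torus. norm (f i x - f j x)) \<le> 2 * pi * (norm (X i - X j) * norm (abs_L2_torus (\<lambda>x. 1)))" for i j
  proof -
    have "abs_L2_torus (\<lambda>x. f i x - f j x) = X i - X j"
      by (rule L2_eqI) (use rep_abs_AE[OF L2_fun_diff[OF f f], of i j] rep_diff[of "X i" "X j"]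
          in \<open>auto simp: f_def\<close>)
    then show ?thesis
      using LINT_cmod_mult_le[OF L2_fun_diff[OF f f] L2_fun_const, of i j 1] by simp
  qed
  define c where "c = 2 * pi * norm (abs_L2_torus (\<lambda>x. 1)) + 1"
  have c: "c > 0" by (simp add: c_def add_nonneg_pos)
  have int1: "integrable torus (f n)" for n
  proof -
    have "integrable torus (\<lambda>x. f n x * cnj 1)"
      by (rule L2_fun_integrable_mult[OF f L2_fun_const])
    then show ?thesis by simp
  qed
  have cau: "\<exists>N. \<forall>i\<ge>N. \<forall>j\<ge>N. (LINT x|torus. norm (f i x - f j x)) < e" if "e > 0" for e
  proof -
    obtain N where N: "\<And>i j. i \<ge> N \<Longrightarrow> j \<ge> N \<Longrightarrow> norm (X i - X j) < e / c"
      using CauchyD[OF X, of "e / c"] \<open>e > 0\<close> c by auto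
    have "(LINT x|torus. norm (f i x - f j x)) < e" if "i \<ge> N" "j \<ge> N" for i j
    proof -
      have "(LINT x|torus. norm (f i x - f j x)) \<le> norm (X i - X j) * c"
        using l1[of i j] by (auto simp: c_def algebra_simps intro: order_trans)
      also have "\<dots> < e / c * c"
        using N[OF that] c by (intro mult_strict_right_mono) auto
      finally show ?thesis using c by simp
    qed
    then show ?thesis by blast
  qed
  obtain r where r: "strict_mono r" and ae: "AE x in torus. Cauchy (\<lambda>i. f (r i) x)"
    using cauchy_L1_AE_cauchy_subseq[of torus f, OF int1] cau by blast
  \<comment> \<open>The limit is taken at every point of the line, with an unspecified value where
    it does not exist. Borel measurability and exact periodicity, which \<open>L2_fun\<close>
    demands everywhere, then hold without changing \<open>g\<close> on a null set.\<close>
  define g where "g x = lim (\<lambda>i. f (r i) x)" for x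
  have gb [measurable]: "g \<in> borel_measurable borel"
    unfolding g_def using f by (intro borel_measurable_lim_metric) (auto simp: L2_fun_def)
  have gt [measurable]: "g \<in> borel_measurable torus"
    by (rule borel_measurable_torus[OF gb])
  have gp: "g (x + 2 * pi) = g x" for x
    using f by (simp add: g_def L2_fun_def)
  have lim: "AE x in torus. (\<lambda>i. f (r i) x) \<longlonglongrightarrow> g x"
    using ae by eventually_elim (auto simp: g_def Cauchy_convergent convergent_LIMSEQ_iff[symmetric])
  have fat: "(\<integral>\<^sup>+x. ennreal ((cmod (g x - f n x))\<^sup>2) \<partial>torus) \<le> ennreal (2 * pi * e\<^sup>2)"
    if n: "\<And>i. i \<ge> N \<Longrightarrow> norm (X i - X n) \<le> e" for n N e
  proof -
    have "(\<integral>\<^sup>+x. ennreal ((cmod (g x - f n x))\<^sup>2) \<partial>torus)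
        = (\<integral>\<^sup>+x. liminf (\<lambda>i. ennreal ((cmod (f (r i) x - f n x))\<^sup>2)) \<partial>torus)"
    proof (rule nn_integral_cong_AE)
      show "AE x in torus. ennreal ((cmod (g x - f n x))\<^sup>2) = liminf (\<lambda>i. ennreal ((cmod (f (r i) x - f n x))\<^sup>2))"
        using lim
      proof eventually_elim
        case (elim x)
        then have "(\<lambda>i. ennreal ((cmod (f (r i) x - f n x))\<^sup>2)) \<longlonglongrightarrow> ennreal ((cmod (g x - f n x))\<^sup>2)"
          by (intro tendsto_intros tendsto_ennrealI)
        then show ?case by (rule lim_imp_Liminf[OF sequentially_bot, symmetric])
      qed
    qed
    also have "\<dots> \<le> liminf (\<lambda>i. \<integral>\<^sup>+x. ennreal ((cmod (f (r i) x - f n x))\<^sup>2) \<partial>torus)"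
      by (rule nn_integral_liminf) measurable
    also have "\<dots> \<le> liminf (\<lambda>i. ennreal (2 * pi * e\<^sup>2) :: ennreal)"
    proof (rule Liminf_mono)
      have "(\<integral>\<^sup>+x. ennreal ((cmod (f (r i) x - f n x))\<^sup>2) \<partial>torus) \<le> ennreal (2 * pi * e\<^sup>2)" if "i \<ge> N" for i
      proof -
        have "r i \<ge> N" using seq_suble[OF r, of i] that by simp
        have "(\<integral>\<^sup>+x. ennreal ((cmod (f (r i) x - f n x))\<^sup>2) \<partial>torus)
            = ennreal (LINT x|torus. (cmod (f (r i) x - f n x))\<^sup>2)"
          by (rule nn_integral_eq_integral) (use L2_fun_integrable[OF L2_fun_diff[OF f f]] in auto)
        also have "\<dots> = ennreal (2 * pi * (norm (X (r i) - X n))\<^sup>2)"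
          by (simp add: norm_diff_rep f_def)
        also have "\<dots> \<le> ennreal (2 * pi * e\<^sup>2)"
          using n[OF \<open>r i \<ge> N\<close>] by (intro ennreal_leI mult_left_mono power_mono) auto
        finally show ?thesis .
      qed
      then show "\<forall>\<^sub>F i in sequentially. (\<integral>\<^sup>+x. ennreal ((cmod (f (r i) x - f n x))\<^sup>2) \<partial>torus) \<le> ennreal (2 * pi * e\<^sup>2)"
        by (auto simp: eventually_sequentially)
    qed
    also have "\<dots> = ennreal (2 * pi * e\<^sup>2)" by (simp add: Liminf_const)
    finally show ?thesis .
  qed
  have gfL2: "(\<lambda>x. g x - f n x) \<in> L2_fun \<and> (LINT x|torus. (cmod (g x - f n x))\<^sup>2) \<le> 2 * pi * e\<^sup>2"
    if n: "\<And>i. i \<ge> N \<Longrightarrow> norm (X i - X n) \<le> e" for n N e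
  proof -
    have fm: "f n \<in> borel_measurable borel" "f n (x + 2 * pi) = f n x" for x
      using f[of n] by (auto simp: L2_fun_def)
    have nn: "(\<integral>\<^sup>+x. ennreal (norm ((cmod (g x - f n x))\<^sup>2)) \<partial>torus) \<le> ennreal (2 * pi * e\<^sup>2)"
      using fat[OF n] by simp
    have i: "integrable torus (\<lambda>x. (cmod (g x - f n x))\<^sup>2)"
      by (rule integrableI_bounded) (use nn in \<open>auto intro: le_less_trans\<close>)
    moreover have "(LINT x|torus. (cmod (g x - f n x))\<^sup>2) \<le> 2 * pi * e\<^sup>2"
      using nn nn_integral_eq_integral[OF i] by simp
    ultimately show ?thesis
      using gb fm gp by (auto simp: L2_fun_def)
  qed
  have ex: "\<exists>N. \<forall>i\<ge>N. \<forall>j\<ge>N. norm (X i - X j) < e" if "e > 0" for e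
    using CauchyD[OF X that] by blast
  have g: "g \<in> L2_fun"
  proof -
    obtain N where N: "\<And>i j. i \<ge> N \<Longrightarrow> j \<ge> N \<Longrightarrow> norm (X i - X j) < 1"
      using ex[of 1] by auto
    have "(\<lambda>x. g x - f N x) \<in> L2_fun"
      using gfL2[of N N 1] N by (force intro: less_imp_le)
    from L2_fun_add[OF this f[of N]] show ?thesis by simp
  qed
  have "X \<longlonglongrightarrow> abs_L2_torus g"
  proof (rule metric_LIMSEQ_I)
    fix e :: real assume "e > 0"
    obtain N where N: "\<And>i j. i \<ge> N \<Longrightarrow> j \<ge> N \<Longrightarrow> norm (X i - X j) < e / 2"
      using ex[of "e / 2"] \<open>e > 0\<close> by auto
    have "dist (X n) (abs_L2_torus g) < e" if "n \<ge> N" for n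
    proof -
      have "(LINT x|torus. (cmod (g x - f n x))\<^sup>2) \<le> 2 * pi * (e / 2)\<^sup>2"
        using gfL2[of N n "e / 2"] N that by (force intro: less_imp_le)
      moreover have "(norm (abs_L2_torus g - X n))\<^sup>2 = (LINT x|torus. (cmod (g x - f n x))\<^sup>2) / (2 * pi)"
        unfolding norm_diff_rep
        by (rule arg_cong[where f = "\<lambda>y. y / (2 * pi)"], rule integral_cong_AE)
          (use rep_abs_AE[OF g] in \<open>auto simp: f_def\<close>)
      ultimately have "(norm (abs_L2_torus g - X n))\<^sup>2 \<le> (2 * pi * (e / 2)\<^sup>2) / (2 * pi)"
        by (simp only:) (intro divide_right_mono, auto)
      then have "(norm (abs_L2_torus g - X n))\<^sup>2 \<le> (e / 2)\<^sup>2" by simp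
      then have "norm (abs_L2_torus g - X n) \<le> e / 2"
        by (rule power2_le_imp_le) (use \<open>e > 0\<close> in simp)
      then show ?thesis
        using \<open>e > 0\<close> by (simp add: dist_norm norm_minus_commute)
    qed
    then show "\<exists>N. \<forall>n\<ge>N. dist (X n) (abs_L2_torus g) < e" by blast
  qed
  then show ?thesis by (auto simp: convergent_def)
qed

instance L2_torus :: banach
  by standard (rule L2_torus_Cauchy_convergent)

section \<open>Fourier coefficients\<close>

definition fexp :: "int \<Rightarrow> real \<Rightarrow> complex" where
  "fexp k x = exp (\<i> * of_real (of_int k * x))"

lemma fexp_add: "fexp (j + k) x = fexp j x * fexp k x"
  by (simp add: fexp_def exp_add[symmetric] ring_distribs)

lemma fexp_0 [simp]: "fexp 0 x = 1"
  by (simp add: fexp_def)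

lemma cnj_fexp: "cnj (fexp k x) = fexp (- k) x"
  by (simp add: fexp_def exp_cnj)

lemma cmod_fexp [simp]: "cmod (fexp k x) = 1"
  using norm_exp_i_times[of "of_int k * x"] by (simp add: fexp_def)

lemma fexp_periodic [simp]: "fexp k (x + 2 * pi) = fexp k x"
proof -
  have "fexp k (x + 2 * pi) = fexp k x * exp (\<i> * of_real (2 * pi * of_int k))"
    by (simp add: fexp_def ring_distribs flip: exp_add) (simp add: algebra_simps)
  also have "exp (\<i> * of_real (2 * pi * of_int k)) = 1"
    by (simp add: exp_eq_1 algebra_simps)
  finally show ?thesis by simp
qed

lemma continuous_fexp: "continuous_on A (fexp k)"
  unfolding fexp_def by (intro continuous_intros)

lemma fexp_borel [measurable]: "fexp k \<in> borel_measurable borel"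
  by (rule borel_measurable_continuous_onI[OF continuous_fexp])

lemma fexp_torus [measurable]: "fexp k \<in> borel_measurable torus"
  by (rule borel_measurable_torus[OF fexp_borel])

lemma fexp_in: "fexp k \<in> L2_fun"
  by (rule L2_fun_bounded[where B = 1]) auto

lemma fourier_coeff_fexp: "fourier_coeff f k = (LINT x|torus. f x * fexp (- k) x) / of_real (2 * pi)"
  by (simp add: fourier_coeff_def fexp_def)

lemma fourier_coeff_cong_AE:
  assumes "f \<in> borel_measurable torus" "g \<in> borel_measurable torus" "AE x in torus. f x = g x"
  shows "fourier_coeff f k = fourier_coeff g k"
  unfolding fourier_coeff_fexp
  by (rule arg_cong[where f = "\<lambda>y. y / _"], rule integral_cong_AE) (use assms in auto)

lemma L2_coeff_abs: "f \<in> L2_fun \<Longrightarrow> L2_coeff (abs_L2_torus f) k = fourier_coeff f k"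
  by (rule fourier_coeff_cong_AE) (auto simp: rep_abs_AE L2_fun_measurable)

lemma L2_fun_mult_bounded:
  assumes "f \<in> L2_fun" "g \<in> borel_measurable borel" "\<And>x. g (x + 2 * pi) = g x" "\<And>x. cmod (g x) \<le> B"
  shows "(\<lambda>x. f x * g x) \<in> L2_fun"
proof -
  have [measurable]: "f \<in> borel_measurable torus" "g \<in> borel_measurable torus" "f \<in> borel_measurable borel"
    using assms by (auto simp: L2_fun_measurable borel_measurable_torus L2_fun_def)
  have "integrable torus (\<lambda>x. (cmod (f x * g x))\<^sup>2)"
  proof (rule Bochner_Integration.integrable_bound)
    show "integrable torus (\<lambda>x. B\<^sup>2 * (cmod (f x))\<^sup>2)"
      using assms by (simp add: L2_fun_integrable)
    have "(cmod (f x * g x))\<^sup>2 \<le> B\<^sup>2 * (cmod (f x))\<^sup>2" for x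
      using mult_right_mono[OF power_mono[OF assms(4)[of x] norm_ge_zero, of 2], of "(cmod (f x))\<^sup>2"]
      by (simp add: norm_mult power_mult_distrib mult.commute)
    then show "AE x in torus. norm ((cmod (f x * g x))\<^sup>2) \<le> norm (B\<^sup>2 * (cmod (f x))\<^sup>2)"
      by simp
    show "(\<lambda>x. (cmod (f x * g x))\<^sup>2) \<in> borel_measurable torus" by measurable
  qed
  then show ?thesis using assms by (auto simp: L2_fun_def)
qed

lemma L2_fun_cnj: "f \<in> L2_fun \<Longrightarrow> (\<lambda>x. cnj (f x)) \<in> L2_fun"
  by (auto simp: L2_fun_def intro: borel_measurable_continuous_on[where f = cnj] continuous_intros)

lemma L2_fun_mult_fexp: "f \<in> L2_fun \<Longrightarrow> (\<lambda>x. f x * fexp k x) \<in> L2_fun"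
  by (rule L2_fun_mult_bounded[where B = 1]) auto

lemma L2_fun_integrable_mult_fexp:
  assumes "f \<in> L2_fun" "g \<in> L2_fun"
  shows "integrable torus (\<lambda>x. f x * g x * fexp k x)"
  using L2_fun_integrable_mult[OF L2_fun_mult_fexp[OF assms(1)] L2_fun_cnj[OF assms(2)], of k]
  by (simp add: mult_ac)

text \<open>A product of two L^2 functions is in general only in L^1 and has no counterpart in
  \<open>L2_torus\<close>; it enters the whole argument only through its Fourier
  coefficients.\<close>

definition prod_coeff :: "L2_torus \<Rightarrow> L2_torus \<Rightarrow> int \<Rightarrow> complex" where
  "prod_coeff u v k = fourier_coeff (\<lambda>x. rep_L2_torus u x * rep_L2_torus v x) k"

lemma prod_coeff_square: "fourier_coeff (\<lambda>x. (rep_L2_torus u x)\<^sup>2) k = prod_coeff u u k"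
  by (simp add: prod_coeff_def power2_eq_square)

lemma prod_coeff_commute: "prod_coeff u v k = prod_coeff v u k"
  by (simp add: prod_coeff_def mult.commute)

lemma prod_coeff_add_left: "prod_coeff (u + w) v k = prod_coeff u v k + prod_coeff w v k"
proof -
  have "prod_coeff (u + w) v k = fourier_coeff (\<lambda>x. rep_L2_torus u x * rep_L2_torus v x
      + rep_L2_torus w x * rep_L2_torus v x) k"
    unfolding prod_coeff_def
    by (rule fourier_coeff_cong_AE) (use rep_add[of u w] in \<open>auto simp: distrib_right\<close>)
  also have "\<dots> = prod_coeff u v k + prod_coeff w v k"
    unfolding prod_coeff_def fourier_coeff_fexp
    by (simp add: distrib_right L2_fun_integrable_mult_fexp rep_in add_divide_distrib)
  finally show ?thesis .
qed

lemma prod_coeff_scaleC_left: "prod_coeff (scaleC c u) v k = c * prod_coeff u v k"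
proof -
  have "prod_coeff (scaleC c u) v k = fourier_coeff (\<lambda>x. c * (rep_L2_torus u x * rep_L2_torus v x)) k"
    unfolding prod_coeff_def
    by (rule fourier_coeff_cong_AE) (use rep_scaleC[of c u] in auto)
  also have "\<dots> = c * prod_coeff u v k"
    unfolding prod_coeff_def fourier_coeff_fexp by (simp add: mult.assoc)
  finally show ?thesis .
qed

lemma scaleR_scaleC: "r *\<^sub>R u = scaleC (of_real r) u"
  by (simp add: scaleC_def scaleR_L2_torus_def)

lemma cmod_LINT_mult_fexp_le:
  assumes "f \<in> L2_fun" "g \<in> L2_fun"
  shows "cmod (LINT x|torus. f x * g x * fexp k x) \<le> 2 * pi * (norm (abs_L2_torus f) * norm (abs_L2_torus g))"
proof -
  have "cmod (LINT x|torus. f x * g x * fexp k x) \<le> (LINT x|torus. cmod (f x * g x * fexp k x))"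
    by (rule integral_norm_bound)
  also have "\<dots> \<le> 2 * pi * (norm (abs_L2_torus f) * norm (abs_L2_torus g))"
    using LINT_cmod_mult_le[OF assms] by (simp add: norm_mult)
  finally show ?thesis .
qed

lemma prod_coeff_bound: "cmod (prod_coeff u v k) \<le> norm u * norm v"
proof -
  have "cmod (prod_coeff u v k) = cmod (LINT x|torus. rep_L2_torus u x * rep_L2_torus v x * fexp (- k) x) / (2 * pi)"
    by (simp add: prod_coeff_def fourier_coeff_fexp norm_divide norm_mult)
  also have "\<dots> \<le> 2 * pi * (norm u * norm v) / (2 * pi)"
    using cmod_LINT_mult_fexp_le[OF rep_in[of u] rep_in[of v]] by (intro divide_right_mono) auto
  finally show ?thesis by simp
qed

lemma bounded_bilinear_prod_coeff: "bounded_bilinear (\<lambda>u v. prod_coeff u v k)"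
proof
  fix a a' b b' :: L2_torus and r :: real
  show "prod_coeff (a + a') b k = prod_coeff a b k + prod_coeff a' b k" by (rule prod_coeff_add_left)
  show "prod_coeff a (b + b') k = prod_coeff a b k + prod_coeff a b' k"
    by (simp add: prod_coeff_commute[of a] prod_coeff_add_left)
  show "prod_coeff (r *\<^sub>R a) b k = r *\<^sub>R prod_coeff a b k"
    by (simp add: scaleR_scaleC prod_coeff_scaleC_left scaleR_conv_of_real)
  show "prod_coeff a (r *\<^sub>R b) k = r *\<^sub>R prod_coeff a b k"
    by (simp add: prod_coeff_commute[of a] scaleR_scaleC prod_coeff_scaleC_left scaleR_conv_of_real)
  show "\<exists>K. \<forall>a b. norm (prod_coeff a b k) \<le> norm a * norm b * K"
    by (rule exI[of _ 1]) (simp add: prod_coeff_bound)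
qed

text \<open>With this second factor \<open>L2_coeff\<close> becomes a case of
  \<open>prod_coeff\<close> and inherits its linearity and its bound.\<close>

definition L2_one :: L2_torus where "L2_one = abs_L2_torus (\<lambda>x. 1)"

lemma norm_L2_one [simp]: "norm L2_one = 1"
proof -
  have "(norm L2_one)\<^sup>2 = 1" by (simp add: L2_one_def norm_abs L2_fun_const)
  then show ?thesis by (simp add: power2_eq_1_iff) (use norm_ge_zero[of L2_one] in linarith)
qed

lemma L2_coeff_eq_prod_coeff: "L2_coeff u k = prod_coeff u L2_one k"
  unfolding prod_coeff_def L2_one_def
  by (rule fourier_coeff_cong_AE) (use rep_abs_AE[OF L2_fun_const[of 1]] in auto)

lemma L2_coeff_bound: "cmod (L2_coeff u k) \<le> norm u"
  using prod_coeff_bound[of u L2_one k] by (simp add: L2_coeff_eq_prod_coeff)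

lemma bounded_linear_L2_coeff: "bounded_linear (\<lambda>u. L2_coeff u k)"
  unfolding L2_coeff_eq_prod_coeff by (rule bounded_bilinear.bounded_linear_left[OF bounded_bilinear_prod_coeff])

lemmas L2_coeff_add = linear_add[OF bounded_linear.linear[OF bounded_linear_L2_coeff]]
  and L2_coeff_diff = linear_diff[OF bounded_linear.linear[OF bounded_linear_L2_coeff]]
  and L2_coeff_zero = linear_0[OF bounded_linear.linear[OF bounded_linear_L2_coeff]]
  and L2_coeff_sum = linear_sum[OF bounded_linear.linear[OF bounded_linear_L2_coeff]]

lemma L2_coeff_scaleC: "L2_coeff (scaleC c u) k = c * L2_coeff u k"
  by (simp add: L2_coeff_eq_prod_coeff prod_coeff_scaleC_left)

lemma L2_coeff_scaleR: "L2_coeff (r *\<^sub>R u) k = of_real r * L2_coeff u k"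
  by (simp add: scaleR_scaleC L2_coeff_scaleC)

section \<open>Orthonormality of the exponentials\<close>

lemma LINT_torus_continuous:
  fixes f :: "real \<Rightarrow> complex"
  assumes "continuous_on UNIV f"
  shows "(LINT x|torus. f x) = integral {-pi..pi} f"
proof -
  have "continuous_on {-pi..pi} f"
    using assms by (rule continuous_on_subset) simp
  then have *: "set_integrable lborel {-pi..pi} f"
    by (rule borel_integrable_atLeastAtMost')
  have "(LINT x|torus. f x) = (LINT x : {-pi..pi} | lborel. f x)"
    unfolding torus_def set_lebesgue_integral_def by (rule integral_restrict_space) simp
  then show ?thesis
    using set_borel_integral_eq_integral(2)[OF *] by simp
qed

lemma LINT_torus_deriv:
  fixes F :: "real \<Rightarrow> complex"
  assumes "\<And>x. (F has_vector_derivative f x) (at x)" "continuous_on UNIV f" "F pi = F (- pi)"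
  shows "(LINT x|torus. f x) = 0"
proof -
  have "(f has_integral (F pi - F (-pi))) {-pi..pi}"
    by (rule fundamental_theorem_of_calculus)
      (auto intro: has_vector_derivative_at_within assms)
  then show ?thesis
    using assms by (simp add: LINT_torus_continuous integral_unique)
qed

lemma fexp_deriv: "(fexp k has_vector_derivative (\<i> * of_int k * fexp k x)) (at x)"
  unfolding fexp_def has_vector_derivative_complex_iff
  by (auto intro!: derivative_eq_intros simp: exp_eq_polar cis.simps Re_exp Im_exp)

lemma fexp_pi: "fexp k pi = fexp k (- pi)"
  using fexp_periodic[of k "- pi"] by simp

lemma LINT_fexp: "(LINT x|torus. fexp k x) = (if k = 0 then 2 * pi else 0)"
proof (cases "k = 0")
  case True
  then show ?thesis by (simp add: fexp_def scaleR_conv_of_real)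
next
  case False
  have "(LINT x|torus. \<i> * of_int k * fexp k x) = 0"
    by (rule LINT_torus_deriv[OF fexp_deriv _ fexp_pi]) (intro continuous_intros continuous_fexp)
  with False show ?thesis by simp
qed

lemma fourier_coeff_fexp_fexp: "fourier_coeff (fexp j) k = (if j = k then 1 else 0)"
  using LINT_fexp[of "j - k"] by (simp add: fourier_coeff_fexp flip: fexp_add)

definition L2_fexp :: "int \<Rightarrow> L2_torus" where "L2_fexp k = abs_L2_torus (fexp k)"

lemma L2_coeff_L2_fexp: "L2_coeff (L2_fexp j) k = (if j = k then 1 else 0)"
  by (simp add: L2_fexp_def L2_coeff_abs fexp_in fourier_coeff_fexp_fexp)

text \<open>The real inner product with \<open>L2_fexp k\<close> alone would show only the real part
  of a coefficient; the free factor \<open>c\<close> recovers the rest, and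
  \<open>c = L2_coeff u k\<close> yields the squared modulus.\<close>

lemma inner_L2_fexp: "inner u (scaleC c (L2_fexp k)) = Re (L2_coeff u k * cnj c)"
proof -
  have "scaleC c (L2_fexp k) = abs_L2_torus (\<lambda>x. c * fexp k x)"
    by (rule L2_eqI)
      (use rep_scaleC[of c "L2_fexp k"] rep_abs_AE[OF fexp_in[of k]] rep_abs_AE[OF L2_fun_cmult[OF fexp_in[of k], of c]]
        in \<open>auto simp: L2_fexp_def\<close>)
  then have "inner u (scaleC c (L2_fexp k)) = inner (abs_L2_torus (rep_L2_torus u)) (abs_L2_torus (\<lambda>x. c * fexp k x))"
    by simp
  also have "\<dots> = Re (LINT x|torus. cnj c * (rep_L2_torus u x * fexp (- k) x)) / (2 * pi)"
    by (subst inner_abs[OF rep_in L2_fun_cmult[OF fexp_in]]) (simp add: cnj_fexp mult_ac)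
  also have "\<dots> = Re (L2_coeff u k * cnj c)"
    by (simp add: fourier_coeff_fexp mult_ac flip: of_real_mult Re_divide_of_real)
  finally show ?thesis .
qed

subsection \<open>Completeness of the trigonometric system\<close>

inductive trigpoly :: "(real \<Rightarrow> complex) \<Rightarrow> bool" where
  trig_fexp: "trigpoly (\<lambda>x. c * fexp k x)"
| trig_add: "trigpoly f \<Longrightarrow> trigpoly g \<Longrightarrow> trigpoly (\<lambda>x. f x + g x)"

lemma trigpoly_mult: 
  assumes "trigpoly f" "trigpoly g" shows "trigpoly (\<lambda>x. f x * g x)"
  using assms(1)
proof induction
  case (trig_fexp c k)
  from assms(2) show ?case
  proof induction
    case (trig_fexp d j)
    show ?case using trigpoly.trig_fexp[of "c * d" "k + j"] by (simp add: fexp_add mult_ac)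
  next
    case (trig_add f g)
    then show ?case using trigpoly.trig_add by (simp add: distrib_left)
  qed
next
  case (trig_add f g)
  then show ?case using trigpoly.trig_add by (simp add: distrib_right)
qed

text \<open>On the circle Re z and Im z are combinations of \<open>fexp 1\<close> and
  \<open>fexp (-1)\<close>, and trigonometric polynomials form an algebra. This makes the
  polynomials of Stone-Weierstrass available as test functions.\<close>

lemma trigpoly_real_polynomial_function:
  assumes "real_polynomial_function p"
  shows "trigpoly (\<lambda>x. complex_of_real (p (cis x)))"
  using assms
proof induction
  case (linear h)
  interpret bounded_linear h by fact
  have h: "h z = Re z * h 1 + Im z * h \<i>" for z
  proof -
    have "h z = h (Re z *\<^sub>R 1 + Im z *\<^sub>R \<i>)"
      by (rule arg_cong[where f = h]) (simp add: complex_eq_iff)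
    then show ?thesis by (simp only: add scaleR real_scaleR_def)
  qed
  have "(\<lambda>x. complex_of_real (h (cis x))) = (\<lambda>x. ((h 1 - \<i> * h \<i>) / 2) * fexp 1 x + ((h 1 + \<i> * h \<i>) / 2) * fexp (-1) x)"
    by (rule ext, subst h) (auto simp: complex_eq_iff fexp_def Re_exp Im_exp field_simps)
  then show ?case using trig_add[OF trig_fexp trig_fexp] by metis
next
  case (const c)
  then show ?case using trig_fexp[of c 0] by simp
next
  case (add f g)
  then show ?case using trig_add by simp
next
  case (mult f g)
  then show ?case using trigpoly_mult by simp
qed

lemma L2_integrable: "integrable torus (rep_L2_torus u)"
  using L2_fun_integrable_mult[OF rep_in[of u] L2_fun_const[of 1]] by simp

lemma integrable_mult_bounded:
  fixes f g :: "real \<Rightarrow> complex"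
  assumes "integrable torus f" "g \<in> borel_measurable torus" "\<And>x. cmod (g x) \<le> B"
  shows "integrable torus (\<lambda>x. f x * g x)"
proof (rule Bochner_Integration.integrable_bound)
  show "integrable torus (\<lambda>x. B * cmod (f x))" using assms(1) by simp
  have [measurable]: "f \<in> borel_measurable torus" using assms(1) by simp
  note assms(2)[measurable]
  show "(\<lambda>x. f x * g x) \<in> borel_measurable torus" by measurable
  have "cmod (f x * g x) \<le> B * cmod (f x)" for x
    using mult_right_mono[OF assms(3)[of x] norm_ge_zero[of "f x"]] by (simp add: norm_mult mult.commute)
  then show "AE x in torus. norm (f x * g x) \<le> norm (B * cmod (f x))"
    by (auto intro: order_trans[OF _ abs_ge_self])
qed

context
  fixes u :: L2_torus
  assumes coeff0: "\<And>k. L2_coeff u k = 0"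
begin

lemma LINT_trigpoly: "trigpoly p \<Longrightarrow> integrable torus (\<lambda>x. rep_L2_torus u x * p x) \<and>
    (LINT x|torus. rep_L2_torus u x * p x) = 0"
proof (induction rule: trigpoly.induct)
  case (trig_fexp c k)
  have i: "integrable torus (\<lambda>x. rep_L2_torus u x * fexp k x)"
    by (rule integrable_mult_bounded[OF L2_integrable, where B = 1]) auto
  have "(LINT x|torus. rep_L2_torus u x * fexp k x) = 0"
    using coeff0[of "- k"] by (simp add: fourier_coeff_fexp)
  with i show ?case by (simp add: mult.left_commute[of _ c])
next
  case (trig_add f g)
  then show ?case by (simp add: distrib_left)
qed

text \<open>Stone-Weierstrass on the unit circle: uniform approximation of \<open>h\<close> is
  enough because \<open>u\<close> is integrable. Composition with \<open>cis\<close> builds in the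
  identification of the end points of the period.\<close>

lemma LINT_continuous_cis:
  fixes h :: "complex \<Rightarrow> real"
  assumes h: "continuous_on UNIV h"
  shows "(LINT x|torus. rep_L2_torus u x * h (cis x)) = 0"
proof -
  let ?u = "rep_L2_torus u"
  have hc: "continuous_on UNIV (\<lambda>x. complex_of_real (h (cis x)))"
    by (intro continuous_intros continuous_on_compose2[OF h]) auto
  have hS: "continuous_on (sphere 0 1) h" using h by (rule continuous_on_subset) simp
  then have "compact (h ` sphere 0 1)" by (rule compact_continuous_image) simp
  then obtain B where B: "\<And>z. z \<in> sphere 0 1 \<Longrightarrow> \<bar>h z\<bar> \<le> B"
    using compact_imp_bounded[of "h ` sphere 0 1"] unfolding bounded_iff by fastforce
  have ih: "integrable torus (\<lambda>x. ?u x * h (cis x))"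
  proof (rule integrable_mult_bounded[OF L2_integrable, where B = B])
    show "(\<lambda>x. complex_of_real (h (cis x))) \<in> borel_measurable torus"
      by (rule borel_measurable_torus[OF borel_measurable_continuous_onI[OF hc]])
    show "cmod (complex_of_real (h (cis x))) \<le> B" for x using B[of "cis x"] by simp
  qed
  define J where "J = (LINT x|torus. cmod (?u x))"
  have J: "J \<ge> 0" by (simp add: J_def)
  have "cmod (LINT x|torus. ?u x * h (cis x)) \<le> 0 + e" if e: "e > 0" for e
  proof -
    \<comment> \<open>The tolerance is \<open>e\<close> divided by the L^1 norm of \<open>u\<close>,
      with 1 added since that norm may be 0.\<close>
    have e': "0 < e / (J + 1)" using J e by simp
    obtain p where p: "real_polynomial_function p" and
      ap: "\<And>z. z \<in> sphere (0::complex) 1 \<Longrightarrow> \<bar>h z - p z\<bar> < e / (J + 1)"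
      by (rule Stone_Weierstrass_real_polynomial_function[OF compact_sphere[of "0::complex" 1] hS e']) blast
    note int_p = LINT_trigpoly[OF trigpoly_real_polynomial_function[OF p]]
    have "(LINT x|torus. ?u x * h (cis x)) = (LINT x|torus. ?u x * h (cis x) - ?u x * p (cis x))"
      using int_p ih by simp
    also have "cmod \<dots> \<le> (LINT x|torus. cmod (?u x * h (cis x) - ?u x * p (cis x)))"
      by (rule integral_norm_bound)
    also have "\<dots> \<le> (LINT x|torus. cmod (?u x) * (e / (J + 1)))"
    proof (rule integral_mono)
      show "integrable torus (\<lambda>x. cmod (?u x * h (cis x) - ?u x * p (cis x)))"
        using int_p ih by simp
      show "integrable torus (\<lambda>x. cmod (?u x) * (e / (J + 1)))"
        using L2_integrable[of u] by simp
      fix x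
      have "cmod (?u x * h (cis x) - ?u x * p (cis x)) = cmod (?u x) * \<bar>h (cis x) - p (cis x)\<bar>"
        by (simp add: norm_mult flip: right_diff_distrib of_real_diff)
      also have "\<dots> \<le> cmod (?u x) * (e / (J + 1))"
        using ap[of "cis x"] by (intro mult_left_mono) auto
      finally show "cmod (?u x * h (cis x) - ?u x * p (cis x)) \<le> cmod (?u x) * (e / (J + 1))" .
    qed
    also have "\<dots> = J * (e / (J + 1))" by (simp add: J_def)
    also have "\<dots> \<le> e" using J e by (simp add: field_simps)
    finally show ?thesis by simp
  qed
  then have "cmod (LINT x|torus. ?u x * h (cis x)) \<le> 0" by (rule field_le_epsilon)
  then show ?thesis by simp
qed

text \<open>The continuous functions \<open>h n\<close>, equal to 1 on \<open>C\<close> and to 0 at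
  distance at least 1/n from it, tend to the indicator pointwise; dominated convergence with
  majorant |u| does the rest.\<close>

lemma LINT_indicator_cis:
  assumes C: "closed C"
  shows "(LINT x|torus. rep_L2_torus u x * indicator C (cis x)) = 0"
proof (cases "C = {}")
  \<comment> \<open>The empty set is apart because \<open>infdist\<close> to it is 0 by convention,
    so that \<open>h n\<close> would be constantly 1.\<close>
  case False
  let ?u = "rep_L2_torus u"
  define h where "h n z = max 0 (1 - real n * infdist z C)" for n z
  have hc: "continuous_on UNIV (h n)" for n
    unfolding h_def by (intro continuous_intros)
  have hb: "\<bar>h n z\<bar> \<le> 1" for n z
    by (auto simp: h_def infdist_nonneg abs_if)
  have lim: "(\<lambda>n. h n z) \<longlonglongrightarrow> indicator C z" for z
  proof (cases "z \<in> C")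
    case True
    then show ?thesis by (simp add: h_def)
  next
    case z: False
    have pos: "infdist z C > 0"
      using in_closed_iff_infdist_zero[OF C False, of z] z infdist_nonneg[of z C] by linarith
    obtain N where N: "1 / infdist z C < real N" using reals_Archimedean2 by blast
    have "h n z = 0" if "n \<ge> N" for n
    proof -
      have "1 < real N * infdist z C" using N pos by (simp add: field_simps)
      also have "\<dots> \<le> real n * infdist z C" using that pos by (intro mult_right_mono) auto
      finally show ?thesis by (simp add: h_def)
    qed
    then have "\<forall>\<^sub>F n in sequentially. h n z = 0" by (auto simp: eventually_sequentially)
    then show ?thesis using z by (simp add: tendsto_eventually)
  qed
  have "(\<lambda>n. LINT x|torus. ?u x * h n (cis x)) \<longlonglongrightarrow> (LINT x|torus. ?u x * indicator C (cis x))"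
  proof (rule integral_dominated_convergence[where w = "\<lambda>x. cmod (?u x)"])
    have cm: "cis \<in> borel_measurable torus"
      by (intro borel_measurable_torus borel_measurable_continuous_onI continuous_intros)
    have "(\<lambda>x. indicator C (cis x) :: complex) \<in> borel_measurable torus"
      by (rule measurable_compose[OF cm]) (use C in simp)
    then show "(\<lambda>x. ?u x * indicator C (cis x)) \<in> borel_measurable torus" by measurable
    show "(\<lambda>x. ?u x * complex_of_real (h n (cis x))) \<in> borel_measurable torus" for n
    proof -
      have "h n \<in> borel_measurable borel" by (rule borel_measurable_continuous_onI[OF hc])
      then have [measurable]: "(\<lambda>x. h n (cis x)) \<in> borel_measurable torus"
        by (rule measurable_compose[OF cm])
      show ?thesis by measurable
    qed
    show "integrable torus (\<lambda>x. cmod (?u x))" using L2_integrable by simp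
    show "AE x in torus. (\<lambda>n. ?u x * complex_of_real (h n (cis x))) \<longlonglongrightarrow> ?u x * indicator C (cis x)"
    proof (rule AE_I2)
      fix x
      have "(\<lambda>n. complex_of_real (h n (cis x))) \<longlonglongrightarrow> complex_of_real (indicator C (cis x))"
        by (intro tendsto_of_real lim)
      then show "(\<lambda>n. ?u x * complex_of_real (h n (cis x))) \<longlonglongrightarrow> ?u x * indicator C (cis x)"
        by (intro tendsto_mult tendsto_const) (simp add: of_real_indicator)
    qed
    show "AE x in torus. cmod (?u x * complex_of_real (h n (cis x))) \<le> cmod (?u x)" for n
      using hb[of n] by (auto simp: norm_mult mult_left_le)
  qed
  moreover have "(LINT x|torus. ?u x * h n (cis x)) = 0" for n
    by (rule LINT_continuous_cis[OF hc])
  ultimately show ?thesis by (simp add: LIMSEQ_const_iff)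
qed simp

text \<open>The two end points are the same point of the circle, where membership in an arc does not
  tell whether \<open>x \<le> a\<close>.\<close>

lemma AE_torus_interior: "AE x in torus. x \<noteq> - pi \<and> x \<noteq> pi"
proof -
  have "AE x in lborel. x \<noteq> c" for c :: real by (rule AE_lborel_singleton)
  from this[of "-pi"] this[of pi] show ?thesis
    unfolding torus_def by (subst AE_restrict_space_iff) auto
qed

text \<open>Up to the end points, \<open>x \<le> a\<close> says that \<open>cis x\<close> lies in a
  closed arc, so the half-line is an instance of \<open>LINT_indicator_cis\<close>.\<close>

lemma LINT_atMost: "(LINT x|torus. indicator {..a} x *\<^sub>R rep_L2_torus u x) = 0"
proof -
  have cc: "continuous_on UNIV cis"
    by (intro continuous_intros)
  have cl: "closed (cis ` {-pi..min a pi})"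
    by (intro compact_imp_closed compact_continuous_image continuous_on_subset[OF cc]) auto
  have cm: "cis \<in> borel_measurable torus"
    by (intro borel_measurable_torus borel_measurable_continuous_onI cc)
  have iff: "cis x \<in> cis ` {-pi..min a pi} \<longleftrightarrow> x \<le> a" if x: "- pi < x" "x < pi" for x
  proof
    assume "cis x \<in> cis ` {-pi..min a pi}"
    then obtain y where y: "cis x = cis y" "-pi \<le> y" "y \<le> a" "y \<le> pi" by auto
    have "sin x = sin y \<and> cos x = cos y" using y(1) by (simp add: complex_eq_iff)
    then obtain n :: int where n: "x = y + 2 * pi * n"
      unfolding sin_cos_eq_iff by auto
    have "\<bar>2 * pi * n\<bar> < 2 * pi" using n x y by linarith
    then have "n = 0" by (simp add: abs_mult)
    then show "x \<le> a" using n y by simp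
  qed (use x in auto)
  have "(LINT x|torus. indicator {..a} x *\<^sub>R rep_L2_torus u x)
    = (LINT x|torus. rep_L2_torus u x * indicator (cis ` {-pi..min a pi}) (cis x))"
  proof (rule integral_cong_AE)
    have "indicat_real {..a} \<in> borel_measurable torus"
      by (intro borel_measurable_torus) simp
    then show "(\<lambda>x. indicator {..a} x *\<^sub>R rep_L2_torus u x) \<in> borel_measurable torus"
      by measurable
    have "(\<lambda>x. indicator (cis ` {-pi..min a pi}) (cis x) :: complex) \<in> borel_measurable torus"
      by (rule measurable_compose[OF cm]) (use cl in simp)
    then show "(\<lambda>x. rep_L2_torus u x * indicator (cis ` {-pi..min a pi}) (cis x)) \<in> borel_measurable torus"
      by measurable
    show "AE x in torus. indicator {..a} x *\<^sub>R rep_L2_torus u x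
        = rep_L2_torus u x * indicator (cis ` {-pi..min a pi}) (cis x)"
      using AE_torus_interior AE_space
    proof eventually_elim
      case (elim x)
      then have "- pi < x" "x < pi" by auto
      from iff[OF this] show ?case by (simp add: indicator_def)
    qed
  qed
  then show ?thesis using LINT_indicator_cis[OF cl] by simp
qed

text \<open>The sets over which \<open>u\<close>, extended by zero, has integral 0 form a Dynkin
  system (complements use that the coefficient at frequency 0 vanishes). It contains the half-lines,
  an intersection-stable generator, hence all Borel sets, and a density with all integrals 0
  vanishes almost everywhere.\<close>

lemma coeff0_eq_0: "u = 0"
proof -
  define g where "g x = indicator {-pi..pi} x *\<^sub>R rep_L2_torus u x" for x
  have gi: "integrable lborel g"
    using L2_integrable[of u] unfolding g_def torus_def by (subst (asm) integrable_restrict_space) auto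
  have gt: "(LINT x : A | lborel. g x) = (LINT x|torus. indicator A x *\<^sub>R rep_L2_torus u x)" for A
    unfolding torus_def set_lebesgue_integral_def g_def
    by (subst integral_restrict_space) (auto intro!: Bochner_Integration.integral_cong simp: indicator_def)
  have int: "set_integrable lborel X g" if "X \<in> sets borel" for X
    unfolding set_integrable_def using integrable_mult_indicator[OF _ gi, of X] that by simp
  have A: "(LINT x : A | lborel. g x) = 0" if "A \<in> sets borel" for A
  proof -
    have gen: "Int_stable (range (\<lambda>a::real. {..a}))" "range (\<lambda>a::real. {..a}) \<subseteq> Pow UNIV"
      "A \<in> sigma_sets UNIV (range (\<lambda>a::real. {..a}))"
      using that by (auto simp: Int_stable_def borel_eq_atMost)
    have meas: "X \<in> sets borel" if "X \<in> sigma_sets UNIV (range (\<lambda>a::real. {..a}))" for X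
      using that by (simp add: borel_eq_atMost)
    show ?thesis
      using gen
    proof (induction rule: sigma_sets_induct_disjoint)
      case (basic X)
      then show ?case using LINT_atMost by (auto simp: gt)
    next
      case empty
      then show ?case by (simp add: set_lebesgue_integral_def)
    next
      case (compl X)
      have "(LINT x : UNIV - X | lborel. g x) = (LINT x|lborel. g x - indicator X x *\<^sub>R g x)"
        unfolding set_lebesgue_integral_def
        by (intro Bochner_Integration.integral_cong) (auto simp: indicator_def)
      also have "\<dots> = (LINT x|lborel. g x) - (LINT x : X | lborel. g x)"
        using int[OF meas[OF compl(1)]] gi by (simp add: set_integrable_def set_lebesgue_integral_def)
      also have "(LINT x|lborel. g x) = (LINT x|torus. rep_L2_torus u x)"
        using gt[of UNIV] by (simp add: set_lebesgue_integral_def)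
      also have "\<dots> = 0"
        using coeff0[of 0] by (simp add: fourier_coeff_fexp)
      finally show ?case using compl by simp
    next
      case (union X)
      have "(LINT x : \<Union>(range X) | lborel. g x) = (\<Sum>i. LINT x : X i | lborel. g x)"
      proof (rule lebesgue_integral_countable_add)
        have X: "X i \<in> sets borel" for i using union meas by auto
        then show "X i \<in> sets lborel" for i by simp
        show "set_integrable lborel (\<Union>(range X)) g"
          by (rule int) (use X in auto)
        show "X i \<inter> X j = {}" if "i \<noteq> j" for i j
          using union that by (auto simp: disjoint_family_on_def)
      qed
      then show ?case using union by simp
    qed
  qed
  have "AE x in lborel. g x = 0"
    by (rule sigma_finite_measure.density_zero[OF sigma_finite_lborel gi]) (use A in simp)
  then have "AE x in torus. rep_L2_torus u x = 0"
    unfolding torus_def by (subst AE_restrict_space_iff) (auto simp: g_def elim: eventually_mono)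
  then show ?thesis
    by (intro L2_eqI) (use rep_zero in auto)
qed

end

lemma L2_coeff_eqI: "(\<And>k. L2_coeff u k = L2_coeff v k) \<Longrightarrow> u = v"
  using coeff0_eq_0[of "u - v"] by (simp add: L2_coeff_diff)

section \<open>Fourier series and Sobolev norms\<close>

definition trig_sum :: "int set \<Rightarrow> (int \<Rightarrow> complex) \<Rightarrow> L2_torus" where
  "trig_sum A c = (\<Sum>k\<in>A. scaleC (c k) (L2_fexp k))"

lemma L2_coeff_trig_sum: "finite A \<Longrightarrow> L2_coeff (trig_sum A c) j = (if j \<in> A then c j else 0)"
  by (simp add: trig_sum_def L2_coeff_sum L2_coeff_scaleC L2_coeff_L2_fexp if_distrib[where f = "(*) _"] cong: if_cong)

lemma inner_trig_sum: "inner u (trig_sum A c) = (\<Sum>k\<in>A. Re (L2_coeff u k * cnj (c k)))"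
  by (simp add: trig_sum_def inner_sum_right inner_L2_fexp)

lemma norm_trig_sum:
  assumes "finite A"
  shows "(norm (trig_sum A c))\<^sup>2 = (\<Sum>k\<in>A. (cmod (c k))\<^sup>2)"
proof -
  have "(norm (trig_sum A c))\<^sup>2 = (\<Sum>k\<in>A. Re (L2_coeff (trig_sum A c) k * cnj (c k)))"
    unfolding power2_norm_eq_inner inner_trig_sum ..
  also have "\<dots> = (\<Sum>k\<in>A. (cmod (c k))\<^sup>2)"
    by (rule sum.cong) (simp_all add: L2_coeff_trig_sum assms complex_norm_square[symmetric] del: of_real_power)
  finally show ?thesis .
qed

text \<open>By orthonormality the squared distance of two nested partial sums is a partial sum of
  the squared coefficients, so the net of finite partial sums is Cauchy and L^2 is complete.\<close>

lemma summable_L2_fexp: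
  assumes "(\<lambda>k. (cmod (c k))\<^sup>2) summable_on UNIV"
  shows "(\<lambda>k. scaleC (c k) (L2_fexp k)) summable_on UNIV"
proof -
  let ?f = "\<lambda>k. scaleC (c k) (L2_fexp k)" and ?n = "\<lambda>k. (cmod (c k))\<^sup>2"
  obtain L where L: "(?n has_sum L) UNIV" using assms by (auto simp: summable_on_def)
  have "\<exists>P. eventually P (finite_subsets_at_top UNIV) \<and>
      (\<forall>F F'. P F \<and> P F' \<longrightarrow> dist (sum ?f F) (sum ?f F') < e)" if "e > 0" for e
  proof -
    obtain F0 where F0: "finite F0" "dist (sum ?n F0) L \<le> (e / 3)\<^sup>2"
      using has_sum_finite_approximation[OF L, of "(e / 3)\<^sup>2"] \<open>e > 0\<close> by auto
    have near: "dist (sum ?f F) (sum ?f F0) \<le> e / 3" if F: "finite F" "F0 \<subseteq> F" for F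
    proof -
      have "sum ?f F - sum ?f F0 = trig_sum (F - F0) c"
        unfolding trig_sum_def using F F0 by (simp add: sum_diff)
      then have "(dist (sum ?f F) (sum ?f F0))\<^sup>2 = sum ?n (F - F0)"
        using norm_trig_sum[of "F - F0" c] F by (simp add: dist_norm)
      also have "\<dots> = sum ?n F - sum ?n F0" using F F0 by (simp add: sum_diff)
      also have "\<dots> \<le> L - sum ?n F0"
        using finite_sum_le_has_sum[OF L, of F] F by simp
      also have "\<dots> \<le> (e / 3)\<^sup>2" using F0(2) by (simp add: dist_real_def)
      finally show ?thesis
        by (rule power2_le_imp_le) (use \<open>e > 0\<close> in simp)
    qed
    let ?P = "\<lambda>F. finite F \<and> F0 \<subseteq> F"
    have "eventually ?P (finite_subsets_at_top UNIV)"
      unfolding eventually_finite_subsets_at_top using F0 by blast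
    moreover have "dist (sum ?f F) (sum ?f F') < e" if "?P F" "?P F'" for F F'
    proof -
      have "dist (sum ?f F) (sum ?f F') \<le> dist (sum ?f F) (sum ?f F0) + dist (sum ?f F') (sum ?f F0)"
        by (rule dist_triangle2)
      also have "\<dots> \<le> e / 3 + e / 3" using near that by (intro add_mono) auto
      also have "\<dots> < e" using \<open>e > 0\<close> by simp
      finally show ?thesis .
    qed
    ultimately show ?thesis by blast
  qed
  then have "cauchy_filter (filtermap (sum ?f) (finite_subsets_at_top UNIV))"
    by (simp add: cauchy_filter_metric_filtermap)
  moreover have "complete (UNIV :: L2_torus set)"
    by (meson Cauchy_convergent UNIV_I complete_def convergent_def)
  ultimately obtain L' where "(sum ?f \<longlongrightarrow> L') (finite_subsets_at_top UNIV)"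
    using complete_uniform[where S="UNIV :: L2_torus set"] by (force simp add: filterlim_def)
  then show ?thesis
    using summable_on_def has_sum_def by blast
qed

lemma L2_coeff_has_sum_L2_fexp:
  assumes "((\<lambda>k. scaleC (c k) (L2_fexp k)) has_sum u) UNIV"
  shows "L2_coeff u j = c j"
proof -
  have "((\<lambda>k. L2_coeff (scaleC (c k) (L2_fexp k)) j) has_sum L2_coeff u j) UNIV"
    by (rule has_sum_bounded_linear[OF bounded_linear_L2_coeff assms])
  moreover have "((\<lambda>k. L2_coeff (scaleC (c k) (L2_fexp k)) j) has_sum c j) UNIV"
    by (rule has_sum_finite_neutralI[where B = "{j}"]) (auto simp: L2_coeff_scaleC L2_coeff_L2_fexp)
  ultimately show ?thesis by (rule has_sum_unique)
qed

lemma riesz_fischer: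
  assumes "(\<lambda>k. (cmod (c k))\<^sup>2) summable_on UNIV"
  shows "\<exists>u. \<forall>k. L2_coeff u k = c k"
  using summable_L2_fexp[OF assms] L2_coeff_has_sum_L2_fexp unfolding summable_on_def by blast

lemma bessel:
  assumes "finite A"
  shows "(\<Sum>k\<in>A. (cmod (L2_coeff u k))\<^sup>2) \<le> (norm u)\<^sup>2"
proof -
  let ?p = "trig_sum A (L2_coeff u)"
  have i: "inner u ?p = (\<Sum>k\<in>A. (cmod (L2_coeff u k))\<^sup>2)"
    unfolding inner_trig_sum
    by (rule sum.cong) (simp_all add: complex_norm_square[symmetric] del: of_real_power)
  have "0 \<le> (norm (u - ?p))\<^sup>2" by simp
  also have "\<dots> = (norm u)\<^sup>2 - 2 * inner u ?p + (norm ?p)\<^sup>2"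
    by (simp add: power2_norm_eq_inner inner_diff_left inner_diff_right inner_commute)
  finally show ?thesis by (simp add: i norm_trig_sum assms)
qed

lemma summable_L2_coeff: "(\<lambda>k. (cmod (L2_coeff u k))\<^sup>2) summable_on UNIV"
proof (rule nonneg_bdd_above_summable_on)
  show "bdd_above (sum (\<lambda>k. (cmod (L2_coeff u k))\<^sup>2) ` {F. F \<subseteq> UNIV \<and> finite F})"
    by (rule bdd_aboveI2[where M = "(norm u)\<^sup>2"]) (use bessel in auto)
qed simp

text \<open>The series converges by Bessel's inequality, and its sum has the coefficients of
  \<open>u\<close>; completeness of the trigonometric system identifies the two.\<close>

lemma fourier_series: "((\<lambda>k. scaleC (L2_coeff u k) (L2_fexp k)) has_sum u) UNIV"
proof -
  obtain v where v: "((\<lambda>k. scaleC (L2_coeff u k) (L2_fexp k)) has_sum v) UNIV"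
    using summable_L2_fexp[OF summable_L2_coeff] by (auto simp: summable_on_def)
  have "v = u" by (rule L2_coeff_eqI) (rule L2_coeff_has_sum_L2_fexp[OF v])
  with v show ?thesis by simp
qed

lemma parseval: "((\<lambda>k. (cmod (L2_coeff u k))\<^sup>2) has_sum (norm u)\<^sup>2) UNIV"
proof -
  have "((\<lambda>k. inner u (scaleC (L2_coeff u k) (L2_fexp k))) has_sum inner u u) UNIV"
    by (rule has_sum_bounded_linear[OF bounded_linear_inner_right fourier_series])
  then show ?thesis
    by (simp add: inner_L2_fexp power2_norm_eq_inner complex_norm_square[symmetric] del: of_real_power)
qed

lemma norm_le_has_sum:
  assumes "\<And>k. (cmod (L2_coeff u k))\<^sup>2 \<le> w k" "(w has_sum W) UNIV"
  shows "(norm u)\<^sup>2 \<le> W"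
  by (rule has_sum_mono[OF parseval assms(2)]) (use assms(1) in auto)

lemma norm_le_coeff:
  assumes "\<And>k. cmod (L2_coeff u k) \<le> cmod (L2_coeff v k)"
  shows "norm u \<le> norm v"
proof -
  have "(norm u)\<^sup>2 \<le> (norm v)\<^sup>2"
    by (rule norm_le_has_sum[OF _ parseval]) (use assms in \<open>simp add: power_mono\<close>)
  then show ?thesis by (rule power2_le_imp_le) simp
qed

lemma norm_eq_coeff:
  assumes "\<And>k. cmod (L2_coeff u k) = cmod (L2_coeff v k)"
  shows "norm u = norm v"
  using assms by (intro antisym norm_le_coeff) auto

text \<open>The hypothesis is what gives the description in \<open>multiplier\<close> a meaning:
  Riesz-Fischer supplies existence, completeness supplies uniqueness.\<close>

lemma multiplier_coeff:
  assumes "(\<lambda>k. (cmod (m k * fourier_coeff f k))\<^sup>2) summable_on UNIV"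
  shows "L2_coeff (multiplier m f) k = m k * fourier_coeff f k"
proof -
  obtain u where u: "\<And>k. L2_coeff u k = m k * fourier_coeff f k"
    using riesz_fischer[OF assms] by blast
  have "\<forall>k. L2_coeff (multiplier m f) k = m k * fourier_coeff f k"
    unfolding multiplier_def
    by (rule theI[where a = u]) (auto simp: u intro: L2_coeff_eqI)
  then show ?thesis by blast
qed

subsection \<open>Brackets\<close>

lemma bracket_power2: "(bracket k)\<^sup>2 = 1 + (of_int k)\<^sup>2"
  by (simp add: bracket_def)

lemma bracket_ge_1: "1 \<le> bracket k"
  by (simp add: bracket_def)

lemma bracket_pos [simp]: "0 < bracket k"
  using bracket_ge_1[of k] by linarith

lemma abs_le_bracket: "\<bar>of_int k\<bar> \<le> bracket k"
  unfolding bracket_def by (rule real_le_rsqrt) simp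

lemma bracket_neq_0 [simp]: "bracket k \<noteq> 0"
  using bracket_pos[of k] by linarith

lemma bracket_minus [simp]: "bracket (- k) = bracket k"
  by (simp add: bracket_def)

lemma bracket_triangle: "bracket k \<le> bracket j + bracket (k - j)"
proof -
  have "(bracket k)\<^sup>2 = 1 + (of_int j + of_int (k - j))\<^sup>2" by (simp add: bracket_power2)
  also have "\<dots> \<le> 1 + (\<bar>of_int j\<bar> + \<bar>of_int (k - j)\<bar>)\<^sup>2"
    by (simp add: power2_le_iff_abs_le)
  also have "\<dots> \<le> (bracket j)\<^sup>2 + (bracket (k - j))\<^sup>2 + 2 * (\<bar>of_int j\<bar> * \<bar>of_int (k - j)\<bar>)"
    by (simp add: bracket_power2 power2_sum)
  also have "\<dots> \<le> (bracket j)\<^sup>2 + (bracket (k - j))\<^sup>2 + 2 * (bracket j * bracket (k - j))"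
    by (intro add_left_mono mult_left_mono mult_mono abs_le_bracket) (auto intro: less_imp_le)
  also have "\<dots> = (bracket j + bracket (k - j))\<^sup>2" by (simp add: power2_sum)
  finally show ?thesis by (rule power2_le_imp_le) (simp add: add_nonneg_nonneg less_imp_le)
qed

text \<open>Passing through the maximum of the two brackets works for every exponent
  \<open>r \<ge> 0\<close>, at the price of the factor \<open>2 powr r\<close>.\<close>

lemma bracket_powr_triangle:
  assumes "r \<ge> 0"
  shows "bracket k powr r \<le> 2 powr r * (bracket j powr r + bracket (k - j) powr r)"
proof -
  let ?m = "max (bracket j) (bracket (k - j))"
  have "bracket k powr r \<le> (2 * ?m) powr r"
    using bracket_triangle[of k j] assms by (intro powr_mono2) (auto intro: less_imp_le)
  also have "\<dots> = 2 powr r * ?m powr r"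
    by (rule powr_mult)
  also have "?m powr r \<le> bracket j powr r + bracket (k - j) powr r"
    by (auto simp: max_def)
  finally show ?thesis by simp
qed

lemma summable_bracket:
  assumes "a > 1"
  shows "(\<lambda>k. bracket k powr (- a)) summable_on UNIV"
proof -
  have "summable (\<lambda>n. bracket (int n) powr (- a))"
  proof (rule summable_comparison_test_ev)
    show "summable (\<lambda>n. of_nat n powr (- a) :: real)"
      using assms by (simp add: summable_real_powr_iff)
    show "\<forall>\<^sub>F n in sequentially. norm (bracket (int n) powr (- a)) \<le> of_nat n powr (- a)"
      using eventually_gt_at_top[of 0]
    proof eventually_elim
      case (elim n)
      then show ?case
        using abs_le_bracket[of "int n"] assms by (auto intro!: powr_mono2')
    qed
  qed
  then have n: "(\<lambda>n. bracket (int n) powr (- a)) summable_on UNIV"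
    by (subst summable_on_UNIV_nonneg_real_iff) auto
  have "(\<lambda>k. bracket k powr (- a)) summable_on range int"
    using n by (subst summable_on_reindex) (auto simp: o_def)
  moreover have "(\<lambda>k. bracket k powr (- a)) summable_on range (\<lambda>n. - int n)"
    using n by (subst summable_on_reindex) (auto simp: o_def inj_def)
  ultimately have "(\<lambda>k. bracket k powr (- a)) summable_on (range int \<union> range (\<lambda>n. - int n))"
    by (rule summable_on_union)
  also have "range int \<union> range (\<lambda>n. - int n) = UNIV"
  proof -
    have "k \<in> range int \<union> range (\<lambda>n. - int n)" for k
      by (cases k rule: int_cases2) auto
    then show ?thesis by blast
  qed
  finally show ?thesis .
qed

lemma bracket_powr_neg_2: "bracket k powr (- 2) = 1 / (bracket k)\<^sup>2"
  using powr_realpow[OF bracket_pos, of k 2] by (simp add: powr_minus divide_inverse)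

lemma abs_phi_le: "\<bar>phi k\<bar> \<le> 1 / bracket k"
proof -
  have "\<bar>phi k\<bar> = \<bar>of_int k\<bar> / (bracket k)\<^sup>2"
    by (simp add: phi_def bracket_power2 abs_divide)
  also have "\<dots> \<le> bracket k / (bracket k)\<^sup>2"
    by (intro divide_right_mono abs_le_bracket) simp
  also have "\<dots> = 1 / bracket k" by (simp add: power2_eq_square)
  finally show ?thesis .
qed

lemma abs_phi_le_1: "\<bar>phi k\<bar> \<le> 1"
  using abs_phi_le[of k] bracket_ge_1[of k] by (auto intro: order_trans simp: divide_le_eq)

text \<open>The squared l^2 norm of \<open>1 / bracket\<close>. It is the constant both in the gain
  from \<open>phi\<close>, which turns bounded coefficients into square summable ones, and in the
  embedding of H^1 into absolutely convergent Fourier series.\<close>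

definition bracket_sum :: real where "bracket_sum = (\<Sum>\<^sub>\<infinity>k. bracket k powr (- 2))"

lemma bracket_sum_has_sum: "((\<lambda>k. 1 / (bracket k)\<^sup>2) has_sum bracket_sum) UNIV"
  using has_sum_infsum[OF summable_bracket[of 2]] by (simp add: bracket_sum_def bracket_powr_neg_2)

lemma bracket_sum_nonneg: "0 \<le> bracket_sum"
  by (rule has_sum_nonneg[OF bracket_sum_has_sum]) simp

lemma norm_le_bracket:
  assumes "\<And>k. cmod (L2_coeff u k) \<le> B / bracket k" "B \<ge> 0"
  shows "norm u \<le> sqrt bracket_sum * B"
proof -
  have "(norm u)\<^sup>2 \<le> B\<^sup>2 * bracket_sum"
  proof (rule norm_le_has_sum)
    show "((\<lambda>k. B\<^sup>2 * (1 / (bracket k)\<^sup>2)) has_sum B\<^sup>2 * bracket_sum) UNIV"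
      by (rule has_sum_cmult_right[OF bracket_sum_has_sum])
    show "(cmod (L2_coeff u k))\<^sup>2 \<le> B\<^sup>2 * (1 / (bracket k)\<^sup>2)" for k
      using power_mono[OF assms(1)[of k], of 2] by (simp add: power_divide)
  qed
  then have "norm u \<le> sqrt (B\<^sup>2 * bracket_sum)" by (rule real_le_rsqrt)
  also have "\<dots> = sqrt bracket_sum * B" using assms(2) by (simp add: real_sqrt_mult)
  finally show ?thesis .
qed

subsection \<open>Products\<close>

lemma prod_coeff_L2_fexp: "prod_coeff (L2_fexp j) v k = L2_coeff v (k - j)"
proof -
  have "prod_coeff (L2_fexp j) v k = fourier_coeff (\<lambda>x. fexp j x * rep_L2_torus v x) k"
    unfolding prod_coeff_def L2_fexp_def
    by (rule fourier_coeff_cong_AE) (use rep_abs_AE[OF fexp_in[of j]] in auto)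
  also have "\<dots> = L2_coeff v (k - j)"
  proof -
    have "fexp j x * y * fexp (- k) x = y * fexp (- (k - j)) x" for x y
      using fexp_add[of j "- k" x] by (simp add: mult_ac)
    then show ?thesis by (simp only: fourier_coeff_fexp)
  qed
  finally show ?thesis .
qed

lemma prod_coeff_has_sum: "((\<lambda>j. L2_coeff u j * L2_coeff v (k - j)) has_sum prod_coeff u v k) UNIV"
  using has_sum_bounded_linear[OF bounded_bilinear.bounded_linear_left[OF bounded_bilinear_prod_coeff] fourier_series,
      of u v k]
  by (simp add: prod_coeff_scaleC_left prod_coeff_L2_fexp)

text \<open>The summability half of \<open>Hs\<close>; reality is propagated separately, by
  conjugation symmetry.\<close>

definition Hsum :: "real \<Rightarrow> L2_torus \<Rightarrow> bool" where
  "Hsum s u \<longleftrightarrow> (\<lambda>k. (bracket k powr s * cmod (L2_coeff u k))\<^sup>2) summable_on UNIV"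

lemma norm_has_sum_le:
  fixes f :: "'a \<Rightarrow> complex"
  assumes "(f has_sum S) A" "\<And>F. finite F \<Longrightarrow> F \<subseteq> A \<Longrightarrow> cmod (sum f F) \<le> B"
  shows "cmod S \<le> B"
proof -
  have "((\<lambda>F. cmod (sum f F)) \<longlongrightarrow> cmod S) (finite_subsets_at_top A)"
    using assms(1) unfolding has_sum_def by (rule tendsto_norm)
  then show ?thesis
    by (rule tendsto_upperbound) (use assms(2) in \<open>auto intro: eventually_finite_subsets_at_top_weakI\<close>)
qed

lemma sum_mult_le_sqrt:
  fixes a b :: "'a \<Rightarrow> real"
  assumes "(\<Sum>k\<in>A. (a k)\<^sup>2) \<le> X\<^sup>2" "(\<Sum>k\<in>A. (b k)\<^sup>2) \<le> Y\<^sup>2" "X \<ge> 0" "Y \<ge> 0"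
  shows "(\<Sum>k\<in>A. a k * b k) \<le> X * Y"
proof -
  have "(\<Sum>k\<in>A. a k * b k)\<^sup>2 \<le> (\<Sum>k\<in>A. (a k)\<^sup>2) * (\<Sum>k\<in>A. (b k)\<^sup>2)"
    by (rule Cauchy_Schwarz_ineq_sum)
  also have "\<dots> \<le> X\<^sup>2 * Y\<^sup>2" by (intro mult_mono assms sum_nonneg) auto
  finally show ?thesis
    using power2_le_imp_le[of "\<Sum>k\<in>A. a k * b k" "X * Y"] assms by (simp add: power_mult_distrib)
qed

lemma Hs_norm_nonneg: "0 \<le> Hs_norm s u"
  unfolding Hs_norm_def by (intro real_sqrt_ge_zero infsum_nonneg) simp

text \<open>In the convolution over \<open>j\<close> and \<open>k - j\<close> the weight is split
  between the two factors. In each half Cauchy-Schwarz pairs the weighted factor in l^2 with the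
  unweighted one, so only one factor pays the H^r norm; the reflection of \<open>j\<close> in
  \<open>k\<close> treats both halves alike.\<close>

lemma prod_coeff_weighted_bound:
  assumes r: "r \<ge> 0" and u: "Hsum r u"
  shows "bracket k powr r * cmod (prod_coeff u u k) \<le> 2 powr r * (2 * (Hs_norm r u * norm u))"
proof -
  let ?c = "\<lambda>j. cmod (L2_coeff u j)"
  have H: "(\<Sum>j\<in>F. (bracket j powr r * ?c j)\<^sup>2) \<le> (Hs_norm r u)\<^sup>2" if "finite F" for F
    using finite_sum_le_infsum[OF u[unfolded Hsum_def], of F] that
    by (simp add: Hs_norm_def infsum_nonneg)
  have refl: "(\<Sum>j\<in>F. h (k - j)) = (\<Sum>j\<in>(\<lambda>j. k - j) ` F. h j)" for F and h :: "int \<Rightarrow> real"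
    by (subst sum.reindex) (auto simp: inj_on_def)
  have "cmod (prod_coeff u u k) \<le> 2 powr r * (2 * (Hs_norm r u * norm u)) / bracket k powr r"
  proof (rule norm_has_sum_le[OF prod_coeff_has_sum])
    fix F :: "int set" assume F: "finite F"
    have "bracket k powr r * cmod (\<Sum>j\<in>F. L2_coeff u j * L2_coeff u (k - j))
        \<le> bracket k powr r * (\<Sum>j\<in>F. ?c j * ?c (k - j))"
      by (intro mult_left_mono order_trans[OF norm_sum]) (simp_all add: norm_mult)
    also have "\<dots> = (\<Sum>j\<in>F. bracket k powr r * (?c j * ?c (k - j)))"
      by (rule sum_distrib_left)
    also have "\<dots> \<le> (\<Sum>j\<in>F. 2 powr r * (bracket j powr r + bracket (k - j) powr r) * (?c j * ?c (k - j)))"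
      by (intro sum_mono mult_right_mono bracket_powr_triangle r) auto
    also have "\<dots> = 2 powr r * ((\<Sum>j\<in>F. (bracket j powr r * ?c j) * ?c (k - j))
        + (\<Sum>j\<in>F. (bracket (k - j) powr r * ?c (k - j)) * ?c j))"
      by (simp add: sum_distrib_left sum.distrib[symmetric] ring_distribs mult_ac)
    also have "\<dots> \<le> 2 powr r * (Hs_norm r u * norm u + Hs_norm r u * norm u)"
    proof (intro mult_left_mono add_mono sum_mult_le_sqrt)
      show "(\<Sum>j\<in>F. (bracket j powr r * ?c j)\<^sup>2) \<le> (Hs_norm r u)\<^sup>2" using H F by blast
      show "(\<Sum>j\<in>F. (bracket (k - j) powr r * ?c (k - j))\<^sup>2) \<le> (Hs_norm r u)\<^sup>2"
        using H[of "(\<lambda>j. k - j) ` F"] F refl[of "\<lambda>j. (bracket j powr r * ?c j)\<^sup>2" F] by simp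
      show "(\<Sum>j\<in>F. (?c (k - j))\<^sup>2) \<le> (norm u)\<^sup>2"
        using bessel[of "(\<lambda>j. k - j) ` F" u] F refl[of "\<lambda>j. (?c j)\<^sup>2" F] by simp
      show "(\<Sum>j\<in>F. (?c j)\<^sup>2) \<le> (norm u)\<^sup>2" using bessel F by blast
    qed (auto simp: Hs_norm_nonneg)
    finally show "cmod (\<Sum>j\<in>F. L2_coeff u j * L2_coeff u (k - j))
        \<le> 2 powr r * (2 * (Hs_norm r u * norm u)) / bracket k powr r"
      by (simp add: pos_le_divide_eq mult.commute)
  qed
  then show ?thesis
    by (simp add: pos_le_divide_eq mult.commute)
qed

subsection \<open>Complex conjugation\<close>

text \<open>It turns reality into the fixed-point equation \<open>L2_cnj u = u\<close> of a
  real-linear isometry, a condition that Gronwall's inequality can propagate.\<close>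

definition L2_cnj :: "L2_torus \<Rightarrow> L2_torus" where
  "L2_cnj u = abs_L2_torus (\<lambda>x. cnj (rep_L2_torus u x))"

lemma rep_L2_cnj: "AE x in torus. rep_L2_torus (L2_cnj u) x = cnj (rep_L2_torus u x)"
  unfolding L2_cnj_def by (rule rep_abs_AE[OF L2_fun_cnj[OF rep_in]])

lemma cnj_rep_measurable [measurable]: "(\<lambda>x. cnj (rep_L2_torus u x)) \<in> borel_measurable torus"
  by (rule L2_fun_measurable[OF L2_fun_cnj[OF rep_in]])

lemma fourier_coeff_cnj: "fourier_coeff (\<lambda>x. cnj (f x)) k = cnj (fourier_coeff f (- k))"
proof -
  have "(LINT x|torus. cnj (f x) * fexp (- k) x) = (LINT x|torus. cnj (f x * fexp k x))"
    by (simp add: cnj_fexp)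
  also have "\<dots> = cnj (LINT x|torus. f x * fexp k x)"
    by (rule Bochner_Integration.integral_cnj)
  finally show ?thesis by (simp add: fourier_coeff_fexp)
qed

lemma L2_coeff_L2_cnj: "L2_coeff (L2_cnj u) k = cnj (L2_coeff u (- k))"
proof -
  have "L2_coeff (L2_cnj u) k = fourier_coeff (\<lambda>x. cnj (rep_L2_torus u x)) k"
    by (rule fourier_coeff_cong_AE) (use rep_L2_cnj in auto)
  then show ?thesis by (simp add: fourier_coeff_cnj)
qed

lemma prod_coeff_L2_cnj: "prod_coeff (L2_cnj u) (L2_cnj v) k = cnj (prod_coeff u v (- k))"
proof -
  have "prod_coeff (L2_cnj u) (L2_cnj v) k = fourier_coeff (\<lambda>x. cnj (rep_L2_torus u x * rep_L2_torus v x)) k"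
    unfolding prod_coeff_def
    by (rule fourier_coeff_cong_AE) (use rep_L2_cnj[of u] rep_L2_cnj[of v] in auto)
  then show ?thesis by (simp only: fourier_coeff_cnj prod_coeff_def)
qed

lemma real_valued_iff_L2_cnj: "real_valued u \<longleftrightarrow> L2_cnj u = u"
proof
  assume "real_valued u"
  then show "L2_cnj u = u"
    unfolding real_valued_def
    by (intro L2_eqI) (use rep_L2_cnj[of u] in \<open>auto elim!: eventually_elim2 simp: Reals_cnj_iff\<close>)
next
  assume "L2_cnj u = u"
  then have "AE x in torus. rep_L2_torus u x = cnj (rep_L2_torus u x)"
    using rep_L2_cnj[of u] by simp
  then show "real_valued u"
    unfolding real_valued_def by eventually_elim (simp add: Reals_cnj_iff)
qed

lemma norm_L2_cnj: "norm (L2_cnj u) = norm u"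
proof (rule power2_eq_imp_eq)
  show "(norm (L2_cnj u))\<^sup>2 = (norm u)\<^sup>2"
    unfolding norm_rep
    by (rule arg_cong[where f = "\<lambda>y. y / (2 * pi)"], rule integral_cong_AE) (use rep_L2_cnj[of u] in auto)
qed auto

lemma bounded_linear_L2_cnj: "bounded_linear L2_cnj"
proof (rule bounded_linear_intro[where K = 1])
  show "L2_cnj (u + v) = L2_cnj u + L2_cnj v" for u v
    by (rule L2_coeff_eqI) (simp add: L2_coeff_L2_cnj L2_coeff_add)
  show "L2_cnj (r *\<^sub>R u) = r *\<^sub>R L2_cnj u" for r u
    by (rule L2_coeff_eqI) (simp add: L2_coeff_L2_cnj L2_coeff_scaleR)
qed (simp add: norm_L2_cnj)

lemma real_valued_coeff: "real_valued u \<Longrightarrow> L2_coeff u (- k) = cnj (L2_coeff u k)"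
  by (metis L2_coeff_L2_cnj real_valued_iff_L2_cnj complex_cnj_cnj)

lemma real_valued_diff: "real_valued u \<Longrightarrow> real_valued v \<Longrightarrow> real_valued (u - v)"
  by (simp add: real_valued_iff_L2_cnj linear_diff[OF bounded_linear.linear[OF bounded_linear_L2_cnj]])

section \<open>Ordinary differential equations with a Lipschitz right-hand side\<close>

text \<open>Anchoring the integral at the left end \<open>a\<close> removes the case distinction on
  the sign of \<open>t\<close>, so that one derivative rule serves both time directions.\<close>

lemma oriented_integral_split:
  fixes f :: "real \<Rightarrow> 'a::banach"
  assumes "continuous_on {a..b} f" "a \<le> 0" "0 \<le> b" "t \<in> {a..b}"
  shows "oriented_integral 0 t f = integral {a..t} f - integral {a..0} f"
proof -
  have i: "f integrable_on {a..x}" if "x \<in> {a..b}" for x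
    by (rule integrable_continuous_interval, rule continuous_on_subset[OF assms(1)]) (use that in auto)
  show ?thesis
  proof (cases "0 \<le> t")
    case True
    have "integral {a..0} f + integral {0..t} f = integral {a..t} f"
      by (rule Henstock_Kurzweil_Integration.integral_combine) (use True assms i in auto)
    then show ?thesis using True by (simp add: oriented_integral_def algebra_simps)
  next
    case False
    have "integral {a..t} f + integral {t..0} f = integral {a..0} f"
      by (rule Henstock_Kurzweil_Integration.integral_combine) (use False assms i in auto)
    then show ?thesis using False by (simp add: oriented_integral_def algebra_simps)
  qed
qed

lemma oriented_integral_deriv:
  fixes f :: "real \<Rightarrow> 'a::banach"
  assumes "continuous_on {a..b} f" "a \<le> 0" "0 \<le> b" "t \<in> {a..b}"
  shows "((\<lambda>t. oriented_integral 0 t f) has_vector_derivative f t) (at t within {a..b})"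
proof -
  have "((\<lambda>t. integral {a..t} f - integral {a..0} f) has_vector_derivative f t - 0) (at t within {a..b})"
    by (intro has_vector_derivative_diff integral_has_vector_derivative has_vector_derivative_const assms)
  then have *: "((\<lambda>t. integral {a..t} f - integral {a..0} f) has_vector_derivative f t) (at t within {a..b})"
    by simp
  show ?thesis
    by (rule has_vector_derivative_transform[OF assms(4) _ *])
      (rule oriented_integral_split[OF assms(1-3)])
qed

lemma oriented_integral_deriv_UNIV:
  fixes f :: "real \<Rightarrow> 'a::banach"
  assumes "continuous_on UNIV f"
  shows "((\<lambda>t. oriented_integral 0 t f) has_vector_derivative f t) (at t)"
proof -
  have "((\<lambda>t. oriented_integral 0 t f) has_vector_derivative f t)
      (at t within {- \<bar>t\<bar> - 1..\<bar>t\<bar> + 1})"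
    by (rule oriented_integral_deriv[OF continuous_on_subset[OF assms]]) auto
  moreover have "at t within {- \<bar>t\<bar> - 1..\<bar>t\<bar> + 1} = at t"
    by (rule at_within_interior) (auto simp: interior_atLeastAtMost_real abs_if)
  ultimately show ?thesis by simp
qed

lemma oriented_integral_0 [simp]: "oriented_integral 0 0 f = 0"
  by (simp add: oriented_integral_def)

lemma oriented_integral_diff:
  fixes f g :: "real \<Rightarrow> 'a::banach"
  assumes "continuous_on UNIV f" "continuous_on UNIV g"
  shows "oriented_integral 0 t (\<lambda>\<tau>. f \<tau> - g \<tau>) = oriented_integral 0 t f - oriented_integral 0 t g"
proof -
  have "f integrable_on {a..b}" "g integrable_on {a..b}" for a b
    by (auto intro!: integrable_continuous_interval continuous_on_subset[OF assms(1)] continuous_on_subset[OF assms(2)])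
  then show ?thesis
    by (simp add: oriented_integral_def Henstock_Kurzweil_Integration.integral_diff)
qed

text \<open>Integrating \<open>exp (L * \<bar>\<tau>\<bar>)\<close> gains \<open>1 / L\<close>; with
  \<open>L\<close> twice the Lipschitz constant this is the contraction factor in
  \<open>picard\<close>.\<close>

lemma oriented_integral_exp_bound:
  fixes f :: "real \<Rightarrow> 'a::banach"
  assumes f: "continuous_on UNIV f" and C: "\<And>\<tau>. norm (f \<tau>) \<le> C * exp (L * \<bar>\<tau>\<bar>)" and L: "L > 0" "C \<ge> 0"
  shows "norm (oriented_integral 0 t f) \<le> C / L * exp (L * \<bar>t\<bar>)"
proof (cases "0 \<le> t")
  case True
  have "((\<lambda>\<tau>. C * exp (L * \<tau>)) has_integral (C / L * exp (L * t) - C / L * exp (L * 0))) {0..t}"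
    by (rule fundamental_theorem_of_calculus[OF True])
      (use L in \<open>auto intro!: derivative_eq_intros simp flip: has_real_derivative_iff_has_vector_derivative\<close>)
  moreover have "(f has_integral oriented_integral 0 t f) {0..t}"
    using True by (auto simp: oriented_integral_def intro!: integrable_integral integrable_continuous_interval continuous_on_subset[OF f])
  moreover have "norm (f \<tau>) \<le> C * exp (L * \<tau>)" if "\<tau> \<in> {0..t}" for \<tau>
    using C[of \<tau>] that by simp
  ultimately have "norm (oriented_integral 0 t f) \<le> C / L * exp (L * t) - C / L * exp (L * 0)"
    using integral_norm_bound_integral[of f "{0..t}" "\<lambda>\<tau>. C * exp (L * \<tau>)"]
    by (metis has_integral_integrable_integral)
  also have "\<dots> \<le> C / L * exp (L * t)" using L by simp
  finally show ?thesis using True by simp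
next
  case False
  have "((\<lambda>\<tau>. C * exp (- L * \<tau>)) has_integral (- (C / L) * exp (- L * 0) - (- (C / L) * exp (- L * t)))) {t..0}"
    by (rule fundamental_theorem_of_calculus)
      (use L False in \<open>auto intro!: derivative_eq_intros simp flip: has_real_derivative_iff_has_vector_derivative\<close>)
  moreover have "(f has_integral integral {t..0} f) {t..0}"
    by (auto intro!: integrable_integral integrable_continuous_interval continuous_on_subset[OF f])
  moreover have "norm (f \<tau>) \<le> C * exp (- L * \<tau>)" if "\<tau> \<in> {t..0}" for \<tau>
    using C[of \<tau>] that by simp
  ultimately have "norm (integral {t..0} f) \<le> - (C / L) * exp (- L * 0) - (- (C / L) * exp (- L * t))"
    using integral_norm_bound_integral[of f "{t..0}" "\<lambda>\<tau>. C * exp (- L * \<tau>)"]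
    by (metis has_integral_integrable_integral)
  also have "\<dots> \<le> C / L * exp (L * \<bar>t\<bar>)" using L False by simp
  finally show ?thesis using False by (simp add: oriented_integral_def)
qed

text \<open>The contraction is for the sup norm with weight \<open>exp (- 2 K |t|)\<close>, in which one Picard step gains a factor 1/2.\<close>

lemma picard:
  fixes G :: "'a::banach \<Rightarrow> 'a"
  assumes G0: "G 0 = 0" and K: "K > 0" and lip: "\<And>x y. norm (G x - G y) \<le> K * norm (x - y)"
  shows "\<exists>u. u 0 = x0 \<and> (\<forall>t. (u has_vector_derivative G (u t)) (at t))"
proof -
  define e where "e t = exp (2 * K * \<bar>t\<bar>)" for t :: real
  have e: "e t > 0" "e t \<ge> 1" for t using K by (simp_all add: e_def)
  have ce: "continuous_on A e" for A unfolding e_def by (intro continuous_intros)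
  have cG: "continuous_on A G" for A
    by (rule lipschitz_on_continuous_on[where L = K])
      (use lip K in \<open>auto intro!: lipschitz_onI simp: dist_norm\<close>)
  \<comment> \<open>The unknown \<open>z\<close> is the solution divided by the weight
    \<open>e\<close>, a bounded continuous function; the weighted norm thereby becomes the sup norm
    of the Banach space of bounded continuous functions.\<close>
  define g where "g z \<tau> = G (e \<tau> *\<^sub>R apply_bcontfun z \<tau>)" for z and \<tau> :: real
  have cg: "continuous_on UNIV (g z)" for z
    unfolding g_def by (rule continuous_on_compose2[OF cG]) (auto intro!: continuous_intros ce)
  define y where "y z t = x0 + oriented_integral 0 t (g z)" for z t
  have dy: "(y z has_vector_derivative g z t) (at t)" for z t
    unfolding y_def
    by (rule derivative_eq_intros oriented_integral_deriv_UNIV[OF cg] refl | simp)+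
  have cy: "continuous_on UNIV (y z)" for z
    by (rule continuous_at_imp_continuous_on) (use dy has_vector_derivative_continuous in blast)
  define Phi where "Phi z = Bcontfun (\<lambda>t. inverse (e t) *\<^sub>R y z t)" for z
  have diff: "norm (oriented_integral 0 t (g z) - oriented_integral 0 t (g w)) \<le> dist z w / 2 * e t" for z w t
  proof -
    have "norm (oriented_integral 0 t (\<lambda>\<tau>. g z \<tau> - g w \<tau>)) \<le> (K * dist z w) / (2 * K) * exp (2 * K * \<bar>t\<bar>)"
    proof (rule oriented_integral_exp_bound)
      show "continuous_on UNIV (\<lambda>\<tau>. g z \<tau> - g w \<tau>)" by (intro continuous_intros cg)
      show "0 < 2 * K" "0 \<le> K * dist z w" using K by auto
      fix \<tau>
      have "norm (g z \<tau> - g w \<tau>) \<le> K * norm (e \<tau> *\<^sub>R apply_bcontfun z \<tau> - e \<tau> *\<^sub>R apply_bcontfun w \<tau>)"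
        unfolding g_def by (rule lip)
      also have "\<dots> = K * (e \<tau> * dist (apply_bcontfun z \<tau>) (apply_bcontfun w \<tau>))"
        using e(1)[of \<tau>] by (simp add: dist_norm flip: scaleR_diff_right)
      also have "\<dots> \<le> K * (e \<tau> * dist z w)"
        using K e(1)[of \<tau>] by (intro mult_left_mono dist_bounded) auto
      finally show "norm (g z \<tau> - g w \<tau>) \<le> K * dist z w * exp (2 * K * \<bar>\<tau>\<bar>)"
        by (simp add: e_def mult_ac)
    qed
    then show ?thesis using K by (simp add: oriented_integral_diff cg e_def)
  qed
  \<comment> \<open>Here \<open>G0\<close> enters: the difference bound against \<open>w = 0\<close>
    becomes a growth bound, which keeps the Picard iterate bounded after division by
    \<open>e\<close>.\<close>
  have "g 0 = (\<lambda>_. 0)" by (simp add: g_def G0 fun_eq_iff)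
  then have "oriented_integral 0 t (g 0) = 0" for t by (simp add: oriented_integral_def)
  then have bd: "norm (oriented_integral 0 t (g z)) \<le> norm z / 2 * e t" for z t
    using diff[of t z 0] by (simp add: dist_norm)
  have Phi: "apply_bcontfun (Phi z) t = inverse (e t) *\<^sub>R y z t" for z t
  proof -
    have "(\<lambda>t. inverse (e t) *\<^sub>R y z t) \<in> bcontfun"
    proof (rule bcontfun_normI)
      show "continuous_on UNIV (\<lambda>t. inverse (e t) *\<^sub>R y z t)"
        using e(1) by (intro continuous_intros ce cy) (metis less_irrefl)
      fix t
      have "norm (y z t) \<le> norm x0 + norm z / 2 * e t"
        unfolding y_def by (intro order_trans[OF norm_triangle_ineq] add_left_mono bd)
      also have "\<dots> \<le> (norm x0 + norm z) * e t"
        using e[of t] mult_left_mono[OF e(2)[of t] norm_ge_zero[of x0]]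
        by (simp add: distrib_right mult_right_mono add_mono)
      finally show "norm (inverse (e t) *\<^sub>R y z t) \<le> norm x0 + norm z"
        using e(1)[of t] by (simp add: field_simps)
    qed
    then show ?thesis by (simp add: Phi_def Bcontfun_inverse)
  qed
  have "\<exists>!z. Phi z = z"
  proof (rule banach_fix_type[where c = "1 / 2"])
    have "dist (Phi z) (Phi w) \<le> 1 / 2 * dist z w" for z w
    proof (rule dist_bound)
      fix t
      have "dist (Phi z t) (Phi w t) = inverse (e t) * norm (oriented_integral 0 t (g z) - oriented_integral 0 t (g w))"
        using e(1)[of t] by (simp add: Phi dist_norm y_def flip: scaleR_diff_right)
      also have "\<dots> \<le> inverse (e t) * (dist z w / 2 * e t)"
        using e(1)[of t] by (intro mult_left_mono diff) auto
      also have "\<dots> = 1 / 2 * dist z w"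
        using e(1)[of t] by (simp add: field_simps)
      finally show "dist (Phi z t) (Phi w t) \<le> 1 / 2 * dist z w" .
    qed
    then show "\<forall>z w. dist (Phi z) (Phi w) \<le> 1 / 2 * dist z w" by blast
  qed auto
  then obtain z where z: "Phi z = z" by blast
  have yz: "e t *\<^sub>R apply_bcontfun z t = y z t" for t
    using Phi[of z t] e(1)[of t] by (simp add: z)
  have "g z t = G (y z t)" for t by (simp add: g_def yz)
  moreover have "y z 0 = x0" by (simp add: y_def)
  ultimately show ?thesis using dy by metis
qed

text \<open>The bound on the absolute value of \<open>f'\<close> serves both time directions. The
  integrating factor is applied to \<open>f + B / A\<close>, which absorbs the
  inhomogeneity.\<close>

lemma gronwall:
  fixes f :: "real \<Rightarrow> real"
  assumes d: "\<And>t. t \<in> {-T..T} \<Longrightarrow> (f has_real_derivative f' t) (at t within {-T..T})"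
    and b: "\<And>t. t \<in> {-T..T} \<Longrightarrow> \<bar>f' t\<bar> \<le> A * f t + B"
    and A: "A > 0" and B: "B \<ge> 0" and t: "t \<in> {-T..T}"
  shows "f t \<le> (f 0 + B / A) * exp (A * \<bar>t\<bar>)"
proof -
  have BA: "B / A \<ge> 0" using A B by simp
  have cf: "continuous_on {-T..T} f" using d by (rule DERIV_continuous_on)
  have di: "(f has_real_derivative f' x) (at x)" if "-T < x" "x < T" for x
    using d[of x] that by (simp add: at_within_Icc_at)
  show ?thesis
  proof (cases "0 \<le> t")
    case True
    have "(f t + B / A) * exp (- A * t) \<le> (f 0 + B / A) * exp (- A * 0)"
    proof (rule DERIV_nonpos_imp_decreasing_open[OF True])
      show "continuous_on {0..t} (\<lambda>t. (f t + B / A) * exp (- A * t))"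
        by (intro continuous_intros continuous_on_subset[OF cf]) (use t True in auto)
      fix x assume x: "0 < x" "x < t"
      have "((\<lambda>t. (f t + B / A) * exp (- A * t)) has_real_derivative
          (f' x - A * (f x + B / A)) * exp (- A * x)) (at x)"
        by (rule derivative_eq_intros di refl | use x t in \<open>simp add: algebra_simps\<close>)+
      moreover have "(f' x - A * (f x + B / A)) * exp (- A * x) \<le> 0"
        using b[of x] x t A by (intro mult_nonpos_nonneg) (auto simp: distrib_left)
      ultimately show "\<exists>y. ((\<lambda>t. (f t + B / A) * exp (- A * t)) has_real_derivative y) (at x) \<and> y \<le> 0"
        by blast
    qed
    then have "(f t + B / A) * exp (- A * t) * exp (A * t) \<le> (f 0 + B / A) * exp (A * t)"
      by (intro mult_right_mono) auto
    also have "(f t + B / A) * exp (- A * t) * exp (A * t) = f t + B / A"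
      by (simp add: mult.assoc flip: exp_add)
    finally show ?thesis using True BA by simp
  next
    case False
    have "(f t + B / A) * exp (A * t) \<le> (f 0 + B / A) * exp (A * 0)"
    proof (rule DERIV_nonneg_imp_increasing_open[of t 0 "\<lambda>t. (f t + B / A) * exp (A * t)"])
      show "t \<le> 0" using False by simp
      show "continuous_on {t..0} (\<lambda>t. (f t + B / A) * exp (A * t))"
        by (intro continuous_intros continuous_on_subset[OF cf]) (use t False in auto)
      fix x assume x: "t < x" "x < 0"
      have "((\<lambda>t. (f t + B / A) * exp (A * t)) has_real_derivative
          (f' x + A * (f x + B / A)) * exp (A * x)) (at x)"
        by (rule derivative_eq_intros di refl | use x t in \<open>simp add: algebra_simps\<close>)+
      moreover have "(f' x + A * (f x + B / A)) * exp (A * x) \<ge> 0"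
        using b[of x] x t A by (intro mult_nonneg_nonneg) (auto simp: distrib_left)
      ultimately show "\<exists>y. ((\<lambda>t. (f t + B / A) * exp (A * t)) has_real_derivative y) (at x) \<and> y \<ge> 0"
        by blast
    qed
    then have "(f t + B / A) * exp (A * t) * exp (- A * t) \<le> (f 0 + B / A) * exp (- A * t)"
      by (intro mult_right_mono) auto
    also have "(f t + B / A) * exp (A * t) * exp (- A * t) = f t + B / A"
      by (simp add: mult.assoc flip: exp_add)
    finally show ?thesis using False BA by simp
  qed
qed

text \<open>The squared norm is used because it is differentiable also where \<open>z\<close>
  vanishes. The cross term \<open>2 * norm (z t) * e\<close> is split into two squares, whence the
  extra 1 in the rate.\<close>

lemma gronwall_norm:
  fixes z :: "real \<Rightarrow> 'a::real_inner"
  assumes d: "\<And>t. t \<in> {-T..T} \<Longrightarrow> (z has_vector_derivative z' t) (at t within {-T..T})"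
    and b: "\<And>t. t \<in> {-T..T} \<Longrightarrow> norm (z' t) \<le> K * norm (z t) + e"
    and K: "K \<ge> 0" "e \<ge> 0" and t: "t \<in> {-T..T}"
  shows "(norm (z t))\<^sup>2 \<le> ((norm (z 0))\<^sup>2 + e\<^sup>2) * exp ((2 * K + 1) * \<bar>t\<bar>)"
proof -
  have "(norm (z t))\<^sup>2 \<le> ((norm (z 0))\<^sup>2 + e\<^sup>2 / (2 * K + 1)) * exp ((2 * K + 1) * \<bar>t\<bar>)"
  proof (rule gronwall[OF _ _ _ _ t])
    fix t assume t: "t \<in> {-T..T}"
    have "((\<lambda>t. inner (z t) (z t)) has_vector_derivative (inner (z t) (z' t) + inner (z' t) (z t))) (at t within {-T..T})"
      by (rule bounded_bilinear.has_vector_derivative[OF bounded_bilinear_inner d[OF t] d[OF t]])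
    then show "((\<lambda>t. (norm (z t))\<^sup>2) has_real_derivative 2 * inner (z t) (z' t)) (at t within {-T..T})"
      by (simp add: has_real_derivative_iff_has_vector_derivative power2_norm_eq_inner inner_commute)
    have "\<bar>inner (z t) (z' t)\<bar> \<le> norm (z t) * (K * norm (z t) + e)"
      using Cauchy_Schwarz_ineq2[of "z t" "z' t"] mult_left_mono[OF b[OF t] norm_ge_zero[of "z t"]]
      by linarith
    moreover have "2 * (norm (z t) * e) \<le> (norm (z t))\<^sup>2 + e\<^sup>2"
      using sum_squares_bound[of "norm (z t)" e] by simp
    ultimately show "\<bar>2 * inner (z t) (z' t)\<bar> \<le> (2 * K + 1) * (norm (z t))\<^sup>2 + e\<^sup>2"
      by (simp add: abs_mult power2_eq_square algebra_simps)
  qed (use K in auto)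
  also have "\<dots> \<le> ((norm (z 0))\<^sup>2 + e\<^sup>2) * exp ((2 * K + 1) * \<bar>t\<bar>)"
  proof (intro mult_right_mono add_left_mono)
    show "e\<^sup>2 / (2 * K + 1) \<le> e\<^sup>2"
      using K by (simp add: divide_le_eq mult_left_le algebra_simps)
  qed simp
  finally show ?thesis .
qed

subsection \<open>Radial truncation\<close>

definition radial_trunc :: "real \<Rightarrow> 'a::real_normed_vector \<Rightarrow> 'a" where
  "radial_trunc R x = (R / max R (norm x)) *\<^sub>R x"

lemma radial_trunc_0 [simp]: "radial_trunc R 0 = 0" by (simp add: radial_trunc_def)

lemma radial_trunc_ident: "R > 0 \<Longrightarrow> norm x \<le> R \<Longrightarrow> radial_trunc R x = x"
  by (simp add: radial_trunc_def max_def)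

lemma norm_radial_trunc_le: "R > 0 \<Longrightarrow> norm (radial_trunc R x) \<le> R"
  by (auto simp: radial_trunc_def max_def field_simps)

text \<open>Two changes contribute, that of the vector and that of the scalar factor, and each costs
  at most \<open>norm (x - y)\<close>.\<close>

lemma radial_trunc_lipschitz:
  assumes R: "R > 0"
  shows "norm (radial_trunc R x - radial_trunc R y) \<le> 2 * norm (x - y)"
proof -
  define a b where "a = max R (norm x)" and "b = max R (norm y)"
  have ab: "a \<ge> R" "b \<ge> R" "norm y \<le> b" "a > 0" "b > 0" using R by (auto simp: a_def b_def)
  have "radial_trunc R x - radial_trunc R y = (R / a) *\<^sub>R (x - y) + (R / a - R / b) *\<^sub>R y"
    by (simp add: radial_trunc_def a_def b_def algebra_simps)
  then have "norm (radial_trunc R x - radial_trunc R y) \<le> R / a * norm (x - y) + \<bar>R / a - R / b\<bar> * norm y"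
    using norm_triangle_ineq[of "(R / a) *\<^sub>R (x - y)" "(R / a - R / b) *\<^sub>R y"] R ab by simp
  also have "R / a * norm (x - y) \<le> 1 * norm (x - y)"
    using ab by (intro mult_right_mono) auto
  also have "\<bar>R / a - R / b\<bar> * norm y \<le> norm (x - y)"
  proof -
    have "R / a - R / b = R / a * ((b - a) / b)" using ab by (simp add: field_simps)
    then have "\<bar>R / a - R / b\<bar> * norm y = R / a * (\<bar>b - a\<bar> * (norm y / b))"
      using ab R by (simp add: abs_mult)
    also have "\<dots> \<le> 1 * (\<bar>b - a\<bar> * 1)"
      using ab R by (intro mult_mono) auto
    also have "\<bar>b - a\<bar> \<le> \<bar>norm x - norm y\<bar>" by (auto simp: a_def b_def max_def abs_real_def)
    also have "\<dots> \<le> norm (x - y)" by (rule norm_triangle_ineq3)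
    finally show ?thesis by simp
  qed
  finally show ?thesis by simp
qed

section \<open>The BBM vector field\<close>

lemma summable_bracket_bound:
  assumes "\<And>k. cmod (c k) \<le> B / bracket k"
  shows "(\<lambda>k. (cmod (c k))\<^sup>2) summable_on UNIV"
proof (rule summable_on_comparison_test)
  show "(\<lambda>k. B\<^sup>2 * (1 / (bracket k)\<^sup>2)) summable_on UNIV"
    by (intro summable_on_cmult_right) (use bracket_sum_has_sum in \<open>auto simp: summable_on_def\<close>)
  show "(cmod (c k))\<^sup>2 \<le> B\<^sup>2 * (1 / (bracket k)\<^sup>2)" for k
    using power_mono[OF assms[of k], of 2] by (simp add: power_divide)
qed simp

lemma exists_L2_coeff:
  assumes "\<And>k. cmod (c k) \<le> B / bracket k"
  shows "\<exists>u. \<forall>k. L2_coeff u k = c k"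
  by (rule riesz_fischer[OF summable_bracket_bound[OF assms]])

text \<open>Covers \<open>phi\<close> and its frequency cutoffs together. Domination by
  \<open>phi\<close> makes all Lipschitz constants independent of the cutoff; oddness makes the
  field commute with complex conjugation.\<close>

definition BBM_symbol :: "(int \<Rightarrow> real) \<Rightarrow> bool" where
  "BBM_symbol m \<longleftrightarrow> (\<forall>k. \<bar>m k\<bar> \<le> \<bar>phi k\<bar> \<and> m (- k) = - m k)"

definition bbm_field :: "(int \<Rightarrow> real) \<Rightarrow> L2_torus \<Rightarrow> L2_torus" where
  "bbm_field m u = (THE g. \<forall>k. L2_coeff g k = - \<i> * m k * (L2_coeff u k + prod_coeff u u k / 2))"

lemma abs_symbol_le: "BBM_symbol m \<Longrightarrow> \<bar>m k\<bar> \<le> 1 / bracket k"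
  unfolding BBM_symbol_def using abs_phi_le order_trans by blast

lemma cmod_symbol_mult_le:
  assumes "BBM_symbol m" "cmod z \<le> B"
  shows "cmod (- \<i> * m k * z) \<le> B / bracket k"
  using mult_mono[OF abs_symbol_le[OF assms(1), of k] assms(2)] by (simp add: norm_mult less_imp_le)

lemma bbm_field_arg_bound: "cmod (L2_coeff u k + prod_coeff u u k / 2) \<le> norm u + (norm u)\<^sup>2 / 2"
  using norm_triangle_ineq[of "L2_coeff u k" "prod_coeff u u k / 2"] L2_coeff_bound[of u k] prod_coeff_bound[of u u k]
  by (simp add: power2_eq_square norm_divide)

lemma bbm_field_coeff:
  assumes "BBM_symbol m"
  shows "L2_coeff (bbm_field m u) k = - \<i> * m k * (L2_coeff u k + prod_coeff u u k / 2)"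
proof -
  obtain g where g: "\<And>k. L2_coeff g k = - \<i> * m k * (L2_coeff u k + prod_coeff u u k / 2)"
    using exists_L2_coeff[of "\<lambda>k. - \<i> * m k * (L2_coeff u k + prod_coeff u u k / 2)",
        OF cmod_symbol_mult_le[OF assms bbm_field_arg_bound]] by blast
  have "\<forall>k. L2_coeff (bbm_field m u) k = - \<i> * m k * (L2_coeff u k + prod_coeff u u k / 2)"
    unfolding bbm_field_def by (rule theI[where a = g]) (auto simp: g intro: L2_coeff_eqI)
  then show ?thesis by blast
qed

lemma prod_coeff_diff_square: "prod_coeff u u k - prod_coeff v v k = prod_coeff (u - v) (u + v) k"
proof -
  interpret bounded_bilinear "\<lambda>u v. prod_coeff u v k" by (rule bounded_bilinear_prod_coeff)
  show ?thesis by (simp add: diff_left add_right prod_coeff_commute[of v u])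
qed

text \<open>Since \<open>u^2 - v^2 = (u - v) (u + v)\<close>, every coefficient of the bracketed
  difference is at most \<open>(1 + R) * norm (u - v)\<close>, and the symbol supplies the square
  summable factor \<open>1 / bracket k\<close>.\<close>

lemma bbm_field_lipschitz:
  assumes m: "BBM_symbol m" and R: "norm u \<le> R" "norm v \<le> R"
  shows "norm (bbm_field m u - bbm_field m v) \<le> sqrt bracket_sum * (1 + R) * norm (u - v)"
proof -
  have "norm (bbm_field m u - bbm_field m v) \<le> sqrt bracket_sum * ((1 + R) * norm (u - v))"
  proof (rule norm_le_bracket)
    fix k
    have eq: "L2_coeff (bbm_field m u - bbm_field m v) k = - \<i> * m k * (L2_coeff (u - v) k + prod_coeff (u - v) (u + v) k / 2)"
      by (simp add: bbm_field_coeff m L2_coeff_diff algebra_simps diff_divide_distrib flip: prod_coeff_diff_square)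
    have "cmod (L2_coeff (u - v) k + prod_coeff (u - v) (u + v) k / 2) \<le> norm (u - v) + norm (u - v) * norm (u + v) / 2"
      using norm_triangle_ineq[of "L2_coeff (u - v) k" "prod_coeff (u - v) (u + v) k / 2"]
        L2_coeff_bound[of "u - v" k] prod_coeff_bound[of "u - v" "u + v" k]
      by (simp add: norm_divide)
    also have "\<dots> \<le> norm (u - v) + norm (u - v) * (2 * R) / 2"
      using norm_triangle_ineq[of u v] R
      by (intro add_left_mono divide_right_mono mult_left_mono) auto
    finally have "cmod (L2_coeff (u - v) k + prod_coeff (u - v) (u + v) k / 2) \<le> (1 + R) * norm (u - v)"
      by (simp add: algebra_simps)
    then show "cmod (L2_coeff (bbm_field m u - bbm_field m v) k) \<le> (1 + R) * norm (u - v) / bracket k"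
      unfolding eq by (rule cmod_symbol_mult_le[OF m])
  next
    show "0 \<le> (1 + R) * norm (u - v)"
      using R order_trans[OF norm_ge_zero R(1)] by simp
  qed
  then show ?thesis by (simp add: mult.assoc)
qed

lemma bbm_field_0: "BBM_symbol m \<Longrightarrow> bbm_field m 0 = 0"
proof (rule L2_coeff_eqI)
  interpret bounded_bilinear "\<lambda>u v. prod_coeff u v k" for k by (rule bounded_bilinear_prod_coeff)
  show "BBM_symbol m \<Longrightarrow> L2_coeff (bbm_field m 0) k = L2_coeff 0 k" for k
    by (simp add: bbm_field_coeff L2_coeff_zero zero_left)
qed

text \<open>The factor 2 is the Lipschitz constant of \<open>radial_trunc\<close>; the added 1
  secures the positivity that \<open>picard\<close> requires.\<close>

definition lip_const :: "real \<Rightarrow> real" where "lip_const R = 2 * sqrt bracket_sum * (1 + R) + 1"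

lemma lip_const_pos: "R > 0 \<Longrightarrow> lip_const R > 0"
  by (simp add: lip_const_def bracket_sum_nonneg add_nonneg_pos)

lemma bbm_field_radial_trunc_lipschitz:
  assumes m: "BBM_symbol m" and R: "R > 0"
  shows "norm (bbm_field m (radial_trunc R u) - bbm_field m (radial_trunc R v)) \<le> lip_const R * norm (u - v)"
proof -
  have "norm (bbm_field m (radial_trunc R u) - bbm_field m (radial_trunc R v)) \<le> sqrt bracket_sum * (1 + R) * norm (radial_trunc R u - radial_trunc R v)"
    by (rule bbm_field_lipschitz[OF m]) (simp_all add: norm_radial_trunc_le R)
  also have "\<dots> \<le> sqrt bracket_sum * (1 + R) * (2 * norm (u - v))"
    using R by (intro mult_left_mono radial_trunc_lipschitz) (simp_all add: bracket_sum_nonneg)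
  also have "\<dots> \<le> lip_const R * norm (u - v)" by (simp add: lip_const_def algebra_simps)
  finally show ?thesis .
qed

section \<open>The truncated flow and its invariants\<close>

lemma flow_exists:
  assumes m: "BBM_symbol m" and R: "R > 0"
  shows "\<exists>u. u 0 = x \<and> (\<forall>t. (u has_vector_derivative bbm_field m (radial_trunc R (u t))) (at t))"
  by (rule picard[where K = "lip_const R"]) (use assms in \<open>auto simp: bbm_field_0 lip_const_pos bbm_field_radial_trunc_lipschitz\<close>)

lemma has_vector_derivative_within_UNIV:
  "(\<And>t. (u has_vector_derivative u' t) (at t)) \<Longrightarrow> (u has_vector_derivative u' t) (at t within S)"
  using has_vector_derivative_at_within by blast

text \<open>The bound is proportional to the size of the data because the field vanishes at 0.
  Sufficiently small data therefore stay inside the truncation radius during a given time.\<close>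

lemma flow_growth:
  assumes m: "BBM_symbol m" and R: "R > 0"
    and u: "\<And>t. (u has_vector_derivative bbm_field m (radial_trunc R (u t))) (at t)"
    and t: "\<bar>t\<bar> \<le> T"
  shows "(norm (u t))\<^sup>2 \<le> (norm (u 0))\<^sup>2 * exp ((2 * lip_const R + 1) * T)"
proof -
  have "(norm (u t))\<^sup>2 \<le> ((norm (u 0))\<^sup>2 + 0\<^sup>2) * exp ((2 * lip_const R + 1) * \<bar>t\<bar>)"
  proof (rule gronwall_norm[where T = T])
    show "(u has_vector_derivative bbm_field m (radial_trunc R (u t))) (at t within {-T..T})" for t
      by (rule has_vector_derivative_within_UNIV[OF u])
    show "norm (bbm_field m (radial_trunc R (u t))) \<le> lip_const R * norm (u t) + 0" for t
      using bbm_field_radial_trunc_lipschitz[OF m R, of "u t" 0] by (simp add: bbm_field_0 m)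
  qed (use t lip_const_pos[OF R] in auto)
  also have "\<dots> \<le> ((norm (u 0))\<^sup>2 + 0\<^sup>2) * exp ((2 * lip_const R + 1) * T)"
    using t lip_const_pos[OF R] by (intro mult_left_mono) (auto intro!: mult_left_mono)
  finally show ?thesis by simp
qed

lemma radial_trunc_L2_cnj: "radial_trunc R (L2_cnj u) = L2_cnj (radial_trunc R u)"
  by (simp add: radial_trunc_def norm_L2_cnj linear_scale[OF bounded_linear.linear[OF bounded_linear_L2_cnj]])

lemma bbm_field_L2_cnj: "BBM_symbol m \<Longrightarrow> bbm_field m (L2_cnj u) = L2_cnj (bbm_field m u)"
  by (rule L2_coeff_eqI) (simp add: bbm_field_coeff L2_coeff_L2_cnj prod_coeff_L2_cnj BBM_symbol_def)

text \<open>The conjugate solves the same truncated equation, as the symbol is odd and the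
  truncation sees only the norm; Gronwall is applied to the difference of the two.\<close>

lemma flow_real_valued:
  assumes m: "BBM_symbol m" and R: "R > 0"
    and u: "\<And>t. (u has_vector_derivative bbm_field m (radial_trunc R (u t))) (at t)"
    and u0: "real_valued (u 0)"
  shows "real_valued (u t)"
proof -
  have "(norm (u t - L2_cnj (u t)))\<^sup>2 \<le> ((norm (u 0 - L2_cnj (u 0)))\<^sup>2 + 0\<^sup>2) * exp ((2 * lip_const R + 1) * \<bar>t\<bar>)"
  proof (rule gronwall_norm[where T = "\<bar>t\<bar>" and z = "\<lambda>t. u t - L2_cnj (u t)"])
    show "((\<lambda>t. u t - L2_cnj (u t)) has_vector_derivative bbm_field m (radial_trunc R (u t)) - L2_cnj (bbm_field m (radial_trunc R (u t)))) (at t within {-\<bar>s\<bar>..\<bar>s\<bar>})" for t s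
      by (intro has_vector_derivative_diff bounded_linear.has_vector_derivative[OF bounded_linear_L2_cnj]
          has_vector_derivative_within_UNIV[OF u])
    show "norm (bbm_field m (radial_trunc R (u t)) - L2_cnj (bbm_field m (radial_trunc R (u t)))) \<le> lip_const R * norm (u t - L2_cnj (u t)) + 0" for t
      using bbm_field_radial_trunc_lipschitz[OF m R, of "u t" "L2_cnj (u t)"] by (simp add: bbm_field_L2_cnj m radial_trunc_L2_cnj)
  qed (use lip_const_pos[OF R] in auto)
  then show ?thesis using u0 by (simp add: real_valued_iff_L2_cnj)
qed

lemma has_vector_derivative_L2_coeff:
  "(u has_vector_derivative u') (at t within S) \<Longrightarrow>
    ((\<lambda>t. L2_coeff (u t) k) has_vector_derivative L2_coeff u' k) (at t within S)"
  by (rule bounded_linear.has_vector_derivative[OF bounded_linear_L2_coeff])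

lemma flow_coeff_const:
  assumes m: "BBM_symbol m" and u: "\<And>t. (u has_vector_derivative bbm_field m (radial_trunc R (u t))) (at t)"
    and "m k = 0"
  shows "L2_coeff (u t) k = L2_coeff (u 0) k"
proof -
  have "\<exists>c. \<forall>t\<in>UNIV. L2_coeff (u t) k = c"
  proof (rule has_vector_derivative_zero_constant[OF convex_UNIV])
    show "((\<lambda>t. L2_coeff (u t) k) has_vector_derivative 0) (at t within UNIV)" for t
      using has_vector_derivative_L2_coeff[OF u[of t], of k] assms(3) by (simp add: bbm_field_coeff m)
  qed auto
  then obtain c where "\<And>t. L2_coeff (u t) k = c" by auto
  then show ?thesis by simp
qed

section \<open>Energy estimate for trigonometric polynomials\<close>

text \<open>The full squared H^1 norm when \<open>w\<close> is band-limited by \<open>N\<close>,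
  written as a finite sum.\<close>

definition energy :: "nat \<Rightarrow> L2_torus \<Rightarrow> real" where
  "energy N w = (\<Sum>k\<in>{-int N..int N}. (bracket k)\<^sup>2 * (cmod (L2_coeff w k))\<^sup>2)"

definition bandlimited :: "nat \<Rightarrow> L2_torus \<Rightarrow> bool" where
  "bandlimited N w \<longleftrightarrow> (\<forall>k. \<bar>k\<bar> > int N \<longrightarrow> L2_coeff w k = 0)"

lemma bandlimitedD:
  assumes "bandlimited N w" "k \<notin> {-int N..int N}"
  shows "L2_coeff w k = 0"
proof -
  have "\<bar>k\<bar> > int N" using assms(2) by auto
  then show ?thesis using assms(1) by (simp add: bandlimited_def)
qed

lemma energy_nonneg: "0 \<le> energy N w"
  unfolding energy_def by (intro sum_nonneg) simp

text \<open>The Fourier form of the embedding of H^1 into bounded functions, by Cauchy-Schwarz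
  against \<open>1 / bracket\<close>.\<close>

lemma sum_cmod_coeff_le: "(\<Sum>k\<in>{-int N..int N}. cmod (L2_coeff w k)) \<le> sqrt bracket_sum * sqrt (energy N w)"
proof -
  have "(\<Sum>k\<in>{-int N..int N}. (1 / bracket k) * (bracket k * cmod (L2_coeff w k))) \<le> sqrt bracket_sum * sqrt (energy N w)"
  proof (rule sum_mult_le_sqrt)
    show "(\<Sum>k\<in>{-int N..int N}. (1 / bracket k)\<^sup>2) \<le> (sqrt bracket_sum)\<^sup>2"
      using finite_sum_le_has_sum[OF bracket_sum_has_sum, of "{-int N..int N}"] by (simp add: power_divide bracket_sum_nonneg)
    show "(\<Sum>k\<in>{-int N..int N}. (bracket k * cmod (L2_coeff w k))\<^sup>2) \<le> (sqrt (energy N w))\<^sup>2"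
      by (simp add: energy_nonneg) (simp add: energy_def power_mult_distrib)
  qed (simp_all add: bracket_sum_nonneg energy_nonneg)
  then show ?thesis by simp
qed

lemma prod_coeff_bandlimited:
  assumes "bandlimited N w"
  shows "prod_coeff v w k = (\<Sum>j\<in>{-int N..int N}. L2_coeff w j * L2_coeff v (k - j))"
proof -
  have "((\<lambda>j. L2_coeff w j * L2_coeff v (k - j)) has_sum
      (\<Sum>j\<in>{-int N..int N}. L2_coeff w j * L2_coeff v (k - j))) UNIV"
    by (rule has_sum_finite_neutralI[where B = "{-int N..int N}"])
      (use bandlimitedD[OF assms] in auto)
  with prod_coeff_has_sum show ?thesis unfolding prod_coeff_commute[of v w] by (rule has_sum_unique)
qed

lemma norm_le_energy:
  assumes "bandlimited N w"
  shows "(norm w)\<^sup>2 \<le> energy N w"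
proof (rule has_sum_le_finite_sums[OF parseval])
  fix F :: "int set" assume F: "finite F"
  have "(\<Sum>k\<in>F. (cmod (L2_coeff w k))\<^sup>2) = (\<Sum>k\<in>F \<inter> {-int N..int N}. (cmod (L2_coeff w k))\<^sup>2)"
    by (rule sum.mono_neutral_right) (use F bandlimitedD[OF assms] in auto)
  also have "\<dots> \<le> (\<Sum>k\<in>{-int N..int N}. (cmod (L2_coeff w k))\<^sup>2)"
    by (rule sum_mono2) auto
  also have "\<dots> \<le> energy N w"
    unfolding energy_def
  proof (rule sum_mono)
    fix k
    show "(cmod (L2_coeff w k))\<^sup>2 \<le> (bracket k)\<^sup>2 * (cmod (L2_coeff w k))\<^sup>2"
      using mult_right_mono[of 1 "(bracket k)\<^sup>2" "(cmod (L2_coeff w k))\<^sup>2"] by (simp add: bracket_power2)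
  qed
  finally show "(\<Sum>k\<in>F. (cmod (L2_coeff w k))\<^sup>2) \<le> energy N w" .
qed

text \<open>For real band-limited \<open>w\<close> and \<open>c\<close> the coefficients of f, this
  is \<i> / (2 pi) times the integral of w_x f.\<close>

definition pairing :: "nat \<Rightarrow> L2_torus \<Rightarrow> (int \<Rightarrow> complex) \<Rightarrow> complex" where
  "pairing N w c = (\<Sum>k\<in>{-int N..int N}. of_int k * cnj (L2_coeff w k) * c k)"

text \<open>The Fourier side of \<open>\<integral> w\<^sub>x w v\<close>: the derivative and one factor \<open>w\<close> are measured in \<open>H\<^sup>1\<close>.\<close>

lemma pairing_bound:
  assumes w: "bandlimited N w"
  shows "cmod (pairing N w (prod_coeff v w)) \<le> sqrt bracket_sum * norm v * energy N w"
proof -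
  let ?A = "{-int N..int N}"
  have "pairing N w (prod_coeff v w)
      = (\<Sum>k\<in>?A. \<Sum>j\<in>?A. L2_coeff w j * (of_int k * cnj (L2_coeff w k) * L2_coeff v (k - j)))"
    unfolding pairing_def by (simp add: prod_coeff_bandlimited[OF w] sum_distrib_left mult_ac)
  \<comment> \<open>With \<open>j\<close> outermost, the undifferentiated factor is summed in l^1
    and the inner sum over \<open>k\<close> is a Cauchy-Schwarz pairing in l^2, uniform in the shift
    \<open>j\<close>.\<close>
  also have "\<dots> = (\<Sum>j\<in>?A. L2_coeff w j * (\<Sum>k\<in>?A. of_int k * cnj (L2_coeff w k) * L2_coeff v (k - j)))"
    by (subst sum.swap) (simp add: sum_distrib_left)
  also have "cmod \<dots> \<le> (\<Sum>j\<in>?A. cmod (L2_coeff w j) * (sqrt (energy N w) * norm v))"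
  proof (intro order_trans[OF norm_sum] sum_mono)
    fix j
    have "cmod (\<Sum>k\<in>?A. of_int k * cnj (L2_coeff w k) * L2_coeff v (k - j))
        \<le> (\<Sum>k\<in>?A. (\<bar>of_int k\<bar> * cmod (L2_coeff w k)) * cmod (L2_coeff v (k - j)))"
      by (intro order_trans[OF norm_sum] sum_mono) (simp add: norm_mult)
    also have "\<dots> \<le> sqrt (energy N w) * norm v"
    proof (rule sum_mult_le_sqrt)
      have "(\<Sum>k\<in>?A. (\<bar>of_int k\<bar> * cmod (L2_coeff w k))\<^sup>2) \<le> energy N w"
        unfolding energy_def
        by (intro sum_mono) (auto simp: power_mult_distrib bracket_power2 intro!: mult_right_mono)
      then show "(\<Sum>k\<in>?A. (\<bar>of_int k\<bar> * cmod (L2_coeff w k))\<^sup>2) \<le> (sqrt (energy N w))\<^sup>2"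
        by (simp add: energy_nonneg)
      have "(\<Sum>k\<in>?A. (cmod (L2_coeff v (k - j)))\<^sup>2) = (\<Sum>k\<in>(\<lambda>k. k - j) ` ?A. (cmod (L2_coeff v k))\<^sup>2)"
        by (subst sum.reindex) (auto simp: inj_on_def)
      also have "\<dots> \<le> (norm v)\<^sup>2" by (rule bessel) simp
      finally show "(\<Sum>k\<in>?A. (cmod (L2_coeff v (k - j)))\<^sup>2) \<le> (norm v)\<^sup>2" .
    qed (simp_all add: energy_nonneg)
    finally show "cmod (L2_coeff w j * (\<Sum>k\<in>?A. of_int k * cnj (L2_coeff w k) * L2_coeff v (k - j)))
        \<le> cmod (L2_coeff w j) * (sqrt (energy N w) * norm v)"
      by (simp add: norm_mult mult_left_mono)
  qed
  also have "\<dots> = (\<Sum>j\<in>?A. cmod (L2_coeff w j)) * (sqrt (energy N w) * norm v)"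
    by (rule sum_distrib_right[symmetric])
  also have "\<dots> \<le> (sqrt bracket_sum * sqrt (energy N w)) * (sqrt (energy N w) * norm v)"
    by (intro mult_right_mono sum_cmod_coeff_le) (simp add: energy_nonneg)
  also have "\<dots> = sqrt bracket_sum * norm v * energy N w"
    using energy_nonneg[of N w] by (simp add: mult_ac)
  finally show ?thesis .
qed

text \<open>The Fourier side of \<open>\<integral> w\<^sub>x w\<^sup>2 = 0\<close>: symmetrise \<open>a + b + c = 0\<close>.\<close>

lemma pairing_square:
  assumes w: "bandlimited N w" and r: "real_valued w"
  shows "pairing N w (prod_coeff w w) = 0"
proof -
  let ?A = "{-int N..int N}"
  \<comment> \<open>The product over three frequencies with sum 0, symmetric in all three; reality
    has turned the conjugate into the coefficient at the opposite frequency.\<close>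
  define f where "f a b = L2_coeff w a * L2_coeff w b * L2_coeff w (- a - b)" for a b
  define Q where "Q = (\<Sum>a\<in>?A. \<Sum>b\<in>?A. of_int a * f a b)"
  have "pairing N w (prod_coeff w w) = (\<Sum>k\<in>?A. \<Sum>j\<in>?A. of_int k * f (- k) j)"
    unfolding pairing_def f_def
    by (simp add: prod_coeff_bandlimited[OF w] sum_distrib_left real_valued_coeff[OF r, symmetric] mult_ac)
  also have "\<dots> = (\<Sum>a\<in>?A. \<Sum>j\<in>?A. of_int (- a) * f a j)"
    by (rule sum.reindex_bij_witness[of _ uminus uminus]) auto
  also have "\<dots> = - Q" by (simp add: Q_def sum_negf)
  finally have pQ: "pairing N w (prod_coeff w w) = - Q" .
  have "Q = (\<Sum>b\<in>?A. \<Sum>a\<in>?A. of_int a * f a b)" unfolding Q_def by (rule sum.swap)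
  also have "\<dots> = (\<Sum>a\<in>?A. \<Sum>b\<in>?A. of_int b * f a b)"
  proof -
    have eq: "- b - a = - a - b" for a b :: int by simp
    have "f a b = f b a" for a b
      unfolding f_def eq[of b a] by (simp only: mult.commute[of "L2_coeff w a"])
    then show ?thesis by (intro sum.cong refl arg_cong2[where f = "(*)"])
  qed
  finally have Q1: "Q = (\<Sum>a\<in>?A. \<Sum>b\<in>?A. of_int b * f a b)" .
  \<comment> \<open>Exchanging \<open>b\<close> with \<open>- a - b\<close> does not preserve the
    range of summation; it does preserve \<open>?B\<close>, outside which \<open>f a b\<close>
    vanishes because \<open>w\<close> is band-limited.\<close>
  have inner: "(\<Sum>b\<in>?A. of_int b * f a b) = (\<Sum>b\<in>?A. of_int (- a - b) * f a b)" for a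
  proof -
    let ?B = "{b \<in> ?A. - a - b \<in> ?A}"
    have z: "f a b = 0" if "b \<in> ?A - ?B" for b
      using that bandlimitedD[OF w] by (auto simp: f_def)
    have "(\<Sum>b\<in>?A. of_int b * f a b) = (\<Sum>b\<in>?B. of_int b * f a b)"
      by (rule sum.mono_neutral_right) (use z in auto)
    also have "\<dots> = (\<Sum>b\<in>?B. of_int (- a - b) * f a (- a - b))"
      by (rule sum.reindex_bij_witness[of _ "\<lambda>b. - a - b" "\<lambda>b. - a - b"]) auto
    also have "\<dots> = (\<Sum>b\<in>?B. of_int (- a - b) * f a b)"
      by (simp add: f_def mult_ac)
    also have "\<dots> = (\<Sum>b\<in>?A. of_int (- a - b) * f a b)"
      by (rule sum.mono_neutral_left) (use z in auto)
    finally show ?thesis .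
  qed
  \<comment> \<open>The weights \<open>a\<close>, \<open>b\<close> and \<open>- a - b\<close> all
    give \<open>Q\<close> and add up to 0, so \<open>3 * Q = 0\<close>.\<close>
  have "Q = (\<Sum>a\<in>?A. \<Sum>b\<in>?A. of_int (- a - b) * f a b)"
    using Q1 inner by simp
  also have "\<dots> = - (\<Sum>a\<in>?A. \<Sum>b\<in>?A. of_int a * f a b) - (\<Sum>a\<in>?A. \<Sum>b\<in>?A. of_int b * f a b)"
    by (simp add: left_diff_distrib sum_subtractf sum_negf)
  also have "\<dots> = - 2 * Q" using Q1 by (simp add: Q_def[symmetric])
  finally have "Q = 0" by simp
  with pQ show ?thesis by simp
qed

text \<open>The H^1 weight is exactly the denominator of \<open>phi\<close>: multiplying by it
  leaves the frequency \<open>k\<close>, that is, a plain derivative in place of the smoothing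
  operator.\<close>

lemma energy_term_deriv:
  assumes "(z has_vector_derivative - \<i> * phi k * c) (at t within S)"
  shows "((\<lambda>t. (bracket k)\<^sup>2 * (cmod (z t))\<^sup>2) has_real_derivative
    2 * Re (- \<i> * (of_int k * cnj (z t) * c))) (at t within S)"
proof -
  let ?d = "- \<i> * phi k * c"
  have "((\<lambda>t. inner (z t) (z t)) has_vector_derivative (inner (z t) ?d + inner ?d (z t))) (at t within S)"
    by (intro bounded_bilinear.has_vector_derivative[OF bounded_bilinear_inner] assms)
  then have "((\<lambda>t. (bracket k)\<^sup>2 * (cmod (z t))\<^sup>2) has_real_derivative
      (bracket k)\<^sup>2 * (inner (z t) ?d + inner ?d (z t))) (at t within S)"
    unfolding has_real_derivative_iff_has_vector_derivative[symmetric] power2_norm_eq_inner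
    by (rule DERIV_cmult)
  moreover have k: "(bracket k)\<^sup>2 * phi k = of_int k"
    using bracket_neq_0[of k] unfolding phi_def bracket_power2[symmetric] by simp
  have "(bracket k)\<^sup>2 * (inner (z t) ?d + inner ?d (z t)) = 2 * ((bracket k)\<^sup>2 * phi k) * Im (cnj (z t) * c)"
    by (simp add: inner_complex_def algebra_simps)
  then have "(bracket k)\<^sup>2 * (inner (z t) ?d + inner ?d (z t)) = 2 * Re (- \<i> * (of_int k * cnj (z t) * c))"
    unfolding k by (simp add: algebra_simps)
  ultimately show ?thesis by (simp only:)
qed

text \<open>The linear term pairs to a real number and the self-interaction pairs to 0, whatever the
  real factors \<open>\<alpha>\<close> and \<open>\<beta>\<close> are; only the interaction with
  \<open>v\<close> remains. The free factors let one statement serve the truncated Galerkin flow and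
  the difference of two solutions. The 1 in the rate keeps it positive for
  \<open>gronwall\<close>.\<close>

lemma energy_growth:
  assumes d: "\<And>t k. t \<in> {-T..T} \<Longrightarrow> \<bar>k\<bar> \<le> int N \<Longrightarrow> ((\<lambda>t. L2_coeff (w t) k) has_vector_derivative
      - \<i> * phi k * (of_real (\<alpha> t) * L2_coeff (w t) k + of_real (\<beta> t) * prod_coeff (w t) (w t) k + prod_coeff (v t) (w t) k))
      (at t within {-T..T})"
    and w: "\<And>t. t \<in> {-T..T} \<Longrightarrow> bandlimited N (w t)" "\<And>t. t \<in> {-T..T} \<Longrightarrow> real_valued (w t)"
    and v: "\<And>t. t \<in> {-T..T} \<Longrightarrow> norm (v t) \<le> 1"
    and t: "t \<in> {-T..T}"
  shows "energy N (w t) \<le> energy N (w 0) * exp ((2 * sqrt bracket_sum + 1) * T)"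
proof -
  let ?A = "{-int N..int N}"
  let ?c = "\<lambda>t k. of_real (\<alpha> t) * L2_coeff (w t) k + of_real (\<beta> t) * prod_coeff (w t) (w t) k + prod_coeff (v t) (w t) k"
  have "energy N (w t) \<le> (energy N (w 0) + 0 / (2 * sqrt bracket_sum + 1)) * exp ((2 * sqrt bracket_sum + 1) * \<bar>t\<bar>)"
  proof (rule gronwall[OF _ _ _ _ t])
    fix t assume t: "t \<in> {-T..T}"
    have "((\<lambda>t. (bracket k)\<^sup>2 * (cmod (L2_coeff (w t) k))\<^sup>2) has_real_derivative
        2 * Re (- \<i> * (of_int k * cnj (L2_coeff (w t) k) * ?c t k))) (at t within {-T..T})"
      if k: "k \<in> ?A" for k
      by (rule energy_term_deriv, rule d) (use k t in auto)
    then have "((\<lambda>t. energy N (w t)) has_real_derivative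
        (\<Sum>k\<in>?A. 2 * Re (- \<i> * (of_int k * cnj (L2_coeff (w t) k) * ?c t k)))) (at t within {-T..T})"
      unfolding energy_def by (intro DERIV_sum) 
    moreover have "(\<Sum>k\<in>?A. 2 * Re (- \<i> * (of_int k * cnj (L2_coeff (w t) k) * ?c t k)))
        = 2 * Im (pairing N (w t) (?c t))"
      by (simp add: pairing_def sum_distrib_left)
    moreover have "Im (pairing N (w t) (?c t)) = Im (pairing N (w t) (prod_coeff (v t) (w t)))"
    proof -
      have "pairing N (w t) (?c t) = of_real (\<alpha> t) * pairing N (w t) (L2_coeff (w t))
          + of_real (\<beta> t) * pairing N (w t) (prod_coeff (w t) (w t)) + pairing N (w t) (prod_coeff (v t) (w t))"
        by (simp add: pairing_def sum.distrib[symmetric] sum_distrib_left algebra_simps)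
      moreover have "pairing N (w t) (L2_coeff (w t)) = of_real (\<Sum>k\<in>?A. of_int k * (cmod (L2_coeff (w t) k))\<^sup>2)"
        by (simp add: pairing_def mult.assoc complex_norm_square[symmetric] mult.commute[of "cnj _"])
      ultimately show ?thesis
        by (simp add: pairing_square[OF w(1)[OF t] w(2)[OF t]])
    qed
    ultimately show "((\<lambda>t. energy N (w t)) has_real_derivative
        2 * Im (pairing N (w t) (prod_coeff (v t) (w t)))) (at t within {-T..T})" by simp
    have "\<bar>Im (pairing N (w t) (prod_coeff (v t) (w t)))\<bar> \<le> sqrt bracket_sum * norm (v t) * energy N (w t)"
      using abs_Im_le_cmod pairing_bound[OF w(1)[OF t]] by (rule order_trans)
    also have "\<dots> \<le> sqrt bracket_sum * 1 * energy N (w t)"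
      using v[OF t] by (intro mult_right_mono mult_left_mono) (simp_all add: bracket_sum_nonneg energy_nonneg)
    finally show "\<bar>2 * Im (pairing N (w t) (prod_coeff (v t) (w t)))\<bar> \<le> (2 * sqrt bracket_sum + 1) * energy N (w t) + 0"
      using energy_nonneg[of N "w t"] by (simp add: algebra_simps)
  qed (simp_all add: bracket_sum_nonneg add_nonneg_pos)
  also have "\<dots> \<le> (energy N (w 0) + 0 / (2 * sqrt bracket_sum + 1)) * exp ((2 * sqrt bracket_sum + 1) * T)"
    using t by (intro mult_left_mono) (auto intro!: mult_left_mono simp: bracket_sum_nonneg energy_nonneg)
  finally show ?thesis by simp
qed

section \<open>Global solutions of the Galerkin systems\<close>

definition fourier_sum :: "nat \<Rightarrow> L2_torus \<Rightarrow> L2_torus" where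
  "fourier_sum N u = trig_sum {-int N..int N} (L2_coeff u)"

lemma L2_coeff_fourier_sum: "L2_coeff (fourier_sum N u) k = (if k \<in> {-int N..int N} then L2_coeff u k else 0)"
  by (simp add: fourier_sum_def L2_coeff_trig_sum)

lemma bandlimited_fourier_sum: "bandlimited N (fourier_sum N u)"
  by (auto simp: bandlimited_def L2_coeff_fourier_sum)

lemma fourier_sum_tendsto: "(\<lambda>N. fourier_sum N u) \<longlonglongrightarrow> u"
proof -
  have "filterlim (\<lambda>N. {-int N..int N}) (finite_subsets_at_top UNIV) sequentially"
    unfolding filterlim_finite_subsets_at_top
  proof (intro allI impI)
    fix X :: "int set" assume X: "finite X \<and> X \<subseteq> UNIV"
    define B where "B = Max (insert 0 (abs ` X))"
    have B: "\<bar>k\<bar> \<le> B" if "k \<in> X" for k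
      using X that by (auto simp: B_def)
    show "\<forall>\<^sub>F N in sequentially. finite {-int N..int N} \<and> X \<subseteq> {-int N..int N} \<and> {-int N..int N} \<subseteq> UNIV"
      using eventually_ge_at_top[of "nat B"]
    proof eventually_elim
      case (elim N)
      have "k \<in> {-int N..int N}" if "k \<in> X" for k using B[OF that] elim by auto
      then show ?case by auto
    qed
  qed
  then show ?thesis
    unfolding fourier_sum_def trig_sum_def
    by (rule filterlim_compose[OF fourier_series[of u, unfolded has_sum_def]])
qed

lemma real_valued_iff_coeff: "real_valued u \<longleftrightarrow> (\<forall>k. L2_coeff u (- k) = cnj (L2_coeff u k))"
proof
  assume "\<forall>k. L2_coeff u (- k) = cnj (L2_coeff u k)"
  then have "L2_cnj u = u" by (intro L2_coeff_eqI) (simp add: L2_coeff_L2_cnj)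
  then show "real_valued u" by (simp add: real_valued_iff_L2_cnj)
qed (simp add: real_valued_coeff)

lemma real_valued_fourier_sum: "real_valued u \<Longrightarrow> real_valued (fourier_sum N u)"
  by (auto simp: real_valued_iff_coeff L2_coeff_fourier_sum)

text \<open>Modes above \<open>N\<close> get velocity 0 and keep their initial value, so the field
  acts on all of L^2 and leaves the band-limited functions invariant.\<close>

definition cutoff :: "nat \<Rightarrow> int \<Rightarrow> real" where
  "cutoff N k = (if \<bar>k\<bar> \<le> int N then phi k else 0)"

lemma phi_odd: "phi (- k) = - phi k" by (simp add: phi_def)

lemma BBM_symbol_phi: "BBM_symbol phi" by (simp add: BBM_symbol_def phi_odd)

lemma BBM_symbol_cutoff: "BBM_symbol (cutoff N)" by (simp add: BBM_symbol_def cutoff_def phi_odd)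

lemma flow_bandlimited:
  assumes u: "\<And>t. (u has_vector_derivative bbm_field (cutoff N) (radial_trunc R (u t))) (at t)"
    and u0: "bandlimited N (u 0)"
  shows "bandlimited N (u t)"
  unfolding bandlimited_def
proof (intro allI impI)
  fix k assume "\<bar>k\<bar> > int N"
  then show "L2_coeff (u t) k = 0"
    using flow_coeff_const[OF BBM_symbol_cutoff u, where k = k and t = t] u0
    by (simp add: cutoff_def bandlimited_def)
qed

lemma radial_trunc_scaleC: "radial_trunc R x = scaleC (of_real (R / max R (norm x))) x"
  by (simp only: radial_trunc_def scaleR_scaleC)

text \<open>Truncation by the scalar \<open>l t\<close> only multiplies the linear part by
  \<open>l t\<close> and the quadratic part by its square, which \<open>energy_growth\<close> does
  not see. The radius can thus be fixed beforehand from the energy of the data, and the solution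
  never reaches it.\<close>

lemma galerkin_exists:
  assumes x: "bandlimited N x" "real_valued x" and T: "T > 0"
  shows "\<exists>u. u 0 = x \<and> (\<forall>t\<in>{-T..T}. (u has_vector_derivative bbm_field (cutoff N) (u t)) (at t within {-T..T})
    \<and> bandlimited N (u t) \<and> real_valued (u t))"
proof -
  define R where "R = sqrt (energy N x * exp ((2 * sqrt bracket_sum + 1) * T)) + 1"
  have R: "R > 0" unfolding R_def by (rule add_nonneg_pos) (simp_all add: energy_nonneg)
  obtain u where u0: "u 0 = x" and u: "\<And>t. (u has_vector_derivative bbm_field (cutoff N) (radial_trunc R (u t))) (at t)"
    using flow_exists[OF BBM_symbol_cutoff R] by blast
  have bl: "bandlimited N (u t)" for t by (rule flow_bandlimited[OF u]) (simp add: u0 x)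
  have rv: "real_valued (u t)" for t by (rule flow_real_valued[OF BBM_symbol_cutoff R u]) (simp add: u0 x)
  have nR: "norm (u t) \<le> R" if t: "t \<in> {-T..T}" for t
  proof -
    define l where "l t = R / max R (norm (u t))" for t
    have "energy N (u t) \<le> energy N (u 0) * exp ((2 * sqrt bracket_sum + 1) * T)"
    proof (rule energy_growth[OF _ bl rv _ t, where v = "\<lambda>_. 0" and \<alpha> = l and \<beta> = "\<lambda>t. (l t)\<^sup>2 / 2"])
      fix t k assume k: "\<bar>k\<bar> \<le> int N"
      have "prod_coeff 0 (u t) k = 0" by (rule bounded_bilinear.zero_left[OF bounded_bilinear_prod_coeff])
      moreover have "prod_coeff (radial_trunc R (u t)) (radial_trunc R (u t)) k = of_real ((l t)\<^sup>2) * prod_coeff (u t) (u t) k"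
        unfolding radial_trunc_scaleC l_def[symmetric]
        by (simp add: prod_coeff_scaleC_left prod_coeff_commute[of "u t" "scaleC _ _"] power2_eq_square)
      moreover have "L2_coeff (radial_trunc R (u t)) k = of_real (l t) * L2_coeff (u t) k"
        unfolding radial_trunc_scaleC l_def[symmetric] by (simp add: L2_coeff_scaleC)
      ultimately have "L2_coeff (bbm_field (cutoff N) (radial_trunc R (u t))) k = - \<i> * phi k * (of_real (l t) * L2_coeff (u t) k
          + of_real ((l t)\<^sup>2 / 2) * prod_coeff (u t) (u t) k + prod_coeff 0 (u t) k)"
        using k by (simp add: bbm_field_coeff BBM_symbol_cutoff cutoff_def)
      then show "((\<lambda>t. L2_coeff (u t) k) has_vector_derivative - \<i> * phi k * (of_real (l t) * L2_coeff (u t) k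
          + of_real ((l t)\<^sup>2 / 2) * prod_coeff (u t) (u t) k + prod_coeff 0 (u t) k)) (at t within {-T..T})"
        using has_vector_derivative_L2_coeff[OF has_vector_derivative_within_UNIV[OF u], of k] by metis
    qed simp
    then have "(norm (u t))\<^sup>2 \<le> energy N x * exp ((2 * sqrt bracket_sum + 1) * T)"
      using norm_le_energy[OF bl[of t]] by (simp add: u0)
    then have "norm (u t) \<le> sqrt (energy N x * exp ((2 * sqrt bracket_sum + 1) * T))" by (rule real_le_rsqrt)
    then show ?thesis by (simp add: R_def)
  qed
  have "(u has_vector_derivative bbm_field (cutoff N) (u t)) (at t within {-T..T})" if "t \<in> {-T..T}" for t
    using has_vector_derivative_within_UNIV[OF u, where S = "{-T..T}" and t = t] radial_trunc_ident[OF R nR[OF that]] by simp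
  with u0 bl rv show ?thesis by blast
qed

text \<open>The high frequencies of the data launch a small solution \<open>v\<close>; the difference \<open>w = u - v\<close> starts
  from finitely many frequencies, and its energy grows at a rate controlled by \<open>v\<close> in \<open>L\<^sup>2\<close> only.\<close>

lemma galerkin_bound:
  assumes x: "real_valued x" and T: "T > 0"
  shows "\<exists>M>0. \<exists>N0. \<forall>N\<ge>N0. \<exists>u. u 0 = fourier_sum N x \<and>
    (\<forall>t\<in>{-T..T}. (u has_vector_derivative bbm_field (cutoff N) (u t)) (at t within {-T..T}) \<and> norm (u t) \<le> M)"
proof -
  \<comment> \<open>The growth factor of the flow truncated at radius 1 over the time
    \<open>T\<close>. Data whose squared norm times \<open>E\<close> is at most 1 stay in the unit
    ball, where that truncation is the identity; \<open>N0\<close> is chosen to make the tail of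
    \<open>x\<close> so small.\<close>
  define E where "E = exp ((2 * lip_const 1 + 1) * T)"
  have E: "E > 0" by (simp add: E_def)
  have "(\<lambda>N. (norm (x - fourier_sum N x))\<^sup>2 * E) \<longlonglongrightarrow> (norm (x - x))\<^sup>2 * E"
    by (intro tendsto_intros fourier_sum_tendsto)
  then have "\<forall>\<^sub>F N in sequentially. (norm (x - fourier_sum N x))\<^sup>2 * E < 1"
    by (rule order_tendstoD) simp
  then obtain N0 where N0: "(norm (x - fourier_sum N0 x))\<^sup>2 * E < 1"
    by (auto simp: eventually_sequentially)
  \<comment> \<open>The 1 bounds \<open>v\<close>, the root bounds \<open>w\<close>. Only the
    partial sum of order \<open>N0\<close> occurs, so the bound is the same for all cutoffs
    \<open>N\<close>.\<close>
  define M where "M = 1 + sqrt (energy N0 (fourier_sum N0 x) * exp ((2 * sqrt bracket_sum + 1) * T))"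
  have M: "M > 0" unfolding M_def by (rule add_pos_nonneg) (simp_all add: energy_nonneg)
  have "\<exists>u. u 0 = fourier_sum N x \<and> (\<forall>t\<in>{-T..T}. (u has_vector_derivative bbm_field (cutoff N) (u t)) (at t within {-T..T}) \<and> norm (u t) \<le> M)"
    if N: "N \<ge> N0" for N
  proof -
    note m = BBM_symbol_cutoff[of N]
    obtain u where u0: "u 0 = fourier_sum N x"
      and u: "\<And>t. t \<in> {-T..T} \<Longrightarrow> (u has_vector_derivative bbm_field (cutoff N) (u t)) (at t within {-T..T})"
      and ub: "\<And>t. t \<in> {-T..T} \<Longrightarrow> bandlimited N (u t)"
      and ur: "\<And>t. t \<in> {-T..T} \<Longrightarrow> real_valued (u t)"
      using galerkin_exists[OF bandlimited_fourier_sum real_valued_fourier_sum[OF x] T] by metis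
    obtain v where v0: "v 0 = fourier_sum N x - fourier_sum N0 x"
      and v: "\<And>t. (v has_vector_derivative bbm_field (cutoff N) (radial_trunc 1 (v t))) (at t)"
      using flow_exists[OF m, of 1] by auto
    have vb0: "bandlimited N (v 0)"
      using N by (auto simp: v0 bandlimited_def L2_coeff_diff L2_coeff_fourier_sum)
    have vb: "bandlimited N (v t)" for t by (rule flow_bandlimited[OF v vb0])
    have vr: "real_valued (v t)" for t
      by (rule flow_real_valued[OF m _ v]) (simp_all add: v0 real_valued_diff real_valued_fourier_sum x)
    \<comment> \<open>The data of \<open>v\<close> are the frequencies above \<open>N0\<close> up to
      \<open>N\<close>, a part of the tail of \<open>x\<close>.\<close>
    have "norm (v 0) \<le> norm (x - fourier_sum N0 x)"
      by (rule norm_le_coeff) (use N in \<open>auto simp: v0 L2_coeff_diff L2_coeff_fourier_sum\<close>)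
    then have "(norm (v 0))\<^sup>2 * E \<le> (norm (x - fourier_sum N0 x))\<^sup>2 * E"
      using E by (intro mult_right_mono power_mono) auto
    then have "(norm (v 0))\<^sup>2 * E \<le> 1" using N0 by simp
    then have v1: "norm (v t) \<le> 1" if "t \<in> {-T..T}" for t
    proof -
      have "\<bar>t\<bar> \<le> T" using that by auto
      from flow_growth[OF m zero_less_one v this] have "(norm (v t))\<^sup>2 \<le> 1\<^sup>2"
        using \<open>(norm (v 0))\<^sup>2 * E \<le> 1\<close> by (simp add: E_def)
      then show ?thesis by (rule power2_le_imp_le) simp
    qed
    define w where "w t = u t - v t" for t
    have "norm (u t) \<le> M" if t: "t \<in> {-T..T}" for t
    proof -
      have wb: "bandlimited N (w t)" if "t \<in> {-T..T}" for t
        using ub[OF that] vb[of t] by (simp add: w_def bandlimited_def L2_coeff_diff)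
      have "energy N (w t) \<le> energy N (w 0) * exp ((2 * sqrt bracket_sum + 1) * T)"
      proof (rule energy_growth[OF _ wb _ v1 t, where \<alpha> = "\<lambda>_. 1" and \<beta> = "\<lambda>_. 1 / 2"])
        show "real_valued (w t)" if "t \<in> {-T..T}" for t
          unfolding w_def by (rule real_valued_diff[OF ur[OF that] vr])
        fix t k assume t: "t \<in> {-T..T}" and k: "\<bar>k\<bar> \<le> int N"
        have "(w has_vector_derivative bbm_field (cutoff N) (u t) - bbm_field (cutoff N) (v t)) (at t within {-T..T})"
          unfolding w_def
          using has_vector_derivative_diff[OF u[OF t] has_vector_derivative_within_UNIV[OF v, where S = "{-T..T}" and t = t]]
            radial_trunc_ident[OF zero_less_one v1[OF t]] by simp
        from has_vector_derivative_L2_coeff[OF this, of k]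
        have "((\<lambda>t. L2_coeff (w t) k) has_vector_derivative
            - \<i> * phi k * ((L2_coeff (u t) k - L2_coeff (v t) k) + (prod_coeff (u t) (u t) k - prod_coeff (v t) (v t) k) / 2))
            (at t within {-T..T})"
          using k by (simp add: L2_coeff_diff bbm_field_coeff m cutoff_def algebra_simps diff_divide_distrib)
        \<comment> \<open>Here \<open>u^2 - v^2 = w^2 + 2 v w\<close>; halved, it gives
          \<open>\<beta> = 1 / 2\<close> and the factor 1 in front of the interaction with
          \<open>v\<close>.\<close>
        moreover have "prod_coeff (u t) (u t) k - prod_coeff (v t) (v t) k = prod_coeff (w t) (w t) k + 2 * prod_coeff (v t) (w t) k"
        proof -
          have "u t + v t = w t + (v t + v t)" by (simp add: w_def)
          then show ?thesis
            unfolding prod_coeff_diff_square w_def[symmetric]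
            by (simp only: prod_coeff_commute[of "w t" "w t + _"] prod_coeff_add_left) simp
        qed
        ultimately show "((\<lambda>t. L2_coeff (w t) k) has_vector_derivative
            - \<i> * phi k * (of_real 1 * L2_coeff (w t) k + of_real (1 / 2) * prod_coeff (w t) (w t) k + prod_coeff (v t) (w t) k))
            (at t within {-T..T})"
          by (simp add: w_def L2_coeff_diff add_divide_distrib add.assoc)
      qed auto
      also have "w 0 = fourier_sum N0 x" by (simp add: w_def u0 v0)
      also have "energy N (fourier_sum N0 x) = energy N0 (fourier_sum N0 x)"
        unfolding energy_def
        by (rule sum.mono_neutral_right) (use N in \<open>auto simp: L2_coeff_fourier_sum\<close>)
      finally have "(norm (w t))\<^sup>2 \<le> energy N0 (fourier_sum N0 x) * exp ((2 * sqrt bracket_sum + 1) * T)"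
        using norm_le_energy[OF wb[OF t]] by linarith
      then have "norm (w t) \<le> sqrt (energy N0 (fourier_sum N0 x) * exp ((2 * sqrt bracket_sum + 1) * T))"
        by (rule real_le_rsqrt)
      moreover have "norm (u t) \<le> norm (v t) + norm (w t)"
        using norm_triangle_ineq[of "v t" "w t"] by (simp add: w_def)
      ultimately show ?thesis using v1[OF t] by (simp add: M_def)
    qed
    with u0 u show ?thesis by blast
  qed
  with M show ?thesis by blast
qed

section \<open>Global solutions in \<open>L\<^sup>2\<close>\<close>

text \<open>The two fields differ only above frequency \<open>N\<close>, where the coefficients have
  the majorant \<open>(R + R^2 / 2) / bracket k\<close>. This majorant is itself the coefficient
  sequence of some \<open>b\<close> in L^2, and the error is the tail of its Fourier series,
  uniformly on the ball.\<close>

lemma bbm_field_cutoff_tendsto: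
  "\<exists>\<epsilon>. \<epsilon> \<longlonglongrightarrow> 0 \<and> (\<forall>N x. norm x \<le> R \<longrightarrow> norm (bbm_field phi x - bbm_field (cutoff N) x) \<le> \<epsilon> N)"
proof -
  obtain b where b: "\<And>k. L2_coeff b k = of_real ((R + R\<^sup>2 / 2) / bracket k)"
    using exists_L2_coeff[of "\<lambda>k. of_real ((R + R\<^sup>2 / 2) / bracket k)" "\<bar>R + R\<^sup>2 / 2\<bar>"]
    by (auto simp: norm_divide abs_of_pos simp flip: of_real_divide of_real_add of_real_power)
  have "(\<lambda>N. norm (b - fourier_sum N b)) \<longlonglongrightarrow> norm (b - b)"
    by (intro tendsto_intros fourier_sum_tendsto)
  moreover have "norm (bbm_field phi x - bbm_field (cutoff N) x) \<le> norm (b - fourier_sum N b)" if x: "norm x \<le> R" for N x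
  proof (rule norm_le_coeff)
    fix k
    show "cmod (L2_coeff (bbm_field phi x - bbm_field (cutoff N) x) k) \<le> cmod (L2_coeff (b - fourier_sum N b) k)"
    proof (cases "\<bar>k\<bar> \<le> int N")
      case True
      then show ?thesis
        by (simp add: L2_coeff_diff bbm_field_coeff BBM_symbol_phi BBM_symbol_cutoff cutoff_def)
    next
      case False
      have "norm x + (norm x)\<^sup>2 / 2 \<le> R + R\<^sup>2 / 2"
        using x by (intro add_mono divide_right_mono power_mono) auto
      then have "cmod (- \<i> * phi k * (L2_coeff x k + prod_coeff x x k / 2)) \<le> (R + R\<^sup>2 / 2) / bracket k"
        by (intro cmod_symbol_mult_le[OF BBM_symbol_phi] order_trans[OF bbm_field_arg_bound])
      also have "\<dots> \<le> cmod (L2_coeff b k)"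
        unfolding b norm_of_real by (rule abs_ge_self)
      finally show ?thesis
        using False by (auto simp: L2_coeff_diff bbm_field_coeff BBM_symbol_phi BBM_symbol_cutoff cutoff_def L2_coeff_fourier_sum)
    qed
  qed
  ultimately show ?thesis by auto
qed

text \<open>The flow truncated at \<open>M\<close> is compared with the Galerkin solutions, on which
  that truncation is the identity. Gronwall, with the errors of the data and of the field, yields
  \<open>norm (U t) \<le> M\<close> in the limit, so the truncation is inactive on \<open>U\<close>
  as well.\<close>

lemma global_L2_solution:
  assumes x: "real_valued x" and T: "T > 0"
  shows "\<exists>u. u 0 = x \<and> (\<forall>t\<in>{-T..T}. real_valued (u t) \<and>
    (u has_vector_derivative bbm_field phi (u t)) (at t within {-T..T}))"
proof -
  obtain M N0 where M: "M > 0" and ga: "\<And>N. N \<ge> N0 \<Longrightarrow> \<exists>u. u 0 = fourier_sum N x \<and>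
    (\<forall>t\<in>{-T..T}. (u has_vector_derivative bbm_field (cutoff N) (u t)) (at t within {-T..T}) \<and> norm (u t) \<le> M)"
    using galerkin_bound[OF x T] by blast
  obtain U where U0: "U 0 = x" and U: "\<And>t. (U has_vector_derivative bbm_field phi (radial_trunc M (U t))) (at t)"
    using flow_exists[OF BBM_symbol_phi M] by blast
  obtain \<epsilon> where e0: "\<epsilon> \<longlonglongrightarrow> 0" and e: "\<And>N x. norm x \<le> M \<Longrightarrow> norm (bbm_field phi x - bbm_field (cutoff N) x) \<le> \<epsilon> N"
    using bbm_field_cutoff_tendsto[of M] by blast
  have UM: "norm (U t) \<le> M" if t: "t \<in> {-T..T}" for t
  proof -
    define C where "C = exp ((2 * lip_const M + 1) * \<bar>t\<bar>)"
    have "norm (U t) \<le> M + sqrt (((norm (x - fourier_sum N x))\<^sup>2 + (\<epsilon> N)\<^sup>2) * C)" if N: "N \<ge> N0" for N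
    proof -
      obtain u where u0: "u 0 = fourier_sum N x"
        and u: "\<And>t. t \<in> {-T..T} \<Longrightarrow> (u has_vector_derivative bbm_field (cutoff N) (u t)) (at t within {-T..T})"
        and uM: "\<And>t. t \<in> {-T..T} \<Longrightarrow> norm (u t) \<le> M"
        using ga[OF N] by blast
      have "(norm (U t - u t))\<^sup>2 \<le> ((norm (U 0 - u 0))\<^sup>2 + (\<epsilon> N)\<^sup>2) * exp ((2 * lip_const M + 1) * \<bar>t\<bar>)"
      proof (rule gronwall_norm[OF _ _ _ _ t, where z = "\<lambda>t. U t - u t"])
        fix t assume t: "t \<in> {-T..T}"
        show "((\<lambda>t. U t - u t) has_vector_derivative bbm_field phi (radial_trunc M (U t)) - bbm_field (cutoff N) (u t)) (at t within {-T..T})"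
          by (intro has_vector_derivative_diff has_vector_derivative_within_UNIV[OF U] u t)
        have "norm (bbm_field phi (radial_trunc M (U t)) - bbm_field (cutoff N) (u t))
            \<le> norm (bbm_field phi (radial_trunc M (U t)) - bbm_field (cutoff N) (radial_trunc M (U t)))
              + norm (bbm_field (cutoff N) (radial_trunc M (U t)) - bbm_field (cutoff N) (radial_trunc M (u t)))"
          using norm_triangle_ineq[of "bbm_field phi (radial_trunc M (U t)) - bbm_field (cutoff N) (radial_trunc M (U t))"
              "bbm_field (cutoff N) (radial_trunc M (U t)) - bbm_field (cutoff N) (radial_trunc M (u t))"] radial_trunc_ident[OF M uM[OF t]] by simp
        also have "\<dots> \<le> \<epsilon> N + lip_const M * norm (U t - u t)"
          by (intro add_mono e norm_radial_trunc_le M bbm_field_radial_trunc_lipschitz BBM_symbol_cutoff)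
        finally show "norm (bbm_field phi (radial_trunc M (U t)) - bbm_field (cutoff N) (u t)) \<le> lip_const M * norm (U t - u t) + \<epsilon> N"
          by simp
      next
        show "0 \<le> lip_const M" using lip_const_pos[OF M] by simp
        show "0 \<le> \<epsilon> N" using e[of 0 N] M by (auto intro: order_trans[OF norm_ge_zero])
      qed
      then have "norm (U t - u t) \<le> sqrt (((norm (x - fourier_sum N x))\<^sup>2 + (\<epsilon> N)\<^sup>2) * C)"
        by (intro real_le_rsqrt) (simp add: U0 u0 C_def)
      moreover have "norm (U t) \<le> norm (u t) + norm (U t - u t)"
        using norm_triangle_ineq[of "u t" "U t - u t"] by simp
      ultimately show ?thesis using uM[OF t] by linarith
    qed
    moreover have "(\<lambda>N. M + sqrt (((norm (x - fourier_sum N x))\<^sup>2 + (\<epsilon> N)\<^sup>2) * C)) \<longlonglongrightarrow> M + sqrt (((norm (x - x))\<^sup>2 + 0\<^sup>2) * C)"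
      by (intro tendsto_intros fourier_sum_tendsto e0)
    ultimately have "norm (U t) \<le> M + sqrt (((norm (x - x))\<^sup>2 + 0\<^sup>2) * C)"
      by (intro LIMSEQ_le_const) auto
    then show ?thesis by simp
  qed
  have "(U has_vector_derivative bbm_field phi (U t)) (at t within {-T..T})" if "t \<in> {-T..T}" for t
    using has_vector_derivative_within_UNIV[OF U, where S = "{-T..T}" and t = t] radial_trunc_ident[OF M UM[OF that]] by simp
  moreover have "real_valued (U t)" for t
    by (rule flow_real_valued[OF BBM_symbol_phi M U]) (simp add: U0 x)
  ultimately show ?thesis using U0 by blast
qed

section \<open>Propagation of Sobolev regularity\<close>

lemma continuous_on_vector_derivative:
  "(\<And>t. t \<in> S \<Longrightarrow> (u has_vector_derivative u' t) (at t within S)) \<Longrightarrow> continuous_on S u"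
  unfolding continuous_on_eq_continuous_within by (blast intro: has_vector_derivative_continuous)

section \<open>Sobolev norms on the Fourier side\<close>

lemma Hs_iff: "u \<in> Hs s \<longleftrightarrow> real_valued u \<and> Hsum s u"
  by (simp add: Hs_def Hsum_def)

lemma Hs_norm_has_sum:
  "Hsum s u \<Longrightarrow> ((\<lambda>k. (bracket k powr s * cmod (L2_coeff u k))\<^sup>2) has_sum (Hs_norm s u)\<^sup>2) UNIV"
  using has_sum_infsum[of "\<lambda>k. (bracket k powr s * cmod (L2_coeff u k))\<^sup>2" UNIV]
  by (simp add: Hsum_def Hs_norm_def infsum_nonneg)

lemma Hsum_le:
  assumes "\<And>k. (bracket k powr s * cmod (L2_coeff u k))\<^sup>2 \<le> w k" "(w has_sum W) UNIV"
  shows "Hsum s u \<and> (Hs_norm s u)\<^sup>2 \<le> W"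
proof -
  have "Hsum s u"
    unfolding Hsum_def
    by (rule summable_on_comparison_test[of w]) (use assms in \<open>auto simp: summable_on_def\<close>)
  with has_sum_mono[OF Hs_norm_has_sum[OF this] assms(2)] assms(1) show ?thesis by blast
qed

lemma Hs_norm_coeff_le:
  assumes "Hsum s u"
  shows "bracket k powr s * cmod (L2_coeff u k) \<le> Hs_norm s u"
proof -
  have "(bracket k powr s * cmod (L2_coeff u k))\<^sup>2 \<le> (Hs_norm s u)\<^sup>2"
    using finite_sum_le_has_sum[OF Hs_norm_has_sum[OF assms], of "{k}"] by simp
  then show ?thesis by (rule power2_le_imp_le) (rule Hs_norm_nonneg)
qed

lemma Hsum_mono:
  assumes "Hsum s u" "r \<le> s"
  shows "Hsum r u \<and> Hs_norm r u \<le> Hs_norm s u"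
proof -
  have "Hsum r u \<and> (Hs_norm r u)\<^sup>2 \<le> (Hs_norm s u)\<^sup>2"
    by (rule Hsum_le[OF _ Hs_norm_has_sum[OF assms(1)]])
      (use assms(2) bracket_ge_1 in \<open>auto intro!: power_mono mult_right_mono powr_mono\<close>)
  then show ?thesis using power2_le_imp_le Hs_norm_nonneg by blast
qed

lemma Hs_0: "Hsum 0 u" "Hs_norm 0 u = norm u"
proof -
  show "Hsum 0 u" using summable_L2_coeff by (simp add: Hsum_def)
  show "Hs_norm 0 u = norm u"
    unfolding Hs_norm_def using infsumI[OF parseval[of u]] by simp
qed

lemma norm_le_Hs_norm: "Hsum s u \<Longrightarrow> s \<ge> 0 \<Longrightarrow> norm u \<le> Hs_norm s u"
  using Hsum_mono[of s u 0] by (simp add: Hs_0)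

text \<open>Mode by mode \<open>(a + b)^2 \<le> 2 a^2 + 2 b^2\<close>; the constant is harmless, as
  only membership and boundedness are drawn from it.\<close>

lemma Hsum_add:
  assumes "Hsum s u" "Hsum s v"
  shows "Hsum s (u + v) \<and> (Hs_norm s (u + v))\<^sup>2 \<le> 2 * (Hs_norm s u)\<^sup>2 + 2 * (Hs_norm s v)\<^sup>2"
proof (rule Hsum_le)
  show "((\<lambda>k. 2 * (bracket k powr s * cmod (L2_coeff u k))\<^sup>2 + 2 * (bracket k powr s * cmod (L2_coeff v k))\<^sup>2)
      has_sum 2 * (Hs_norm s u)\<^sup>2 + 2 * (Hs_norm s v)\<^sup>2) UNIV"
    by (intro has_sum_add has_sum_cmult_right Hs_norm_has_sum assms)
  fix k
  have "(cmod (L2_coeff (u + v) k))\<^sup>2 \<le> (cmod (L2_coeff u k) + cmod (L2_coeff v k))\<^sup>2"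
    unfolding L2_coeff_add by (intro power_mono norm_triangle_ineq) simp
  also have "\<dots> \<le> 2 * (cmod (L2_coeff u k))\<^sup>2 + 2 * (cmod (L2_coeff v k))\<^sup>2"
    using sum_squares_bound[of "cmod (L2_coeff u k)" "cmod (L2_coeff v k)"] by (simp add: power2_sum)
  finally show "(bracket k powr s * cmod (L2_coeff (u + v) k))\<^sup>2
      \<le> 2 * (bracket k powr s * cmod (L2_coeff u k))\<^sup>2 + 2 * (bracket k powr s * cmod (L2_coeff v k))\<^sup>2"
    using mult_left_mono[of "(cmod (L2_coeff (u + v) k))\<^sup>2"
        "2 * (cmod (L2_coeff u k))\<^sup>2 + 2 * (cmod (L2_coeff v k))\<^sup>2" "(bracket k powr s)\<^sup>2"]
    by (simp add: power_mult_distrib algebra_simps)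
qed

lemma bbm_field_coeff_decay:
  assumes r: "r \<ge> 0" and u: "Hsum r u" "Hs_norm r u \<le> M"
  shows "cmod (L2_coeff (bbm_field phi u) k) \<le> (M + 2 powr r * M\<^sup>2) * bracket k powr (- 1 - r)"
proof -
  have M: "M \<ge> 0" using Hs_norm_nonneg[of r u] u by linarith
  have nM: "norm u \<le> M" using norm_le_Hs_norm[OF u(1) r] u(2) by linarith
  have b: "bracket k powr r > 0" by simp
  have 1: "bracket k powr r * cmod (L2_coeff u k) \<le> M"
    using Hs_norm_coeff_le[OF u(1), of k] u(2) by linarith
  have 2: "bracket k powr r * cmod (prod_coeff u u k) \<le> 2 powr r * (2 * (M * M))"
    by (rule order_trans[OF prod_coeff_weighted_bound[OF r u(1)]])
      (intro mult_left_mono mult_mono u nM; simp add: M)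
  have "cmod (L2_coeff u k + prod_coeff u u k / 2) \<le> cmod (L2_coeff u k) + cmod (prod_coeff u u k) / 2"
    using norm_triangle_ineq[of "L2_coeff u k" "prod_coeff u u k / 2"] by (simp add: norm_divide)
  then have "bracket k powr r * cmod (L2_coeff u k + prod_coeff u u k / 2)
      \<le> bracket k powr r * (cmod (L2_coeff u k) + cmod (prod_coeff u u k) / 2)"
    using b by (intro mult_left_mono) auto
  also have "\<dots> \<le> M + 2 powr r * M\<^sup>2"
    using 1 2 by (simp add: distrib_left power2_eq_square)
  finally have "cmod (L2_coeff u k + prod_coeff u u k / 2) \<le> (M + 2 powr r * M\<^sup>2) / bracket k powr r"
    using b by (simp add: pos_le_divide_eq mult.commute)
  then have "cmod (L2_coeff (bbm_field phi u) k) \<le> (M + 2 powr r * M\<^sup>2) / bracket k powr r / bracket k"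
    unfolding bbm_field_coeff[OF BBM_symbol_phi] by (rule cmod_symbol_mult_le[OF BBM_symbol_phi])
  also have "\<dots> = (M + 2 powr r * M\<^sup>2) * bracket k powr (- 1 - r)"
    by (simp add: powr_diff powr_minus divide_inverse abs_of_pos mult_ac)
  finally show ?thesis .
qed

text \<open>For \<open>u\<close> bounded in \<open>H\<^sup>r\<close> the \<open>k\<close>-th coefficient of the vector field is
  \<open>O(\<langle>k\<rangle>\<^sup>-\<^sup>1\<^sup>-\<^sup>r)\<close>, which is square summable with weight \<open>\<langle>k\<rangle>\<^sup>r\<^sup>+\<^sup>1\<^sup>/\<^sup>4\<close>: a gain of a quarter derivative.\<close>

lemma regularity_step:
  assumes d: "\<And>t. t \<in> {-T..T} \<Longrightarrow> (u has_vector_derivative bbm_field phi (u t)) (at t within {-T..T})"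
    and r: "r \<ge> 0" "r' \<le> r + 1 / 4"
    and b: "\<And>t. t \<in> {-T..T} \<Longrightarrow> Hsum r (u t) \<and> Hs_norm r (u t) \<le> M"
  shows "\<exists>L. \<forall>t\<in>{-T..T}. \<forall>t'\<in>{-T..T}. Hsum r' (u t - u t') \<and> Hs_norm r' (u t - u t') \<le> L * \<bar>t - t'\<bar>"
proof -
  define K where "K = M + 2 powr r * M\<^sup>2"
  \<comment> \<open>Twice the exponent \<open>r' - 1 - r\<close> is at most \<open>- 3 / 2\<close>,
    which lies below the summability threshold -1.\<close>
  define W where "W = (\<Sum>\<^sub>\<infinity>k. bracket k powr (- (3 / 2)))"
  have W: "((\<lambda>k. bracket k powr (- (3 / 2))) has_sum W) UNIV"
    using has_sum_infsum[OF summable_bracket[of "3 / 2"]] by (simp add: W_def)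
  have W0: "W \<ge> 0" by (rule has_sum_nonneg[OF W]) simp
  have "Hsum r' (u t - u t') \<and> Hs_norm r' (u t - u t') \<le> (K * sqrt W) * \<bar>t - t'\<bar>"
    if t: "t \<in> {-T..T}" and t': "t' \<in> {-T..T}" for t t'
  proof -
    have K: "K \<ge> 0" using b[OF t] Hs_norm_nonneg[of r "u t"] by (simp add: K_def)
    have co: "cmod (L2_coeff (u t - u t') k) \<le> K * bracket k powr (- 1 - r) * \<bar>t - t'\<bar>" for k
    proof -
      \<comment> \<open>The mean value inequality is applied to each coefficient, since
        differentiability of \<open>u\<close> is known only in L^2 and not in the norm of order
        \<open>r'\<close>.\<close>
      have "norm (L2_coeff (u t) k - L2_coeff (u t') k) \<le> K * bracket k powr (- 1 - r) * norm (t - t')"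
      proof (rule differentiable_bound[OF convex_real_interval(5) _ _ t t'])
        fix \<tau> assume \<tau>: "\<tau> \<in> {-T..T}"
        show "((\<lambda>t. L2_coeff (u t) k) has_derivative (\<lambda>h. h *\<^sub>R L2_coeff (bbm_field phi (u \<tau>)) k)) (at \<tau> within {-T..T})"
          using has_vector_derivative_L2_coeff[OF d[OF \<tau>]] by (simp add: has_vector_derivative_def)
        show "onorm (\<lambda>h. h *\<^sub>R L2_coeff (bbm_field phi (u \<tau>)) k) \<le> K * bracket k powr (- 1 - r)"
        proof (rule onorm_le)
          fix h :: real
          show "norm (h *\<^sub>R L2_coeff (bbm_field phi (u \<tau>)) k) \<le> K * bracket k powr (- 1 - r) * norm h"
            using mult_left_mono[OF bbm_field_coeff_decay[OF r(1), of "u \<tau>" M k] abs_ge_zero[of h]] b[OF \<tau>]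
            by (simp add: K_def mult_ac)
        qed
      qed
      then show ?thesis by (simp add: L2_coeff_diff)
    qed
    have "Hsum r' (u t - u t') \<and> (Hs_norm r' (u t - u t'))\<^sup>2 \<le> (K * \<bar>t - t'\<bar>)\<^sup>2 * W"
    proof (rule Hsum_le)
      show "((\<lambda>k. (K * \<bar>t - t'\<bar>)\<^sup>2 * bracket k powr (- (3 / 2))) has_sum (K * \<bar>t - t'\<bar>)\<^sup>2 * W) UNIV"
        by (rule has_sum_cmult_right[OF W])
      fix k
      have "bracket k powr r' * cmod (L2_coeff (u t - u t') k)
          \<le> bracket k powr r' * (K * bracket k powr (- 1 - r) * \<bar>t - t'\<bar>)"
        by (intro mult_left_mono co) simp
      also have "\<dots> = (K * \<bar>t - t'\<bar>) * bracket k powr (r' + (- 1 - r))"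
        by (simp add: powr_add)
      also have "\<dots> \<le> (K * \<bar>t - t'\<bar>) * bracket k powr (- (3 / 4))"
        using K r(2) bracket_ge_1[of k] by (intro mult_left_mono powr_mono) auto
      finally have "(bracket k powr r' * cmod (L2_coeff (u t - u t') k))\<^sup>2
          \<le> ((K * \<bar>t - t'\<bar>) * bracket k powr (- (3 / 4)))\<^sup>2"
        by (rule power_mono) simp
      also have "\<dots> = (K * \<bar>t - t'\<bar>)\<^sup>2 * bracket k powr (- (3 / 2))"
        by (simp add: power_mult_distrib power2_eq_square flip: powr_add)
      finally show "(bracket k powr r' * cmod (L2_coeff (u t - u t') k))\<^sup>2
          \<le> (K * \<bar>t - t'\<bar>)\<^sup>2 * bracket k powr (- (3 / 2))" .
    qed
    moreover have "(K * \<bar>t - t'\<bar>)\<^sup>2 * W = (K * sqrt W * \<bar>t - t'\<bar>)\<^sup>2"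
      using W0 by (simp add: power_mult_distrib)
    ultimately show ?thesis
      using power2_le_imp_le[of "Hs_norm r' (u t - u t')" "K * sqrt W * \<bar>t - t'\<bar>"] K W0 by auto
  qed
  then show ?thesis by blast
qed

text \<open>Each step bounds the increment \<open>u t - u 0\<close> in a norm stronger by up to 1/4,
  and the data supply the rest; hence the cap \<open>min s\<close>. The start of the induction is
  continuity in L^2 on a compact interval.\<close>

lemma regularity_bounded:
  assumes d: "\<And>t. t \<in> {-T..T} \<Longrightarrow> (u has_vector_derivative bbm_field phi (u t)) (at t within {-T..T})"
    and T: "T > 0" and s: "s \<ge> 0" "Hsum s (u 0)"
  shows "\<exists>M. \<forall>t\<in>{-T..T}. Hsum (min s (real n / 4)) (u t) \<and> Hs_norm (min s (real n / 4)) (u t) \<le> M"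
proof (induction n)
  case 0
  have "continuous_on {-T..T} u"
    by (rule continuous_on_vector_derivative[OF d])
  then have "bounded (u ` {-T..T})"
    by (intro compact_imp_bounded compact_continuous_image) auto
  then show ?case using s by (auto simp: bounded_iff Hs_0)
next
  case (Suc n)
  let ?r = "min s (real n / 4)" and ?r' = "min s (real (Suc n) / 4)"
  obtain M where M: "\<And>t. t \<in> {-T..T} \<Longrightarrow> Hsum ?r (u t) \<and> Hs_norm ?r (u t) \<le> M"
    using Suc by blast
  obtain L where L: "\<And>t t'. t \<in> {-T..T} \<Longrightarrow> t' \<in> {-T..T} \<Longrightarrow>
      Hsum ?r' (u t - u t') \<and> Hs_norm ?r' (u t - u t') \<le> L * \<bar>t - t'\<bar>"
  proof -
    have "0 \<le> ?r" "?r' \<le> ?r + 1 / 4" using s by (auto simp: min_def)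
    from regularity_step[OF d this M] show ?thesis using that by blast
  qed
  have u0: "Hsum ?r' (u 0)" using Hsum_mono[OF s(2), of ?r'] by simp
  have "Hsum ?r' (u t) \<and> Hs_norm ?r' (u t) \<le> sqrt (2 * (\<bar>L\<bar> * T)\<^sup>2 + 2 * (Hs_norm ?r' (u 0))\<^sup>2)"
    if t: "t \<in> {-T..T}" for t
  proof -
    have l: "Hsum ?r' (u t - u 0)" "Hs_norm ?r' (u t - u 0) \<le> L * \<bar>t - 0\<bar>" using L[OF t, of 0] T by auto
    have "L * \<bar>t - 0\<bar> \<le> \<bar>L\<bar> * T" using t by (intro mult_mono) auto
    then have "(Hs_norm ?r' (u t - u 0))\<^sup>2 \<le> (\<bar>L\<bar> * T)\<^sup>2"
      using l(2) by (intro power_mono Hs_norm_nonneg) simp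
    with Hsum_add[OF l(1) u0] show ?thesis
      by (auto intro!: real_le_rsqrt)
  qed
  then show ?case by blast
qed

text \<open>Once \<open>u\<close> is bounded in H^s, one more step with target order
  \<open>s\<close> itself gives Lipschitz continuity in time with values in H^s.\<close>

lemma regularity:
  assumes d: "\<And>t. t \<in> {-T..T} \<Longrightarrow> (u has_vector_derivative bbm_field phi (u t)) (at t within {-T..T})"
    and T: "T > 0" and s: "s \<ge> 0" "Hsum s (u 0)"
  shows "\<exists>L. \<forall>t\<in>{-T..T}. Hsum s (u t) \<and>
    (\<forall>t'\<in>{-T..T}. Hs_norm s (u t - u t') \<le> L * \<bar>t - t'\<bar>)"
proof -
  obtain n :: nat where n: "4 * s \<le> real n" using real_arch_simple by blast
  then have min: "min s (real n / 4) = s" by simp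
  obtain M where M: "\<And>t. t \<in> {-T..T} \<Longrightarrow> Hsum s (u t) \<and> Hs_norm s (u t) \<le> M"
    using regularity_bounded[OF assms, of n] unfolding min by blast
  obtain L where "\<forall>t\<in>{-T..T}. \<forall>t'\<in>{-T..T}. Hsum s (u t - u t') \<and> Hs_norm s (u t - u t') \<le> L * \<bar>t - t'\<bar>"
    using regularity_step[OF d s(1) _ M, of s] by auto
  with M show ?thesis by blast
qed

section \<open>The Duhamel formula\<close>

lemma L2_coeff_propagator: "L2_coeff (propagator t u) k = exp (- \<i> * of_real (t * phi k)) * L2_coeff u k"
proof -
  have "cmod (exp (- \<i> * of_real (t * phi k))) = 1" for k
    using norm_exp_i_times[of "- t * phi k"] by simp
  then show ?thesis
    unfolding propagator_def
    by (intro multiplier_coeff) (simp add: norm_mult summable_L2_coeff)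
qed

lemma norm_propagator [simp]: "norm (propagator t u) = norm u"
proof (rule norm_eq_coeff)
  fix k
  show "cmod (L2_coeff (propagator t u) k) = cmod (L2_coeff u k)"
    using norm_exp_i_times[of "- t * phi k"] by (simp add: L2_coeff_propagator norm_mult)
qed

lemma bounded_linear_propagator: "bounded_linear (propagator t)"
proof (rule bounded_linear_intro[where K = 1])
  show "propagator t (u + v) = propagator t u + propagator t v" for u v
    by (rule L2_coeff_eqI) (simp add: L2_coeff_propagator L2_coeff_add distrib_left)
  show "propagator t (r *\<^sub>R u) = r *\<^sub>R propagator t u" for r u
    by (rule L2_coeff_eqI) (simp add: L2_coeff_propagator L2_coeff_scaleR)
qed simp

lemma propagator_propagator: "propagator t (propagator t' u) = propagator (t + t') u"
  by (rule L2_coeff_eqI) (simp add: L2_coeff_propagator ring_distribs exp_diff exp_minus field_simps exp_add)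

lemma propagator_0 [simp]: "propagator 0 u = u"
  by (rule L2_coeff_eqI) (simp add: L2_coeff_propagator)

lemma propagator_scaleC: "propagator t (scaleC c u) = scaleC c (propagator t u)"
  by (rule L2_coeff_eqI) (simp add: L2_coeff_propagator L2_coeff_scaleC)

lemma norm_scaleC: "norm (scaleC c u) = cmod c * norm u"
proof -
  have "norm (scaleC c u) = norm (cmod c *\<^sub>R u)"
    by (rule norm_eq_coeff) (simp add: L2_coeff_scaleC L2_coeff_scaleR norm_mult)
  then show ?thesis by simp
qed

lemma bounded_linear_scaleC: "bounded_linear (scaleC c)"
proof (rule bounded_linear_intro[where K = "cmod c"])
  show "scaleC c (u + v) = scaleC c u + scaleC c v" for u v
    by (rule L2_coeff_eqI) (simp add: L2_coeff_scaleC L2_coeff_add distrib_left)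
  show "scaleC c (r *\<^sub>R u) = r *\<^sub>R scaleC c u" for r u
    by (rule L2_coeff_eqI) (simp add: L2_coeff_scaleC L2_coeff_scaleR)
qed (simp add: norm_scaleC mult.commute)

text \<open>The generator is bounded, since \<open>\<bar>phi k\<bar> \<le> 1\<close>, so the group
  is Lipschitz in the operator norm.\<close>

lemma norm_propagator_diff: "norm (propagator a u - propagator b u) \<le> \<bar>a - b\<bar> * norm u"
proof -
  have "norm (propagator a u - propagator b u) \<le> norm (\<bar>a - b\<bar> *\<^sub>R u)"
  proof (rule norm_le_coeff)
    fix k
    let ?A = "exp (\<i> * of_real (- a * phi k))" and ?B = "exp (\<i> * of_real (- b * phi k))"
    have "cmod (?A - ?B) = cmod (?B * (exp (\<i> * of_real ((b - a) * phi k)) - 1))"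
      by (simp add: right_diff_distrib flip: exp_add) (simp add: algebra_simps)
    also have "\<dots> = 2 * \<bar>sin ((b - a) * phi k / 2)\<bar>"
      using dist_exp_i_1[of "(b - a) * phi k"] norm_exp_i_times[of "- b * phi k"]
      by (simp add: norm_mult dist_norm)
    also have "\<dots> \<le> 2 * \<bar>(b - a) * phi k / 2\<bar>"
      by (intro mult_left_mono abs_sin_x_le_abs_x) simp
    also have "\<dots> \<le> \<bar>a - b\<bar>"
      using mult_left_mono[OF abs_phi_le_1[of k] abs_ge_zero[of "a - b"]] by (simp add: abs_mult abs_minus_commute)
    finally have "cmod (?A - ?B) \<le> \<bar>a - b\<bar>" .
    then show "cmod (L2_coeff (propagator a u - propagator b u) k) \<le> cmod (L2_coeff (\<bar>a - b\<bar> *\<^sub>R u) k)"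
      by (simp add: L2_coeff_diff L2_coeff_propagator L2_coeff_scaleR norm_mult mult_right_mono flip: left_diff_distrib)
  qed
  then show ?thesis by simp
qed

section \<open>The quadratic term and continuity of the Duhamel integrand\<close>

definition phi_square :: "L2_torus \<Rightarrow> L2_torus" where
  "phi_square u = phi_D (\<lambda>x. (rep_L2_torus u x)\<^sup>2)"

lemma phi_prod_coeff_bound: "cmod (of_real (phi k) * prod_coeff u v k) \<le> norm u * norm v / bracket k"
proof -
  have "\<bar>phi k\<bar> * cmod (prod_coeff u v k) \<le> 1 / bracket k * (norm u * norm v)"
    by (rule mult_mono[OF abs_phi_le prod_coeff_bound]) (simp_all add: less_imp_le[OF bracket_pos])
  then show ?thesis by (simp add: norm_mult)
qed

lemma L2_coeff_phi_square: "L2_coeff (phi_square u) k = phi k * prod_coeff u u k"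
proof -
  have "(\<lambda>k. (cmod (of_real (phi k) * fourier_coeff (\<lambda>x. (rep_L2_torus u x)\<^sup>2) k))\<^sup>2) summable_on UNIV"
    unfolding prod_coeff_square by (rule summable_bracket_bound[OF phi_prod_coeff_bound])
  from multiplier_coeff[OF this] show ?thesis by (simp add: phi_square_def phi_D_def prod_coeff_square)
qed

lemma norm_phi_square_diff: "norm (phi_square u - phi_square v) \<le> sqrt bracket_sum * (norm (u - v) * norm (u + v))"
proof (rule norm_le_bracket)
  fix k
  have "L2_coeff (phi_square u - phi_square v) k = phi k * prod_coeff (u - v) (u + v) k"
    by (simp only: L2_coeff_diff L2_coeff_phi_square prod_coeff_diff_square[symmetric] right_diff_distrib)
  then show "cmod (L2_coeff (phi_square u - phi_square v) k) \<le> norm (u - v) * norm (u + v) / bracket k"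
    by (simp only: phi_prod_coeff_bound)
qed simp

lemma continuous_on_phi_square:
  assumes "continuous_on S u"
  shows "continuous_on S (\<lambda>t. phi_square (u t))"
  unfolding continuous_on_def
proof
  fix t assume t: "t \<in> S"
  have u: "(u \<longlongrightarrow> u t) (at t within S)" using assms t by (simp add: continuous_on_def)
  have "((\<lambda>\<tau>. sqrt bracket_sum * (norm (u \<tau> - u t) * norm (u \<tau> + u t))) \<longlongrightarrow> sqrt bracket_sum * (norm (u t - u t) * norm (u t + u t))) (at t within S)"
    by (intro tendsto_intros u)
  then have lim: "((\<lambda>\<tau>. sqrt bracket_sum * (norm (u \<tau> - u t) * norm (u \<tau> + u t))) \<longlongrightarrow> 0) (at t within S)"
    by simp
  have "((\<lambda>\<tau>. norm (phi_square (u \<tau>) - phi_square (u t))) \<longlongrightarrow> 0) (at t within S)"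
    by (rule tendsto_sandwich[OF _ _ tendsto_const lim]) (simp_all add: norm_phi_square_diff)
  then show "((\<lambda>\<tau>. phi_square (u \<tau>)) \<longlongrightarrow> phi_square (u t)) (at t within S)"
    by (rule LIM_zero_cancel[OF tendsto_norm_zero_cancel])
qed

lemma continuous_on_propagator:
  assumes "continuous_on S y" "continuous_on S a"
  shows "continuous_on S (\<lambda>\<tau>. propagator (a \<tau>) (y \<tau>))"
  unfolding continuous_on_def
proof
  fix t assume t: "t \<in> S"
  have y: "(y \<longlongrightarrow> y t) (at t within S)" and a: "(a \<longlongrightarrow> a t) (at t within S)"
    using assms t by (simp_all add: continuous_on_def)
  have le: "norm (propagator (a \<tau>) (y \<tau>) - propagator (a t) (y t))
      \<le> norm (y \<tau> - y t) + \<bar>a \<tau> - a t\<bar> * norm (y t)" for \<tau>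
  proof -
    have "propagator (a \<tau>) (y \<tau>) - propagator (a t) (y t)
        = propagator (a \<tau>) (y \<tau> - y t) + (propagator (a \<tau>) (y t) - propagator (a t) (y t))"
      by (simp add: linear_diff[OF bounded_linear.linear[OF bounded_linear_propagator]])
    also have "norm \<dots> \<le> norm (y \<tau> - y t) + \<bar>a \<tau> - a t\<bar> * norm (y t)"
      using norm_propagator_diff by (intro order_trans[OF norm_triangle_ineq] add_mono) auto
    finally show ?thesis .
  qed
  have "((\<lambda>\<tau>. norm (y \<tau> - y t) + \<bar>a \<tau> - a t\<bar> * norm (y t)) \<longlongrightarrow> norm (y t - y t) + \<bar>a t - a t\<bar> * norm (y t)) (at t within S)"
    by (intro tendsto_intros y a)
  then have lim: "((\<lambda>\<tau>. norm (y \<tau> - y t) + \<bar>a \<tau> - a t\<bar> * norm (y t)) \<longlongrightarrow> 0) (at t within S)"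
    by simp
  have "((\<lambda>\<tau>. norm (propagator (a \<tau>) (y \<tau>) - propagator (a t) (y t))) \<longlongrightarrow> 0) (at t within S)"
    by (rule tendsto_sandwich[OF _ _ tendsto_const lim]) (simp_all add: le)
  then show "((\<lambda>\<tau>. propagator (a \<tau>) (y \<tau>)) \<longlongrightarrow> propagator (a t) (y t)) (at t within S)"
    by (rule LIM_zero_cancel[OF tendsto_norm_zero_cancel])
qed

section \<open>Duhamel formula and differential equation\<close>

lemma oriented_integral_linear:
  fixes f :: "real \<Rightarrow> 'a::banach"
  assumes "bounded_linear h" "continuous_on {-T..T} f" "t \<in> {-T..T}"
  shows "h (oriented_integral 0 t f) = oriented_integral 0 t (\<lambda>\<tau>. h (f \<tau>))"
proof -
  have i: "f integrable_on {a..b}" if "{a..b} \<subseteq> {-T..T}" for a b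
    using that by (intro integrable_continuous_interval continuous_on_subset[OF assms(2)])
  show ?thesis
    using assms(3) integral_linear[OF i assms(1), of 0 t] integral_linear[OF i assms(1), of t 0]
    by (auto simp: oriented_integral_def o_def linear_neg[OF bounded_linear.linear[OF assms(1)]])
qed

lemma oriented_integral_FTC:
  fixes g :: "real \<Rightarrow> 'a::banach"
  assumes d: "\<And>\<tau>. \<tau> \<in> {-T..T} \<Longrightarrow> (g has_vector_derivative g' \<tau>) (at \<tau> within {-T..T})" and t: "t \<in> {-T..T}"
  shows "oriented_integral 0 t g' = g t - g 0"
proof -
  have "(g' has_integral (g b - g a)) {a..b}" if "a \<le> b" "{a..b} \<subseteq> {-T..T}" for a b
    by (rule fundamental_theorem_of_calculus[OF that(1)])
      (use that in \<open>auto intro: has_vector_derivative_within_subset[OF d]\<close>)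
  from this[of 0 t] this[of t 0] show ?thesis
    using t by (auto simp: oriented_integral_def integral_unique)
qed

text \<open>Variation of constants, carried out for one Fourier coefficient at a time, where the
  group is a scalar exponential.\<close>

lemma duhamel_of_ODE:
  assumes d: "\<And>t. t \<in> {-T..T} \<Longrightarrow> (u has_vector_derivative bbm_field phi (u t)) (at t within {-T..T})"
  shows "bbm_solution T (u 0) u"
  unfolding bbm_solution_def phi_square_def[symmetric]
proof
  fix t assume t: "t \<in> {-T..T}"
  have cu: "continuous_on {-T..T} u"
    by (rule continuous_on_vector_derivative[OF d])
  let ?h = "\<lambda>\<tau>. propagator (t - \<tau>) (phi_square (u \<tau>))"
  have ch: "continuous_on {-T..T} ?h"
    by (intro continuous_on_propagator continuous_on_phi_square cu continuous_intros)
  show "u t = propagator t (u 0) - scaleC (\<i> / 2) (oriented_integral 0 t ?h)"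
  proof (rule L2_coeff_eqI)
    fix k
    \<comment> \<open>The coefficient of \<open>propagator (t - \<tau>) (u \<tau>)\<close>: its
      derivative loses the linear part of the field, and it runs from the freely evolved data at 0
      to \<open>u t\<close>.\<close>
    define g where "g \<tau> = exp (of_real (\<tau> - t) * (\<i> * phi k)) * L2_coeff (u \<tau>) k" for \<tau>
    have g: "(g has_vector_derivative - (\<i> / 2) * L2_coeff (?h \<tau>) k) (at \<tau> within {-T..T})"
      if "\<tau> \<in> {-T..T}" for \<tau>
    proof -
      have e: "((\<lambda>\<tau>. exp (of_real (\<tau> - t) * (\<i> * phi k))) has_vector_derivative
          exp (of_real (\<tau> - t) * (\<i> * phi k)) * (\<i> * phi k)) (at \<tau> within {-T..T})"
      proof -
        have eq: "exp (of_real (\<tau> - t) * A) = exp (- (t *\<^sub>R A)) * exp (\<tau> *\<^sub>R A)" for \<tau> and A :: complex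
          by (simp add: scaleR_conv_of_real left_diff_distrib flip: exp_add)
        show ?thesis
          unfolding eq mult.assoc
          by (intro has_vector_derivative_mult_right exp_scaleR_has_vector_derivative_right)
      qed
      have "(g has_vector_derivative exp (of_real (\<tau> - t) * (\<i> * phi k)) * L2_coeff (bbm_field phi (u \<tau>)) k
          + exp (of_real (\<tau> - t) * (\<i> * phi k)) * (\<i> * phi k) * L2_coeff (u \<tau>) k) (at \<tau> within {-T..T})"
        unfolding g_def
        by (rule has_vector_derivative_mult[OF e has_vector_derivative_L2_coeff[OF d[OF that]]])
      moreover have "- \<i> * of_real ((t - \<tau>) * phi k) = of_real (\<tau> - t) * (\<i> * phi k)"
        by (simp add: algebra_simps)
      ultimately show ?thesis
        by (simp add: L2_coeff_propagator L2_coeff_phi_square bbm_field_coeff BBM_symbol_phi algebra_simps)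
    qed
    have "L2_coeff (scaleC (\<i> / 2) (oriented_integral 0 t ?h)) k
        = oriented_integral 0 t (\<lambda>\<tau>. - (- (\<i> / 2) * L2_coeff (?h \<tau>) k))"
      using oriented_integral_linear[OF bounded_linear_compose[OF bounded_linear_L2_coeff bounded_linear_scaleC] ch t]
      by (simp add: L2_coeff_scaleC)
    also have "\<dots> = - g t - - g 0"
      by (rule oriented_integral_FTC[OF has_vector_derivative_minus[OF g] t])
    also have "\<dots> = exp (- \<i> * of_real (t * phi k)) * L2_coeff (u 0) k - L2_coeff (u t) k"
      by (simp add: g_def mult_ac)
    finally show "L2_coeff (u t) k = L2_coeff (propagator t (u 0) - scaleC (\<i> / 2) (oriented_integral 0 t ?h)) k"
      by (simp add: L2_coeff_diff L2_coeff_propagator)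
  qed
qed

text \<open>Undoing the free evolution removes \<open>t\<close> from the integrand, so that the
  right-hand side can be differentiated in \<open>t\<close>.\<close>

lemma duhamel_interaction:
  assumes cu: "continuous_on {-T..T} u" and s: "bbm_solution T x u" and t: "t \<in> {-T..T}"
  shows "propagator (- t) (u t) = x - scaleC (\<i> / 2) (oriented_integral 0 t (\<lambda>\<tau>. propagator (- \<tau>) (phi_square (u \<tau>))))"
proof -
  have c: "continuous_on {-T..T} (\<lambda>\<tau>. propagator (t - \<tau>) (phi_square (u \<tau>)))"
    by (intro continuous_on_propagator continuous_on_phi_square cu continuous_intros)
  have "u t = propagator t x - scaleC (\<i> / 2) (oriented_integral 0 t (\<lambda>\<tau>. propagator (t - \<tau>) (phi_square (u \<tau>))))"
    using s t by (simp add: bbm_solution_def phi_square_def)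
  then show ?thesis
    by (simp add: linear_diff[OF bounded_linear.linear[OF bounded_linear_propagator]] propagator_propagator
        propagator_scaleC oriented_integral_linear[OF bounded_linear_propagator c t])
qed

text \<open>In the interaction picture both solutions become differentiable, and their distance is
  unchanged because the propagator is an isometry. Continuity on the compact interval bounds both,
  which makes the quadratic term Lipschitz along them; Gronwall concludes.\<close>

lemma duhamel_unique:
  assumes c: "continuous_on {-T..T} u" "continuous_on {-T..T} v"
    and s: "bbm_solution T x u" "bbm_solution T x v" and t: "t \<in> {-T..T}"
  shows "u t = v t"
proof -
  have T: "T \<ge> 0" using t by simp
  have "bounded (u ` {-T..T} \<union> v ` {-T..T})"
    by (simp add: compact_imp_bounded compact_continuous_image c)
  then obtain B where "\<forall>y\<in>u ` {-T..T} \<union> v ` {-T..T}. norm y \<le> B"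
    unfolding bounded_iff by blast
  then have B: "norm (u t) \<le> B" "norm (v t) \<le> B" if "t \<in> {-T..T}" for t
    using that by auto
  have B0: "B \<ge> 0" using B(1)[OF t] norm_ge_zero[of "u t"] by linarith
  define z where "z t = propagator (- t) (u t) - propagator (- t) (v t)" for t
  have nz: "norm (z t) = norm (u t - v t)" for t
    by (simp add: z_def flip: linear_diff[OF bounded_linear.linear[OF bounded_linear_propagator]])
  have der: "((\<lambda>t. propagator (- t) (w t)) has_vector_derivative - scaleC (\<i> / 2) (propagator (- t) (phi_square (w t))))
      (at t within {-T..T})"
    if w: "continuous_on {-T..T} w" "bbm_solution T x w" and t: "t \<in> {-T..T}" for w t
  proof -
    have c: "continuous_on {-T..T} (\<lambda>\<tau>. propagator (- \<tau>) (phi_square (w \<tau>)))"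
      by (intro continuous_on_propagator continuous_on_phi_square w continuous_intros)
    have "((\<lambda>t. x - scaleC (\<i> / 2) (oriented_integral 0 t (\<lambda>\<tau>. propagator (- \<tau>) (phi_square (w \<tau>))))) has_vector_derivative
        0 - scaleC (\<i> / 2) (propagator (- t) (phi_square (w t)))) (at t within {-T..T})"
      by (intro has_vector_derivative_diff has_vector_derivative_const
          bounded_linear.has_vector_derivative[OF bounded_linear_scaleC] oriented_integral_deriv c t) (use T in auto)
    then have *: "((\<lambda>t. x - scaleC (\<i> / 2) (oriented_integral 0 t (\<lambda>\<tau>. propagator (- \<tau>) (phi_square (w \<tau>))))) has_vector_derivative
        - scaleC (\<i> / 2) (propagator (- t) (phi_square (w t)))) (at t within {-T..T})" by simp
    show ?thesis
      by (rule has_vector_derivative_transform[OF t _ *]) (rule duhamel_interaction[OF w])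
  qed
  have "(norm (z t))\<^sup>2 \<le> ((norm (z 0))\<^sup>2 + 0\<^sup>2) * exp ((2 * (sqrt bracket_sum * B) + 1) * \<bar>t\<bar>)"
  proof (rule gronwall_norm[OF _ _ _ _ t])
    fix t assume t: "t \<in> {-T..T}"
    show "(z has_vector_derivative - scaleC (\<i> / 2) (propagator (- t) (phi_square (u t)))
        - - scaleC (\<i> / 2) (propagator (- t) (phi_square (v t)))) (at t within {-T..T})"
      unfolding z_def by (intro has_vector_derivative_diff der c s t)
    have "- scaleC (\<i> / 2) (propagator (- t) (phi_square (u t))) - - scaleC (\<i> / 2) (propagator (- t) (phi_square (v t)))
        = - scaleC (\<i> / 2) (propagator (- t) (phi_square (u t) - phi_square (v t)))"
      by (simp add: linear_diff[OF bounded_linear.linear[OF bounded_linear_propagator]]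
          linear_diff[OF bounded_linear.linear[OF bounded_linear_scaleC]])
    also have "norm \<dots> \<le> 1 / 2 * (sqrt bracket_sum * (norm (u t - v t) * norm (u t + v t)))"
      by (simp add: norm_scaleC norm_divide norm_phi_square_diff)
    also have "\<dots> \<le> 1 / 2 * (sqrt bracket_sum * (norm (u t - v t) * (B + B)))"
      using norm_triangle_le[OF add_mono[OF B(1)[OF t] B(2)[OF t]]]
      by (intro mult_left_mono) (simp_all add: bracket_sum_nonneg)
    also have "\<dots> = sqrt bracket_sum * B * norm (z t) + 0" by (simp add: nz)
    finally show "norm (- scaleC (\<i> / 2) (propagator (- t) (phi_square (u t)))
        - - scaleC (\<i> / 2) (propagator (- t) (phi_square (v t)))) \<le> sqrt bracket_sum * B * norm (z t) + 0" .
  qed (simp_all add: bracket_sum_nonneg B0)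
  moreover have "z 0 = 0"
    using duhamel_interaction[OF c(1) s(1), of 0] duhamel_interaction[OF c(2) s(2), of 0] T by (simp add: z_def)
  ultimately have "norm (u t - v t) = 0" by (simp add: nz[symmetric])
  then show ?thesis by simp
qed

text \<open>For \<open>s \<ge> 0\<close> the H^s norm dominates the L^2 norm; uniqueness in
  \<open>Xs\<close> thereby reduces to uniqueness among L^2-continuous solutions.\<close>

lemma Xs_continuous:
  assumes u: "u \<in> Xs s T" and s: "s \<ge> 0"
  shows "continuous_on {-T..T} u"
  unfolding continuous_on_def
proof
  fix t assume t: "t \<in> {-T..T}"
  have uH: "Hsum s (u \<tau>)" if "\<tau> \<in> {-T..T}" for \<tau>
    using u that by (auto simp: Xs_def Hs_iff)
  have lim: "((\<lambda>\<tau>. Hs_norm s (u \<tau> - u t)) \<longlongrightarrow> 0) (at t within {-T..T})"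
    using u t by (auto simp: Xs_def)
  have "\<forall>\<^sub>F \<tau> in at t within {-T..T}. norm (u \<tau> - u t) \<le> Hs_norm s (u \<tau> - u t)"
    unfolding eventually_at_filter
  proof (intro always_eventually allI impI)
    fix \<tau> assume "\<tau> \<noteq> t" "\<tau> \<in> {-T..T}"
    have "Hsum s (- u t)"
      using uH[OF t] by (simp add: Hsum_def linear_neg[OF bounded_linear.linear[OF bounded_linear_L2_coeff]])
    then have "Hsum s (u \<tau> - u t)"
      using Hsum_add[OF uH[OF \<open>\<tau> \<in> {-T..T}\<close>], of "- u t"] by simp
    then show "norm (u \<tau> - u t) \<le> Hs_norm s (u \<tau> - u t)"
      by (rule norm_le_Hs_norm[OF _ s])
  qed
  then have "((\<lambda>\<tau>. norm (u \<tau> - u t)) \<longlongrightarrow> 0) (at t within {-T..T})"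
    by (rule tendsto_sandwich[OF _ _ tendsto_const lim, rotated]) simp
  then show "(u \<longlongrightarrow> u t) (at t within {-T..T})"
    by (rule LIM_zero_cancel[OF tendsto_norm_zero_cancel])
qed

lemma bbm_exists:
  assumes s: "s \<ge> 0" and x: "x \<in> Hs s" and T: "T > 0"
  shows "\<exists>u. u \<in> Xs s T \<and> bbm_solution T x u"
proof -
  have x': "real_valued x" "Hsum s x" using x by (simp_all add: Hs_iff)
  obtain U where U0: "U 0 = x" and Ur: "\<And>t. t \<in> {-T..T} \<Longrightarrow> real_valued (U t)"
    and U: "\<And>t. t \<in> {-T..T} \<Longrightarrow> (U has_vector_derivative bbm_field phi (U t)) (at t within {-T..T})"
    using global_L2_solution[OF x'(1) T] by blast
  \<comment> \<open>Elements of \<open>Xs\<close> are \<open>undefined\<close> off the interval,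
    whereas the flow lives on the whole line.\<close>
  define u where "u = restrict U {-T..T}"
  have u0: "u 0 = x" using T U0 by (simp add: u_def)
  have d: "(u has_vector_derivative bbm_field phi (u t)) (at t within {-T..T})" if "t \<in> {-T..T}" for t
    by (rule has_vector_derivative_transform[OF that]) (use that U in \<open>auto simp: u_def\<close>)
  have sol: "bbm_solution T x u" using duhamel_of_ODE[OF d] by (simp add: u0)
  have "Hsum s (u 0)" using x' by (simp add: u0)
  from regularity[OF d T s this]
  obtain L where L: "\<And>t. t \<in> {-T..T} \<Longrightarrow> Hsum s (u t)"
    "\<And>t t'. t \<in> {-T..T} \<Longrightarrow> t' \<in> {-T..T} \<Longrightarrow> Hs_norm s (u t - u t') \<le> L * \<bar>t - t'\<bar>"
    by blast
  have "((\<lambda>\<tau>. Hs_norm s (u \<tau> - u t)) \<longlongrightarrow> 0) (at t within {-T..T})" if t: "t \<in> {-T..T}" for t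
  proof (rule tendsto_sandwich[OF _ _ tendsto_const])
    show "\<forall>\<^sub>F \<tau> in at t within {-T..T}. 0 \<le> Hs_norm s (u \<tau> - u t)" by (simp add: Hs_norm_nonneg)
    show "\<forall>\<^sub>F \<tau> in at t within {-T..T}. Hs_norm s (u \<tau> - u t) \<le> L * \<bar>\<tau> - t\<bar>"
      unfolding eventually_at_filter using L(2) t by (intro always_eventually) auto
    have "((\<lambda>\<tau>. L * \<bar>\<tau> - t\<bar>) \<longlongrightarrow> L * \<bar>t - t\<bar>) (at t within {-T..T})"
      by (intro tendsto_intros)
    then show "((\<lambda>\<tau>. L * \<bar>\<tau> - t\<bar>) \<longlongrightarrow> 0) (at t within {-T..T})" by simp
  qed
  moreover have "u \<in> {-T..T} \<rightarrow>\<^sub>E Hs s"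
    using L(1) Ur by (auto simp: u_def Hs_iff)
  ultimately have "u \<in> Xs s T" by (simp add: Xs_def)
  with sol show ?thesis by blast
qed

theorem theorem3p4:
  fixes s :: real and u0 :: L2_torus
  assumes "s \<ge> 0" and "u0 \<in> Hs s"
  shows "\<forall>T>0. \<exists>!u. u \<in> Xs s T \<and> bbm_solution T u0 u"
proof (intro allI impI ex_ex1I)
  fix T :: real assume T: "T > 0"
  show "\<exists>u. u \<in> Xs s T \<and> bbm_solution T u0 u"
    by (rule bbm_exists[OF assms T])
  fix u v assume "u \<in> Xs s T \<and> bbm_solution T u0 u" "v \<in> Xs s T \<and> bbm_solution T u0 v"
  then have u: "u \<in> Xs s T" "bbm_solution T u0 u" and v: "v \<in> Xs s T" "bbm_solution T u0 v" by auto
  have "u \<in> extensional {-T..T}" "v \<in> extensional {-T..T}"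
    using u(1) v(1) by (simp_all add: Xs_def PiE_def)
  then show "u = v"
    using duhamel_unique[OF Xs_continuous[OF u(1) assms(1)] Xs_continuous[OF v(1) assms(1)] u(2) v(2)]
    by (rule extensionalityI)
qed

end
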